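(* Let $n\geq 3$ and let $\Lambda$ be a normal subgroup of $\mathrm{SL}(n,\mathbb{Z})$ that is non-central, i.e. not contained in the centre of $\mathrm{SL}(n,\mathbb{Z})$. Then $\Lambda$ has the $R_\infty$-property.
   Context: For a group $G$ and an endomorphism $\phi:G\to G$, the group $G$ acts on itself by $g.x=gx\phi(g^{-1})$; the orbits are called the $\phi$-twisted conjugacy classes. The Reidemeister number $R(\phi)$ is the cardinality of the set of $\phi$-twisted conjugacy classes. A group $G$ has the $R_\infty$-property if $R(\phi)=\infty$, i.e. there are infinitely many $\phi$-twisted conjugacy classes, for every automorphism $\phi$ of $G$. *)

theory Defs
  imports
    "Jordan_Normal_Form.Determinant"
    "HOL-Algebra.Group_Action"
    "HOL-Library.Extended_Nat"
begin

definition SL_int :: "nat \<Rightarrow> int mat monoid" where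
  "SL_int n =
     \<lparr>carrier = {A \<in> carrier_mat n n. det A = 1}, mult = (*), one = 1\<^sub>m n\<rparr>"

lemma group_SL_int: "group (SL_int n)"
proof (rule groupI)
  fix A assume "A \<in> carrier (SL_int n)"
  then have A: "A \<in> carrier_mat n n" and dA: "det A = 1"
    by (auto simp: SL_int_def)
  have B: "adj_mat A \<in> carrier_mat n n" and AB: "A * adj_mat A = 1\<^sub>m n"
    and BA: "adj_mat A * A = 1\<^sub>m n"
    using adj_mat[OF A] dA by auto
  have "det (adj_mat A) = 1"
    using det_mult[OF A B] dA AB by simp
  then show "\<exists>B\<in>carrier (SL_int n). B \<otimes>\<^bsub>SL_int n\<^esub> A = \<one>\<^bsub>SL_int n\<^esub>"
    using B BA by (auto simp: SL_int_def)
qed (auto simp: SL_int_def det_mult intro: assoc_mult_mat)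

definition group_center :: "('a, 'b) monoid_scheme \<Rightarrow> 'a set" where
  "group_center G =
     {z \<in> carrier G. \<forall>g\<in>carrier G. z \<otimes>\<^bsub>G\<^esub> g = g \<otimes>\<^bsub>G\<^esub> z}"

text \<open>The restriction to the carrier makes each translation an element of
  \<^term>\<open>Bij (carrier G)\<close>, as \<^locale>\<open>group_action\<close> requires.\<close>

definition twisted_action ::
    "('a, 'b) monoid_scheme \<Rightarrow> ('a \<Rightarrow> 'a) \<Rightarrow> 'a \<Rightarrow> 'a \<Rightarrow> 'a" where
  "twisted_action G \<phi> =
     (\<lambda>g. \<lambda>x\<in>carrier G. g \<otimes>\<^bsub>G\<^esub> x \<otimes>\<^bsub>G\<^esub> \<phi> (inv\<^bsub>G\<^esub> g))"

lemma (in group) group_action_twisted_action: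
  assumes phi: "\<phi> \<in> hom G G"
  shows "group_action G (carrier G) (twisted_action G \<phi>)"
proof -
  interpret ph: group_hom G G \<phi>
    using phi by unfold_locales
  have comp: "twisted_action G \<phi> g (twisted_action G \<phi> h x) = twisted_action G \<phi> (g \<otimes> h) x"
    if "g \<in> carrier G" "h \<in> carrier G" "x \<in> carrier G" for g h x
    using that by (simp add: twisted_action_def inv_mult_group m_assoc)
  have one: "twisted_action G \<phi> \<one> x = x" if "x \<in> carrier G" for x
    using that by (simp add: twisted_action_def)
  have closed: "twisted_action G \<phi> g x \<in> carrier G"
    if "g \<in> carrier G" "x \<in> carrier G" for g x
    using that by (simp add: twisted_action_def)
  have bij: "twisted_action G \<phi> g \<in> Bij (carrier G)" if g: "g \<in> carrier G" for g
  proof -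
    have "bij_betw (twisted_action G \<phi> g) (carrier G) (carrier G)"
      by (rule bij_betw_byWitness[where f' = "twisted_action G \<phi> (inv g)"])
        (use g in \<open>auto simp: comp one closed\<close>)
    then show ?thesis
      by (simp add: Bij_def twisted_action_def)
  qed
  have "twisted_action G \<phi> (g \<otimes> h) =
      compose (carrier G) (twisted_action G \<phi> g) (twisted_action G \<phi> h)"
    if "g \<in> carrier G" "h \<in> carrier G" for g h
  proof
    fix x
    show "twisted_action G \<phi> (g \<otimes> h) x =
        compose (carrier G) (twisted_action G \<phi> g) (twisted_action G \<phi> h) x"
      using that comp[of g h x]
      by (cases "x \<in> carrier G") (simp_all add: compose_def, simp add: twisted_action_def)
  qed
  then show ?thesis
    by (auto simp: group_action_def group_hom_def group_hom_axioms_def hom_def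
        BijGroup_def bij group_BijGroup[unfolded BijGroup_def] is_group)
qed

definition twisted_conjugacy_classes ::
    "('a, 'b) monoid_scheme \<Rightarrow> ('a \<Rightarrow> 'a) \<Rightarrow> 'a set set" where
  "twisted_conjugacy_classes G \<phi> = orbits G (carrier G) (twisted_action G \<phi>)"

definition reidemeister_number :: "('a, 'b) monoid_scheme \<Rightarrow> ('a \<Rightarrow> 'a) \<Rightarrow> enat" where
  "reidemeister_number G \<phi> =
     (if finite (twisted_conjugacy_classes G \<phi>)
      then enat (card (twisted_conjugacy_classes G \<phi>)) else \<infinity>)"

definition R_infinity_property :: "('a, 'b) monoid_scheme \<Rightarrow> bool" where
  "R_infinity_property G \<longleftrightarrow> (\<forall>\<phi>\<in>iso G G. reidemeister_number G \<phi> = \<infinity>)"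

end

theory Submission
  imports Defs "HOL-Library.Function_Algebras"
    "HOL-Computational_Algebra.Fundamental_Theorem_Algebra"
begin

text \<open>
  A non-central normal subgroup \<open>\<Lambda>\<close> contains all elementary matrices \<open>E\<^sub>i\<^sub>j(m)\<close> for some
  \<open>m > 0\<close>, by commutators with transvections. Let \<open>\<phi>\<close> be an injective endomorphism of \<open>\<Lambda>\<close>. Since
  \<open>E\<^sub>i\<^sub>j(m\<^sup>2)\<close> is a central commutator in a Heisenberg group, the eigenvalues of its image are roots
  of unity, so for a suitable multiple \<open>M\<close> of \<open>m\<close> the matrices \<open>\<phi>(E\<^sub>i\<^sub>j(M))\<close> are unipotent. Their
  logarithms satisfy the Steinberg relations of \<open>sl\<^sub>n\<close>, and counting weights shows that a nontrivial
  representation of these relations in dimension \<open>n\<close> is the standard one or its dual. Hence there is an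
  invertible complex matrix \<open>A\<close> with \<open>\<phi>(x) A = A \<theta>(x)\<close> on the group generated by the \<open>E\<^sub>i\<^sub>j(M)\<close>, where
  \<open>\<theta>(x)\<close> is \<open>x\<close> or its inverse transpose. For \<open>n \<ge> 3\<close> this group contains multiples of all integral
  transvections, in particular conjugates of elementary matrices by elements of \<open>\<Lambda>\<close>; comparing how
  \<open>\<phi>(g)\<close> and \<open>\<theta>(g)\<close> conjugate them gives \<open>\<phi>(g) A = c A \<theta>(g)\<close> with \<open>c\<^sup>n = 1\<close> for all \<open>g \<in> \<Lambda>\<close>. With
  \<open>Z = x A\<close>, the number \<open>(tr Z)\<^sup>n\<close>, respectively \<open>tr (Z\<^sup>-\<^sup>1 Z\<^sup>T)\<close>, is therefore constant on twisted
  conjugacy classes, and it takes infinitely many values.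
\<close>

section \<open>Linear operators on a finite-dimensional subspace\<close>

text \<open>Comparing \<phi> with \<theta> leaves an unknown scalar \<open>c\<close> with
  \<open>c ^ n = 1\<close>, and the two invariants are built to ignore it. If \<theta> is the
  inclusion, twisted conjugation by \<open>g\<close> replaces \<open>Z\<close> by \<open>c\<close>
  times a conjugate, so the n-th power of the trace survives. If \<theta> is the inverse transpose,
  it replaces \<open>Z\<close> by \<open>c g Z g^T\<close>, so the cosquare \<open>Z^-1 Z^T\<close>
  is conjugated and \<open>c\<close> cancels. The passage from the group to its Lie relations is
  algebraic: for unipotent \<open>Y\<close> the vector \<open>Y^a x\<close> is polynomial in the
  natural number \<open>a\<close>, its linear coefficient is the logarithm applied to
  \<open>x\<close>, and a commutator relation becomes a bracket relation by comparing coefficients.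
  Weights are counted because joint eigenvectors with distinct eigenvalues are independent. A
  highest weight vector of nonzero weight already produces \<open>n\<close> different weights, so in
  dimension \<open>n\<close> there is no room for another one. Operators are defined on a whole
  type, and only \<open>span B\<close> is finite-dimensional.\<close>

locale fin_dim_subspace = vector_space scale
  for scale :: "complex \<Rightarrow> 'b::ab_group_add \<Rightarrow> 'b" (infixr \<open>*s\<close> 75) +
  fixes B :: "'b set"
  assumes finite_B: "finite B"
begin

abbreviation lin :: "('b \<Rightarrow> 'b) \<Rightarrow> bool" where
  "lin \<equiv> Modules.module_hom scale scale"

lemma lin_funpow: "lin f \<Longrightarrow> lin (f ^^ k)"
  by (induction k) (simp_all add: module_hom_iff module_axioms)

lemma linI:
  "(\<And>x y. f (x + y) = f x + f y) \<Longrightarrow> (\<And>c x. f (c *s x) = c *s f x) \<Longrightarrow> lin f"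
  by unfold_locales auto

section \<open>Polynomials in an operator, eigenvectors and nilpotency\<close>

definition poly_op :: "('b \<Rightarrow> 'b) \<Rightarrow> complex poly \<Rightarrow> 'b \<Rightarrow> 'b" where
  "poly_op f p w = (\<Sum>k\<le>degree p. coeff p k *s (f ^^ k) w)"

lemma poly_op_0 [simp]: "poly_op f 0 w = 0"
  by (simp add: poly_op_def)

lemma poly_op_pCons:
  assumes "lin f"
  shows "poly_op f (pCons a p) w = a *s w + f (poly_op f p w)"
proof (cases "p = 0")
  case True
  then show ?thesis
    by (simp add: poly_op_def module_hom.zero[OF assms])
next
  case False
  then show ?thesis
    by (simp add: poly_op_def sum.atMost_Suc_shift module_hom.sum[OF assms]
        module_hom.scale[OF assms] del: sum.atMost_Suc)
qed

lemma poly_op_add: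
  assumes "lin f"
  shows "poly_op f (p + q) w = poly_op f p w + poly_op f q w"
  by (induction p q rule: poly_induct2)
    (simp_all add: poly_op_pCons[OF assms] module_hom.add[OF assms] scale_left_distrib
      algebra_simps)

lemma poly_op_smult:
  assumes "lin f"
  shows "poly_op f (smult c p) w = c *s poly_op f p w"
  by (induction p)
    (simp_all add: poly_op_pCons[OF assms] module_hom.scale[OF assms] scale_right_distrib)

lemma poly_op_linear_factor:
  assumes "lin f"
  shows "poly_op f ([:-a, 1:] * q) w = f (poly_op f q w) - a *s poly_op f q w"
proof -
  have "[:-a, 1:] * q = pCons 0 q + smult (-a) q"
    by simp
  then show ?thesis
    by (simp only: poly_op_add[OF assms] poly_op_smult[OF assms] poly_op_pCons[OF assms]) simp
qed

lemma poly_op_shift: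
  assumes "lin f"
  shows "poly_op f p (f w) = f (poly_op f p w)"
  by (simp add: poly_op_def module_hom.sum[OF assms] module_hom.scale[OF assms]
      funpow_swap1)

lemma funpow_invariant:
  "f ` U \<subseteq> U \<Longrightarrow> w \<in> U \<Longrightarrow> (f ^^ k) w \<in> U"
  by (induction k) auto

lemma poly_op_in:
  assumes "subspace U" "f ` U \<subseteq> U" "w \<in> U"
  shows "poly_op f p w \<in> U"
  unfolding poly_op_def
  by (intro subspace_sum subspace_scale assms funpow_invariant)

text \<open>Strip one linear factor \<open>X - a\<close> off \<open>p\<close>: either the quotient
  \<open>q\<close> still annihilates \<open>w\<close>, or \<open>q(f) w\<close> is an eigenvector
  for \<open>a\<close>. That the eigenvalue is a root of \<open>p\<close> is recorded for the
  nilpotency criterion.\<close>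

lemma eigenvector_of_annihilator:
  assumes f: "lin f" and U: "subspace U" "f ` U \<subseteq> U"
    and w: "w \<in> U" "w \<noteq> 0" and p: "p \<noteq> 0" "poly_op f p w = 0"
  shows "\<exists>v\<in>U. v \<noteq> 0 \<and> (\<exists>a. poly p a = 0 \<and> f v = a *s v)"
  using p
proof (induction "degree p" arbitrary: p rule: less_induct)
  case less
  show ?case
  proof (cases "degree p = 0")
    case True
    then obtain c where "p = [:c:]"
      by (meson degree_eq_zeroE)
    with less.prems w have False
      by (simp add: poly_op_def)
    then show ?thesis ..
  next
    case False
    then have "\<not> constant (poly p)"
      by (simp add: constant_degree)
    then obtain a where a: "poly p a = 0"
      using fundamental_theorem_of_algebra by blast
    then obtain q where q: "p = [:-a, 1:] * q"
      by (metis dvdE poly_eq_0_iff_dvd)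
    have q0: "q \<noteq> 0"
      using q less.prems by auto
    then have dq: "degree q < degree p"
      using q by (simp add: degree_mult_eq del: mult_pCons_left)
    show ?thesis
    proof (cases "poly_op f q w = 0")
      case True
      from less.hyps[OF dq q0 True] show ?thesis
        using q by (metis mult_zero_right poly_mult)
    next
      case ne: False
      have "f (poly_op f q w) = a *s poly_op f q w"
        using less.prems(2) unfolding q poly_op_linear_factor[OF f] by simp
      then show ?thesis
        using ne a poly_op_in[OF U w(1)] by blast
    qed
  qed
qed

text \<open>A family rather than a set, since iterates of an operator may repeat; a repetition is
  itself a relation, with coefficients 1 and -1.\<close>

lemma dependent_family:
  assumes I: "finite I" "card I > card B" and x: "\<And>s. s \<in> I \<Longrightarrow> x s \<in> span B"
  shows "\<exists>c. (\<exists>s\<in>I. c s \<noteq> 0) \<and> (\<Sum>s\<in>I. c s *s x s) = 0"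
proof (cases "inj_on x I")
  case True
  then have "card (x ` I) > card B"
    using I by (simp add: card_image)
  then have "dependent (x ` I)"
    using independent_span_bound[OF finite_B, of "x ` I"] x by fastforce
  then obtain u v where u: "v \<in> x ` I" "u v \<noteq> 0" "(\<Sum>v\<in>x ` I. u v *s v) = 0"
    using dependent_finite[of "x ` I"] I by auto
  have "(\<Sum>s\<in>I. u (x s) *s x s) = 0"
    using u(3) by (simp add: sum.reindex[OF True])
  then show ?thesis
    using u by (intro exI[of _ "u \<circ> x"]) auto
next
  case False
  then obtain s t where st: "s \<in> I" "t \<in> I" "s \<noteq> t" "x s = x t"
    by (auto simp: inj_on_def)
  define c :: "_ \<Rightarrow> complex" where "c = (\<lambda>r. if r = s then 1 else if r = t then -1 else 0)"
  have "(\<Sum>r\<in>I. c r *s x r) = (\<Sum>r\<in>{s, t}. c r *s x r)"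
    by (rule sum.mono_neutral_right) (use I st in \<open>auto simp: c_def\<close>)
  also have "\<dots> = 0"
    using st by (simp add: c_def)
  finally show ?thesis
    using st by (intro exI[of _ c]) (auto simp: c_def)
qed

text \<open>The \<open>card B + 1\<close> vectors \<open>w\<close>, \<open>f w\<close>, ... are
  dependent. The degree bound makes the exponent in the nilpotency criterion uniform in
  \<open>w\<close>.\<close>

lemma annihilator_exists:
  assumes U: "f ` U \<subseteq> U" "U \<subseteq> span B" and w: "w \<in> U"
  shows "\<exists>p. p \<noteq> 0 \<and> degree p \<le> card B \<and> poly_op f p w = 0"
proof -
  obtain c where c: "\<exists>k\<in>{..card B}. c k \<noteq> 0"
    and s: "(\<Sum>k\<le>card B. c k *s (f ^^ k) w) = 0"
    using dependent_family[of "{..card B}" "\<lambda>k. (f ^^ k) w"] funpow_invariant[OF U(1) w] U(2)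
    by auto
  define p where "p = (\<Sum>k\<le>card B. monom (c k) k)"
  have cf: "coeff p k = (if k \<le> card B then c k else 0)" for k
    by (simp add: p_def coeff_sum)
  have d: "degree p \<le> card B"
    by (rule degree_le) (simp add: cf)
  have "poly_op f p w = (\<Sum>k\<le>card B. coeff p k *s (f ^^ k) w)"
    unfolding poly_op_def
    by (rule sum.mono_neutral_left) (use d in \<open>auto simp: coeff_eq_0\<close>)
  also have "\<dots> = 0"
    using s by (simp add: cf)
  finally have "poly_op f p w = 0" .
  moreover have "p \<noteq> 0"
    using c cf by (metis atMost_iff coeff_0)
  ultimately show ?thesis
    using d by blast
qed

lemma eigenvector_exists:
  assumes f: "lin f" and U: "subspace U" "f ` U \<subseteq> U" "U \<subseteq> span B"
    and w: "w \<in> U" "w \<noteq> 0"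
  shows "\<exists>v\<in>U. v \<noteq> 0 \<and> (\<exists>a. f v = a *s v)"
  using annihilator_exists[OF U(2,3) w(1)] eigenvector_of_annihilator[OF f U(1,2) w] by blast

text \<open>If \<open>p\<close> annihilates \<open>w \<noteq> 0\<close>, some root of
  \<open>p\<close> is an eigenvalue and hence 0, so \<open>X\<close> divides \<open>p\<close> and
  the quotient annihilates \<open>f w\<close>; induction on \<open>p\<close> then gives
  \<open>f^(degree p) w = 0\<close>.\<close>

lemma nilpotent_of_eigenvalues:
  assumes f: "lin f" and S: "f ` span B \<subseteq> span B"
    and ev: "\<And>v a. v \<in> span B \<Longrightarrow> v \<noteq> 0 \<Longrightarrow> f v = a *s v \<Longrightarrow> a = 0"
    and w: "w \<in> span B"
  shows "(f ^^ card B) w = 0"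
proof -
  have *: "(f ^^ degree p) w = 0" if "p \<noteq> 0" "poly_op f p w = 0" "w \<in> span B" for p w
    using that
  proof (induction p arbitrary: w)
    case 0
    then show ?case by simp
  next
    case (pCons c q)
    show ?case
    proof (cases "w = 0")
      case True
      then show ?thesis
        by (simp add: module_hom.zero[OF lin_funpow[OF f]])
    next
      case False
      obtain v a where v: "v \<in> span B" "v \<noteq> 0" "poly (pCons c q) a = 0" "f v = a *s v"
        using eigenvector_of_annihilator[OF f subspace_span S pCons.prems(3) False] pCons.prems
        by blast
      with ev have "a = 0" by blast
      with v have c: "c = 0" by simp
      then have q: "q \<noteq> 0"
        using pCons.prems by auto
      have "poly_op f q (f w) = 0"
        using pCons.prems(2) c by (simp add: poly_op_pCons[OF f] poly_op_shift[OF f])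
      then have "(f ^^ degree q) (f w) = 0"
        using pCons.IH[OF q] pCons.prems(3) S by blast
      then show ?thesis
        using q by (simp add: funpow_swap1)
    qed
  qed
  obtain p where p: "p \<noteq> 0" "degree p \<le> card B" "poly_op f p w = 0"
    using annihilator_exists[OF S order.refl w] by blast
  have "(f ^^ card B) w = (f ^^ (card B - degree p)) ((f ^^ degree p) w)"
    using p(2) by (simp flip: funpow_add[THEN fun_cong, unfolded comp_def])
  also have "\<dots> = 0"
    using *[OF p(1,3) w] by (simp add: module_hom.zero[OF lin_funpow[OF f]])
  finally show ?thesis .
qed

text \<open>Applying \<open>h k - wt t k\<close> to a relation kills the term of \<open>t\<close>
  and multiplies the others by differences of weights; for each \<open>s\<close> the index
  \<open>k\<close> is chosen to separate \<open>s\<close> from \<open>t\<close>.\<close>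

lemma joint_eigenvectors_independent:
  assumes "finite I"
    and h: "\<And>k. k \<in> K \<Longrightarrow> lin (h k)"
    and x: "\<And>s k. s \<in> I \<Longrightarrow> k \<in> K \<Longrightarrow> h k (x s) = wt s k *s x s"
    and x0: "\<And>s. s \<in> I \<Longrightarrow> x s \<noteq> 0"
    and d: "\<And>s t. s \<in> I \<Longrightarrow> t \<in> I \<Longrightarrow> s \<noteq> t \<Longrightarrow> \<exists>k\<in>K. wt s k \<noteq> wt t k"
    and sum0: "(\<Sum>s\<in>I. c s *s x s) = 0"
  shows "\<forall>s\<in>I. c s = 0"
  using assms(1) x x0 d sum0
proof (induction I arbitrary: c rule: finite_induct)
  case empty
  then show ?case by simp
next
  case (insert t I)
  have zero: "c s = 0" if s: "s \<in> I" for s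
  proof -
    obtain k where k: "k \<in> K" "wt s k \<noteq> wt t k"
      using insert.prems(3)[of s t] insert.hyps s by auto
    have "0 = h k (\<Sum>s\<in>insert t I. c s *s x s) - wt t k *s (\<Sum>s\<in>insert t I. c s *s x s)"
      using insert.prems(4) by (simp add: module_hom.zero[OF h[OF k(1)]])
    also have "\<dots> = (\<Sum>s\<in>insert t I. (c s * (wt s k - wt t k)) *s x s)"
      unfolding module_hom.sum[OF h[OF k(1)]] scale_sum_right sum_subtractf[symmetric]
      by (rule sum.cong)
        (simp_all add: module_hom.scale[OF h[OF k(1)]] insert.prems(1)[OF _ k(1)]
          algebra_simps scale_left_diff_distrib)
    also have "\<dots> = (\<Sum>s\<in>I. (c s * (wt s k - wt t k)) *s x s)"
      using insert.hyps by simp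
    finally have "\<forall>s\<in>I. c s * (wt s k - wt t k) = 0"
      using insert.IH[of "\<lambda>s. c s * (wt s k - wt t k)"] insert.prems by auto
    with s k show ?thesis by auto
  qed
  then have "c t *s x t = 0"
    using insert.prems(4) insert.hyps by simp
  then have "c t = 0"
    using insert.prems(2) by auto
  with zero show ?case by auto
qed

text \<open>The dimension count behind both the classification by weights and the root of unity
  argument.\<close>

lemma card_joint_eigenvectors_le:
  assumes "finite I"
    and "\<And>k. k \<in> K \<Longrightarrow> lin (h k)"
    and "\<And>s k. s \<in> I \<Longrightarrow> k \<in> K \<Longrightarrow> h k (x s) = wt s k *s x s"
    and "\<And>s. s \<in> I \<Longrightarrow> x s \<noteq> 0"
    and "\<And>s t. s \<in> I \<Longrightarrow> t \<in> I \<Longrightarrow> s \<noteq> t \<Longrightarrow> \<exists>k\<in>K. wt s k \<noteq> wt t k"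
    and S: "\<And>s. s \<in> I \<Longrightarrow> x s \<in> span B"
  shows "card I \<le> card B"
proof (rule ccontr)
  assume "\<not> ?thesis"
  then obtain c where "\<exists>s\<in>I. c s \<noteq> 0" "(\<Sum>s\<in>I. c s *s x s) = 0"
    using dependent_family[of I x] assms(1) S by auto
  with joint_eigenvectors_independent[of I K h x wt c] assms(1-5) show False
    by blast
qed

end

section \<open>Lie algebra representations of sl(n) in dimension n\<close>

text \<open>The relations are those of the off-diagonal matrix units of sl_n; the bracket of
  \<open>e i j\<close> with \<open>e j i\<close> is unconstrained and defines the operator
  \<open>h i j\<close>. \<open>e_in\<close> is required of all \<open>x\<close>, which fits
  logarithms of operators \<open>Y\<close> with \<open>Y x - x\<close> always in the span.\<close>

locale steinberg_rep = fin_dim_subspace scale B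
  for scale :: "complex \<Rightarrow> 'b::ab_group_add \<Rightarrow> 'b" (infixr \<open>*s\<close> 75) and B +
  fixes n :: nat and e :: "nat \<Rightarrow> nat \<Rightarrow> 'b \<Rightarrow> 'b"
  assumes n3: "n \<ge> 3" and card_B: "card B = n"
    and lin_e: "\<lbrakk>i < n; j < n; i \<noteq> j\<rbrakk> \<Longrightarrow> lin (e i j)"
    and e_in: "\<lbrakk>i < n; j < n; i \<noteq> j\<rbrakk> \<Longrightarrow> e i j x \<in> span B"
    and nil_e: "\<lbrakk>i < n; j < n; i \<noteq> j\<rbrakk> \<Longrightarrow> \<exists>k. \<forall>x. (e i j ^^ k) x = 0"
    and e_bracket: "\<lbrakk>i < n; j < n; k < n; i \<noteq> j; j \<noteq> k; i \<noteq> k\<rbrakk> \<Longrightarrow>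
      e i j (e j k x) = e j k (e i j x) + e i k x"
    and e_comm: "\<lbrakk>i < n; j < n; k < n; l < n; i \<noteq> j; k \<noteq> l; j \<noteq> k; i \<noteq> l\<rbrakk> \<Longrightarrow>
      e i j (e k l x) = e k l (e i j x)"
begin

abbreviation ok :: "nat \<Rightarrow> nat \<Rightarrow> bool" where
  "ok i j \<equiv> i < n \<and> j < n \<and> i \<noteq> j"

section \<open>The coroot operators and their brackets\<close>

definition h :: "nat \<Rightarrow> nat \<Rightarrow> 'b \<Rightarrow> 'b" where
  "h i j x = e i j (e j i x) - e j i (e i j x)"

lemma e_simps:
  assumes "ok i j"
  shows "e i j (x + y) = e i j x + e i j y" "e i j (x - y) = e i j x - e i j y"
    "e i j (- x) = - e i j x" "e i j 0 = 0" "e i j (c *s x) = c *s e i j x"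
  using lin_e[of i j] assms
  by (simp_all add: module_hom.add module_hom.diff module_hom.neg module_hom.zero module_hom.scale)

lemma lin_h: "ok i j \<Longrightarrow> lin (h i j)"
  by (rule linI) (simp_all add: h_def e_simps algebra_simps scale_right_diff_distrib)

lemma h_simps:
  assumes "ok i j"
  shows "h i j (x + y) = h i j x + h i j y" "h i j (x - y) = h i j x - h i j y"
    "h i j (- x) = - h i j x" "h i j 0 = 0" "h i j (c *s x) = c *s h i j x"
  using lin_h[of i j] assms
  by (simp_all add: module_hom.add module_hom.diff module_hom.neg module_hom.zero module_hom.scale)

lemma h_antisym: "h j i x = - h i j x"
  by (simp add: h_def)

lemma e_e: "e i j (e j i x) = e j i (e i j x) + h i j x"
  by (simp add: h_def)

text \<open>Jacobi: \<open>[h_ij, e_ik] = [e_ij, [e_ji, e_ik]] = [e_ij, e_jk] = e_ik\<close>,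
  because \<open>e i j\<close> and \<open>e i k\<close> commute.\<close>

lemma h_e_row:
  assumes "ok i j" "ok i k" "j \<noteq> k"
  shows "h i j (e i k x) = e i k (h i j x) + e i k x"
proof -
  have "e i j (e j i (e i k x)) = e i j (e i k (e j i x)) + e i j (e j k x)"
    using assms e_bracket[of j i k x] by (simp add: e_simps)
  moreover have "e i j (e i k (e j i x)) = e i k (e i j (e j i x))"
    using assms e_comm[of i j i k] by simp
  moreover have "e j i (e i j (e i k x)) = e i k (e j i (e i j x)) + e j k (e i j x)"
    using assms e_comm[of i j i k] e_bracket[of j i k] by simp
  moreover have "e i j (e j k x) = e j k (e i j x) + e i k x"
    using assms e_bracket[of i j k] by simp
  ultimately show ?thesis
    using assms by (simp add: h_def e_simps)
qed

lemma h_e_col: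
  assumes "ok i j" "ok k j" "i \<noteq> k"
  shows "h i j (e k j x) = e k j (h i j x) + e k j x"
proof -
  have "e k j (e j i x) = e j i (e k j x) + e k i x"
    using assms e_bracket[of k j i x] by simp
  then have "e i j (e j i (e k j x)) = e i j (e k j (e j i x)) - e i j (e k i x)"
    using assms by (simp add: e_simps)
  moreover have "e i j (e k j (e j i x)) = e k j (e i j (e j i x))"
    using assms e_comm[of i j k j] by simp
  moreover have "e j i (e i j (e k j x)) = e k j (e j i (e i j x)) - e k i (e i j x)"
    using assms e_comm[of i j k j] e_bracket[of k j i] by simp
  moreover have "e k i (e i j x) = e i j (e k i x) + e k j x"
    using assms e_bracket[of k i j] by simp
  ultimately show ?thesis
    using assms by (simp add: h_def e_simps)
qed

text \<open>A third index writes \<open>e i j\<close> as a bracket of two vectors of weight one.\<close>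

lemma h_e_same:
  assumes "ok i j"
  shows "h i j (e i j x) = e i j (h i j x) + 2 *s e i j x"
proof -
  have "\<exists>p<n. p \<noteq> i \<and> p \<noteq> j"
  proof -
    have "card ({..<n} - {i, j}) \<ge> 1"
      using n3 assms by (subst card_Diff_subset) auto
    then have "{..<n} - {i, j} \<noteq> {}" by fastforce
    then show ?thesis by blast
  qed
  then obtain p where p: "p < n" "p \<noteq> i" "p \<noteq> j" by blast
  have ij: "e i j y = e i p (e p j y) - e p j (e i p y)" for y
    using e_bracket[of i p j y] assms p by simp
  have r: "h i j (e i p y) = e i p (h i j y) + e i p y" for y
    using h_e_row[of i j p y] assms p by simp
  have c: "h i j (e p j y) = e p j (h i j y) + e p j y" for y
    using h_e_col[of i j p y] assms p by simp
  show ?thesis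
    using assms p
    by (simp add: ij r c h_simps e_simps scale_left_distrib[of 1 1, simplified])
qed

text \<open>The pairing of the root eps_k - eps_l with the coroot of the pair (i, j).\<close>

definition wc :: "nat \<Rightarrow> nat \<Rightarrow> nat \<Rightarrow> nat \<Rightarrow> int" where
  "wc i j k l = of_bool (i = k) - of_bool (i = l) - (of_bool (j = k) - of_bool (j = l))"

lemma h_e:
  assumes "ok i j" "ok k l"
  shows "h i j (e k l x) = e k l (h i j x) + of_int (wc i j k l) *s e k l x"
proof -
  consider (a) "k = i" "l = j" | (b) "k = j" "l = i" | (c) "k = i" "l \<noteq> j" | (d) "k = j" "l \<noteq> i"
    | (e) "l = j" "k \<noteq> i" | (f) "l = i" "k \<noteq> j" | (g) "k \<noteq> i" "k \<noteq> j" "l \<noteq> i" "l \<noteq> j"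
    by blast
  then show ?thesis
  proof cases
    case a
    then show ?thesis using h_e_same[of i j x] assms by (simp add: wc_def)
  next
    case b
    then show ?thesis
      using h_e_same[of j i x] assms by (simp add: wc_def h_antisym[of i j] e_simps)
  next
    case c
    then show ?thesis using h_e_row[of i j l x] assms by (simp add: wc_def)
  next
    case d
    then show ?thesis
      using h_e_row[of j i l x] assms by (simp add: wc_def h_antisym[of i j] e_simps)
  next
    case e
    then show ?thesis using h_e_col[of i j k x] assms by (simp add: wc_def)
  next
    case f
    then show ?thesis
      using h_e_col[of j i k x] assms by (simp add: wc_def h_antisym[of i j] e_simps)
  next
    case g
    then show ?thesis
      using assms e_comm[of i j k l] e_comm[of j i k l] by (simp add: wc_def h_def e_simps)
  qed
qed

lemma wc_flip: "wc i j l k = - wc i j k l"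
  by (simp add: wc_def)

lemma h_h:
  assumes "ok i j" "ok k l"
  shows "h i j (h k l x) = h k l (h i j x)"
  unfolding h_def[of k l]
  using assms by (simp add: h_simps h_e e_simps wc_flip[of i j l k] algebra_simps)

text \<open>Expand \<open>e i k\<close> as the bracket of \<open>e i j\<close> and
  \<open>e j k\<close>. Additivity is what later lets the eigenvalues of the simple operators
  \<open>h i (Suc i)\<close> determine all others.\<close>

lemma h_add:
  assumes "ok i j" "ok j k" "ok i k"
  shows "h i k x = h i j x + h j k x"
proof -
  have ik: "e i k y = e i j (e j k y) - e j k (e i j y)" for y
    using e_bracket[of i j k y] assms by simp
  have 1: "e k i (e j k y) = e j k (e k i y) - e j i y" for y
    using e_bracket[of j k i y] assms by simp
  have 2: "e k i (e i j y) = e i j (e k i y) + e k j y" for y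
    using e_bracket[of k i j y] assms by simp
  show ?thesis
    unfolding h_def ik using assms by (simp add: 1 2 e_simps algebra_simps)
qed

lemma h_pow:
  assumes "ok i j" "ok k l"
  shows "h i j ((e k l ^^ r) x) = (e k l ^^ r) (h i j x) + (of_nat r * of_int (wc i j k l)) *s (e k l ^^ r) x"
proof (induction r)
  case (Suc r)
  then show ?case
    using assms by (simp add: h_e e_simps algebra_simps scale_left_distrib)
qed simp

text \<open>The sl_2 identity \<open>[e^(r+1), f] = (r+1) e^r (h + r)\<close>. It serves twice in
  the search for a highest weight: for the top power of \<open>e 0 (n - 1)\<close> and for the
  powers of a simple lowering operator.\<close>

lemma sl2_commutation:
  assumes ij: "ok i j"
  shows "(e i j ^^ Suc r) (e j i x) = e j i ((e i j ^^ Suc r) x)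
    + of_nat (Suc r) *s ((e i j ^^ r) (h i j x) + of_nat r *s (e i j ^^ r) x)"
proof (induction r)
  case 0
  then show ?case by (simp add: h_def)
next
  case (Suc r)
  let ?y = "(e i j ^^ Suc r) x" and ?z = "(e i j ^^ Suc r) (h i j x)"
  have w: "wc i j i j = 2"
    using ij by (simp add: wc_def)
  have "(e i j ^^ Suc (Suc r)) (e j i x) = e i j ((e i j ^^ Suc r) (e j i x))"
    by simp
  also have "\<dots> = e i j (e j i ?y) + of_nat (Suc r) *s (?z + of_nat r *s ?y)"
    unfolding Suc.IH by (simp only: e_simps[OF ij] funpow.simps(2) o_apply)
  also have "e i j (e j i ?y) = e j i (e i j ?y) + (?z + (of_nat (Suc r) * 2) *s ?y)"
    using h_pow[OF ij ij, of "Suc r" x] by (simp add: e_e[of i j] w)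
  finally have "(e i j ^^ Suc (Suc r)) (e j i x) = e j i (e i j ?y) + (?z + (of_nat (Suc r) * 2) *s ?y)
      + of_nat (Suc r) *s (?z + of_nat r *s ?y)" .
  also have "\<dots> = e j i (e i j ?y) + of_nat (Suc (Suc r)) *s (?z + of_nat (Suc r) *s ?y)"
  proof -
    have "(?z + (of_nat (Suc r) * 2) *s ?y) + of_nat (Suc r) *s (?z + of_nat r *s ?y)
       = (1 + of_nat (Suc r)) *s ?z + (of_nat (Suc r) * 2 + of_nat (Suc r) * of_nat r) *s ?y"
      by (simp only: scale_left_distrib scale_right_distrib scale_scale scale_one add_ac)
    also have "\<dots> = of_nat (Suc (Suc r)) *s ?z + (of_nat (Suc (Suc r)) * of_nat (Suc r)) *s ?y"
      by (simp add: algebra_simps)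
    finally show ?thesis
      by (simp only: scale_right_distrib scale_scale add.assoc)
  qed
  finally show ?case by simp
qed

section \<open>Weights and their number\<close>

definition weight_vec :: "'b \<Rightarrow> (nat \<Rightarrow> int) \<Rightarrow> bool" where
  "weight_vec x \<mu> \<longleftrightarrow> (\<forall>i j. ok i j \<longrightarrow> h i j x = of_int (\<mu> i - \<mu> j) *s x)"

abbreviation shift :: "nat \<Rightarrow> nat \<Rightarrow> (nat \<Rightarrow> int) \<Rightarrow> nat \<Rightarrow> int" where
  "shift k l \<mu> \<equiv> (\<lambda>m. \<mu> m + of_bool (m = k) - of_bool (m = l))"

lemma weight_vec_e:
  assumes "weight_vec x \<mu>" "ok k l"
  shows "weight_vec (e k l x) (shift k l \<mu>)"
  using assms unfolding weight_vec_def
  by (auto simp: h_e e_simps wc_def algebra_simps simp flip: scale_left_distrib scale_left_diff_distrib)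

text \<open>\<open>h\<close> sees only the differences of a weight, so \<mu> is determined up to an
  additive constant on the first \<open>n\<close> coordinates; the common sum \<open>s\<close> fixes
  that constant and \<open>F_ext\<close> fixes the remaining coordinates. Distinct members of
  \<open>F\<close> are then distinct joint eigenvalues.\<close>

lemma card_weights_le:
  assumes "finite F"
    and F: "\<And>\<mu>. \<mu> \<in> F \<Longrightarrow> (\<exists>x\<in>span B. x \<noteq> 0 \<and> weight_vec x \<mu>)"
    and F_sum: "\<And>\<mu>. \<mu> \<in> F \<Longrightarrow> (\<Sum>m<n. \<mu> m) = s"
    and F_ext: "\<And>\<mu> m. \<mu> \<in> F \<Longrightarrow> m \<ge> n \<Longrightarrow> \<mu> m = 0"
  shows "card F \<le> n"
proof -
  obtain x where x: "\<And>\<mu>. \<mu> \<in> F \<Longrightarrow> x \<mu> \<in> span B \<and> x \<mu> \<noteq> 0 \<and> weight_vec (x \<mu>) \<mu>"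
    using F by metis
  have "card F \<le> card B"
  proof (rule card_joint_eigenvectors_le[where h = "\<lambda>(i, j). h i j" and K = "{(i, j). ok i j}"
        and x = x and wt = "\<lambda>\<mu> (i, j). of_int (\<mu> i - \<mu> j)"])
    show "\<exists>k\<in>{(i, j). ok i j}. (case k of (i, j) \<Rightarrow> complex_of_int (\<mu> i - \<mu> j)) \<noteq>
        (case k of (i, j) \<Rightarrow> complex_of_int (\<nu> i - \<nu> j))"
      if \<mu>: "\<mu> \<in> F" and \<nu>: "\<nu> \<in> F" and "\<mu> \<noteq> \<nu>" for \<mu> \<nu>
    proof (rule ccontr)
      assume "\<not> ?thesis"
      then have eq: "\<mu> i - \<mu> j = \<nu> i - \<nu> j" if "ok i j" for i j
        using that by (auto simp flip: of_int_diff)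
      have c: "\<mu> i = \<nu> i + (\<mu> 0 - \<nu> 0)" if "i < n" for i
        using eq[of i 0] that n3 by (cases "i = 0") auto
      have "(\<Sum>m<n. \<mu> m) = (\<Sum>m<n. \<nu> m + (\<mu> 0 - \<nu> 0))"
        by (rule sum.cong) (use c in blast)+
      also have "\<dots> = (\<Sum>m<n. \<nu> m) + int n * (\<mu> 0 - \<nu> 0)"
        by (simp add: sum.distrib)
      finally have "(\<Sum>m<n. \<mu> m) = (\<Sum>m<n. \<nu> m) + int n * (\<mu> 0 - \<nu> 0)" .
      then have "\<mu> 0 - \<nu> 0 = 0"
        using F_sum \<mu> \<nu> n3 by simp
      then have "\<mu> = \<nu>"
        using c F_ext[OF \<mu>] F_ext[OF \<nu>] by (metis add_0_right ext linorder_not_le)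
      with \<open>\<mu> \<noteq> \<nu>\<close> show False ..
    qed
  qed (use x lin_h \<open>finite F\<close> in \<open>auto simp: weight_vec_def\<close>)
  then show ?thesis
    by (simp add: card_B)
qed

abbreviation unit :: "nat \<Rightarrow> nat \<Rightarrow> int" where
  "unit q \<equiv> (\<lambda>m. of_bool (m = q))"

text \<open>The vectors \<open>v\<close> and \<open>e q z v\<close> carry the weights
  \<open>unit q\<close>, which already exhaust dimension \<open>n\<close>. Hence
  \<open>e i j (u q)\<close> with \<open>j \<noteq> q\<close> vanishes: its weight would have a
  negative entry at \<open>j\<close>. The index \<open>z\<close> is free because the dual case uses
  the last index in place of the first.\<close>

lemma standard_basis:
  assumes v: "v \<in> span B" "v \<noteq> 0" and z: "z < n" and wt: "weight_vec v (unit z)"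
    and ann: "\<And>j. ok z j \<Longrightarrow> e z j v = 0"
  shows "\<exists>u. (\<forall>q<n. u q \<in> span B)
    \<and> (\<forall>c. (\<Sum>q<n. c q *s u q) = 0 \<longrightarrow> (\<forall>q<n. c q = 0))
    \<and> (\<forall>i j q. ok i j \<and> q < n \<longrightarrow> e i j (u q) = (if q = j then u i else 0))"
proof -
  define u where "u = (\<lambda>q. if q = z then v else e q z v)"
  have lower: "e z q (e q z v) = v" if "ok z q" for q
    using that ann[OF that] wt by (simp add: e_e[of z q] e_simps weight_vec_def)
  have u_in: "u q \<in> span B" if "q < n" for q
    using that v z e_in by (simp add: u_def)
  have u_wt: "weight_vec (u q) (unit q)" if "q < n" for q
  proof (cases "q = z")
    case False
    have "shift q z (unit z) = unit q"
      by auto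
    then show ?thesis
      using weight_vec_e[OF wt, of q z] False that z by (simp add: u_def)
  qed (use wt in \<open>simp add: u_def\<close>)
  have u_ne: "u q \<noteq> 0" if "q < n" for q
    using lower[of q] v that z by (auto simp: u_def e_simps)
  have inj: "inj_on unit {..<n}"
    by (auto simp: inj_on_def fun_eq_iff of_bool_def split: if_splits)
  have vanish: "x = 0" if "x \<in> span B" "weight_vec x \<mu>" "(\<Sum>m<n. \<mu> m) = 1" "\<And>m. m \<ge> n \<Longrightarrow> \<mu> m = 0"
    "j < n" "\<mu> j < 0" for x \<mu> j
  proof (rule ccontr)
    assume "x \<noteq> 0"
    have "\<mu> \<notin> unit ` {..<n}"
      using that(6) by (auto simp: of_bool_def split: if_splits)
    then have "card (insert \<mu> (unit ` {..<n})) = Suc n"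
      using inj by (simp add: card_image)
    moreover have "card (insert \<mu> (unit ` {..<n})) \<le> n"
    proof (rule card_weights_le[where s = 1])
      show "(\<Sum>m<n. \<nu> m) = 1" if "\<nu> \<in> insert \<mu> (unit ` {..<n})" for \<nu>
        using that \<open>(\<Sum>m<n. \<mu> m) = 1\<close> by (auto simp: of_bool_def)
      show "\<exists>y\<in>span B. y \<noteq> 0 \<and> weight_vec y \<nu>" if "\<nu> \<in> insert \<mu> (unit ` {..<n})" for \<nu>
        using that \<open>x \<in> span B\<close> \<open>x \<noteq> 0\<close> \<open>weight_vec x \<mu>\<close> u_in u_wt u_ne by blast
    qed (use that in auto)
    ultimately show False by simp
  qed
  have kill: "e i j (u q) = 0" if "ok i j" "q < n" "j \<noteq> q" for i j q
  proof (rule vanish[where \<mu> = "shift i j (unit q)" and j = j])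
    show "(\<Sum>m<n. shift i j (unit q) m) = 1"
      using that by (simp add: sum.distrib sum_subtractf of_bool_def)
  qed (use that e_in weight_vec_e[OF u_wt] in auto)
  have move: "e i j (u j) = u i" if ij: "ok i j" for i j
  proof -
    consider "j = z" | "i = z" "j \<noteq> z" | "i \<noteq> z" "j \<noteq> z"
      by blast
    then show ?thesis
    proof cases
      case 1
      then show ?thesis using ij by (simp add: u_def)
    next
      case 2
      then show ?thesis using ij lower[of j] by (simp add: u_def)
    next
      case 3
      have "e i j v = 0"
        using kill[of i j z] 3 ij z by (simp add: u_def)
      then show ?thesis
        using e_bracket[of i j z v] 3 ij z by (simp add: u_def e_simps)
    qed
  qed
  have "\<forall>q\<in>{..<n}. c q = 0" if "(\<Sum>q<n. c q *s u q) = 0" for c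
  proof (rule joint_eigenvectors_independent[where h = "\<lambda>(i, j). h i j" and K = "{(i, j). ok i j}"
        and x = u and wt = "\<lambda>q (i, j). of_int (unit q i - unit q j)"])
    show "\<exists>k\<in>{(i, j). ok i j}. (case k of (i, j) \<Rightarrow> complex_of_int (unit q i - unit q j)) \<noteq>
       (case k of (i, j) \<Rightarrow> complex_of_int (unit q' i - unit q' j))"
      if "q \<in> {..<n}" "q' \<in> {..<n}" "q \<noteq> q'" for q q'
      using that by (intro bexI[of _ "(q, q')"]) auto
  qed (use that u_wt u_ne lin_h in \<open>auto simp: weight_vec_def\<close>)
  then show ?thesis
    using u_in kill move by (intro exI[of _ u]) auto
qed

text \<open>The weight comes out as \<open>- b\<close>, where \<open>b\<close> consists of the
  partial sums of the eigenvalues of the simple operators \<open>h i (Suc i)\<close>. These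
  eigenvalues are natural numbers by sl_2 theory, so \<open>b\<close> is monotone, and
  \<open>b (n - 1)\<close> equals the exponent \<open>r\<close> of the top power, hence is
  positive.\<close>

lemma highest_weight_vector:
  assumes ne: "e 0 (n - 1) x0 \<noteq> 0"
  shows "\<exists>v b. v \<in> span B \<and> v \<noteq> 0 \<and> (\<forall>i j. i < j \<and> j < n \<longrightarrow> e i j v = 0) \<and> mono b \<and> b 0 = 0
    \<and> b (n - 1) > (0::nat) \<and> (\<forall>i j. ok i j \<longrightarrow> h i j v = of_int (int (b j) - int (b i)) *s v)"
proof -
  have ok0: "ok 0 (n - 1)"
    using n3 by auto
  define E where "E = e 0 (n - 1)"
  define d where "d = (LEAST k. \<forall>x. (E ^^ k) x = 0)"
  have d: "(E ^^ d) x = 0" for x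
    using LeastI_ex[of "\<lambda>k. \<forall>x. (E ^^ k) x = 0"] nil_e[of 0 "n - 1"] ok0
    by (auto simp: E_def d_def)
  have "d \<noteq> 0"
    using d[of "E x0"] ne by (auto simp: E_def intro: ccontr)
  moreover have "d \<noteq> 1"
    using d[of x0] ne by (auto simp: E_def)
  ultimately obtain r where r: "d = Suc r" "r \<ge> 1"
    by (metis One_nat_def Suc_le_eq not0_implies_Suc neq0_conv)
  obtain y0 where y0: "(E ^^ r) y0 \<noteq> 0"
    using not_less_Least[of r "\<lambda>k. \<forall>x. (E ^^ k) x = 0"] r by (auto simp: d_def)
  \<comment> \<open>With \<open>r\<close> maximal such that \<open>E ^^ r \<noteq> 0\<close>, the operator \<open>h 0 (n - 1)\<close> is the scalar \<open>r > 0\<close> on the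
    image of \<open>E ^^ r\<close>; searching there makes the highest weight nonzero.\<close>
  define W where "W = range (E ^^ r)"
  have linE: "lin (E ^^ r)"
    unfolding E_def by (rule lin_funpow) (use lin_e[of 0 "n - 1"] ok0 in auto)
  have W_sub: "subspace W"
    unfolding W_def by (rule module_hom.subspace_image[OF linE subspace_UNIV])
  obtain r' where r': "r = Suc r'"
    using r(2) by (cases r) auto
  have W_span: "W \<subseteq> span B"
    using e_in[of 0 "n - 1"] ok0 by (auto simp: W_def r' E_def)
  have W_e: "e i j w \<in> W" if "i < j" "j < n" "w \<in> W" for i j w
  proof -
    have "e i j ((E ^^ k) y) = (E ^^ k) (e i j y)" for k y
      unfolding E_def by (induction k) (use e_comm[of i j 0 "n - 1"] ok0 that in auto)
    then show ?thesis
      using that(3) by (auto simp: W_def)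
  qed
  have W_h: "h i j w \<in> W" if ij: "ok i j" and w: "w \<in> W" for i j w
  proof -
    obtain y where y: "w = (E ^^ r) y"
      using w by (auto simp: W_def)
    have "h i j w = (E ^^ r) (h i j y) + (of_nat r * of_int (wc i j 0 (n - 1))) *s w"
      unfolding y E_def by (rule h_pow[OF ij ok0])
    then show ?thesis
      using ij w W_sub by (auto intro!: subspace_add subspace_scale simp: W_def)
  qed
  have W_top: "h 0 (n - 1) w = of_nat r *s w" if w: "w \<in> W" for w
  proof -
    obtain y where y: "w = (E ^^ r) y"
      using w by (auto simp: W_def)
    have "of_nat (Suc r) *s ((E ^^ r) (h 0 (n - 1) y) + of_nat r *s (E ^^ r) y) = 0"
      using sl2_commutation[OF ok0, of r y] d e_simps(4)[of "n - 1" 0] ok0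
      unfolding E_def[symmetric] r(1) by simp
    then have "(E ^^ r) (h 0 (n - 1) y) + of_nat r *s (E ^^ r) y = 0"
      by (subst (asm) scale_eq_0_iff) (simp del: of_nat_Suc)
    then have 1: "(E ^^ r) (h 0 (n - 1) y) = - (of_nat r *s w)"
      unfolding y by (simp add: eq_neg_iff_add_eq_0)
    have "wc 0 (n - 1) 0 (n - 1) = 2"
      using ok0 by (simp add: wc_def)
    then have "h 0 (n - 1) w = (E ^^ r) (h 0 (n - 1) y) + (of_nat r * 2) *s w"
      using h_pow[OF ok0 ok0, of r y] unfolding y E_def by simp
    then show ?thesis
      unfolding 1 mult_2_right scale_left_distrib by simp
  qed
  \<comment> \<open>Order in which the raising operators are killed: each one preserves the common kernel of its
    predecessors.\<close>
  define code where "code = (\<lambda>i j. i * n + (n - 1 - j))"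
  have code_less: "k < i \<or> k = i \<and> j < l"
    if "code k l < code i j" "i < j" "j < n" "k < l" "l < n" for i j k l
  proof (rule ccontr)
    assume a: "\<not> ?thesis"
    show False
    proof (cases "k = i")
      case True
      then show False using that a by (simp add: code_def)
    next
      case False
      with a have "Suc i \<le> k" by simp
      then have "Suc i * n \<le> k * n" by (rule mult_le_mono1)
      then show False using that by (simp add: code_def)
    qed
  qed
  have "\<exists>x\<in>W. x \<noteq> 0 \<and> (\<forall>i j. i < j \<and> j < n \<and> code i j < t \<longrightarrow> e i j x = 0)" for t
  proof (induction t)
    case 0
    then show ?case
      using y0 by (auto simp: W_def)
  next
    case (Suc t)
    then obtain x where x: "x \<in> W" "x \<noteq> 0"
      and kx: "\<And>i j. i < j \<Longrightarrow> j < n \<Longrightarrow> code i j < t \<Longrightarrow> e i j x = 0" by blast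
    show ?case
    proof (cases "\<exists>i j. i < j \<and> j < n \<and> code i j = t")
      case False
      then show ?thesis
        using x kx False by (intro bexI[of _ x]) (auto simp: less_Suc_eq)
    next
      case True
      then obtain i j where ij: "i < j" "j < n" "code i j = t" by blast
      \<comment> \<open>\<open>code\<close> writes the pair as a two-digit number in base
        \<open>n\<close>, so it is injective.\<close>
      have uniq: "k = i \<and> l = j" if "k < l" "l < n" "code k l = t" for k l
      proof -
        have dm: "(k * n + m) div n = k" "(k * n + m) mod n = m" if "m < n" for k m
          using that by simp_all
        have "n - 1 - l < n" "n - 1 - j < n"
          using n3 by simp_all
        then have "k = i" "n - 1 - l = n - 1 - j"
          using dm[of "n - 1 - l" k] dm[of "n - 1 - j" i] that(3) ij(3)
          unfolding code_def by metis+
        then show ?thesis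
          using that(2) ij(2) by linarith
      qed
      have okij: "ok i j" using ij by auto
      have inv: "(e i j ^^ m) x \<in> W \<and>
          (\<forall>k l. k < l \<and> l < n \<and> code k l < t \<longrightarrow> e k l ((e i j ^^ m) x) = 0)" for m
      proof (induction m)
        case 0
        then show ?case using x kx by simp
      next
        case (Suc m)
        let ?y = "(e i j ^^ m) x"
        have "e k l (e i j ?y) = 0" if kl: "k < l" "l < n" "code k l < t" for k l
        proof -
          have y0: "e k l ?y = 0"
            using Suc.IH kl by blast
          have lt: "k < i \<or> k = i \<and> j < l"
            using code_less[of k l i j] kl ij by simp
          show ?thesis
          proof (cases "l = i")
            case True
            \<comment> \<open>The only nonzero bracket of a predecessor with \<open>e i j\<close> is
              \<open>[e_ki, e_ij] = e_kj\<close>, and (k, j) is again a predecessor because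
              \<open>k < i\<close>.\<close>
            then have "code k j < t"
              using lt kl ij by (auto simp: code_def dest!: Suc_leI intro!: order.strict_trans2[OF _ le_add1]
                  order.strict_trans2[OF _ mult_le_mono1[of "Suc k" i n]])
            then have "e k j ?y = 0"
              using Suc.IH True kl ij by auto
            then show ?thesis
              using e_bracket[of k i j ?y] True kl ij y0 okij by (simp add: e_simps)
          next
            case False
            then show ?thesis
              using e_comm[of k l i j ?y] lt kl ij y0 okij by (auto simp: e_simps)
          qed
        qed
        then show ?case
          using Suc.IH W_e ij by auto
      qed
      \<comment> \<open>The last nonzero power of \<open>e i j\<close> on \<open>x\<close> is killed
        by \<open>e i j\<close>, and by \<open>inv\<close> it is still killed by all
        predecessors.\<close>
      obtain k where k: "(e i j ^^ k) x = 0"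
        using nil_e[of i j] okij by blast
      define k0 where "k0 = (LEAST k. (e i j ^^ k) x = 0)"
      have k0: "(e i j ^^ k0) x = 0"
        unfolding k0_def by (rule LeastI[of _ k]) (rule k)
      then have "k0 \<noteq> 0"
        using x by (metis funpow_0)
      then obtain m where m: "k0 = Suc m"
        using not0_implies_Suc by blast
      have "(e i j ^^ m) x \<noteq> 0"
        using not_less_Least[of m "\<lambda>k. (e i j ^^ k) x = 0"] m by (auto simp: k0_def)
      moreover have "e i j ((e i j ^^ m) x) = 0"
        using k0 m by simp
      ultimately show ?thesis
        using inv[of m] uniq by (intro bexI[of _ "(e i j ^^ m) x"]) (auto simp: less_Suc_eq)
    qed
  qed
  note kernel = this
  define K where "K = {x \<in> W. \<forall>i j. i < j \<and> j < n \<longrightarrow> e i j x = 0}"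
  have code_bound: "code i j < n * n" if "i < j" "j < n" for i j
  proof -
    have "code i j < Suc i * n"
      using that by (simp add: code_def)
    also have "\<dots> \<le> n * n"
      using that by (intro mult_le_mono1) simp
    finally show ?thesis .
  qed
  obtain x1 where x1: "x1 \<in> W" "x1 \<noteq> 0"
    and "\<forall>i j. i < j \<and> j < n \<and> code i j < n * n \<longrightarrow> e i j x1 = 0"
    using kernel[of "n * n"] by blast
  with code_bound have x1_K: "x1 \<in> K"
    unfolding K_def by blast
  have K_sub: "subspace K"
    using W_sub unfolding K_def subspace_def by (auto simp: e_simps)
  have K_h: "h i j x \<in> K" if ij: "ok i j" and x: "x \<in> K" for i j x
  proof -
    have "e k l (h i j x) = 0" if kl: "k < l" "l < n" for k l
    proof -
      have "e k l x = 0"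
        using x kl by (simp add: K_def)
      then show ?thesis
        using h_e[OF ij, of k l x] ij kl by (simp add: h_simps)
    qed
    then show ?thesis
      using x W_h[OF ij] by (simp add: K_def)
  qed
  \<comment> \<open>\<open>K\<close> is invariant under all \<open>h i j\<close>, and these commute;
    so one simple operator after another finds an eigenvector inside the common eigenspace
    \<open>U\<close> of the previous ones.\<close>
  have "\<exists>x\<in>K. x \<noteq> 0 \<and> (\<exists>a. \<forall>i<t. h i (Suc i) x = of_nat (a i) *s x)" if "t \<le> n - 1" for t
    using that
  proof (induction t)
    case 0
    then show ?case using x1 x1_K by auto
  next
    case (Suc t)
    then obtain x and a :: "nat \<Rightarrow> nat" where x: "x \<in> K" "x \<noteq> 0"
      and a: "\<And>i. i < t \<Longrightarrow> h i (Suc i) x = of_nat (a i) *s x"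
      by auto
    have okt: "ok t (Suc t)"
      using Suc.prems by auto
    have okl: "ok i (Suc i)" if "i < t" for i
      using Suc.prems that by auto
    define U where "U = {x \<in> K. \<forall>i<t. h i (Suc i) x = of_nat (a i) *s x}"
    have U_sub: "subspace U"
      using K_sub unfolding U_def subspace_def
      by (auto simp: h_simps[OF okl] scale_right_distrib scale_left_commute mult.commute)
    have "h t (Suc t) ` U \<subseteq> U"
      using K_h[OF okt] by (auto simp: U_def h_simps[OF okt] h_h[OF okl okt])
    moreover have "U \<subseteq> span B"
      using W_span by (auto simp: U_def K_def)
    ultimately obtain v c where v: "v \<in> U" "v \<noteq> 0" "h t (Suc t) v = c *s v"
      using eigenvector_exists[OF lin_h[OF okt] U_sub, of x] x a by (auto simp: U_def)
    have ev: "e t (Suc t) v = 0"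
      using v(1) okt by (auto simp: U_def K_def)
    obtain k where k: "(e (Suc t) t ^^ k) v = 0"
      using nil_e[of "Suc t" t] okt by auto
    define k0 where "k0 = (LEAST k. (e (Suc t) t ^^ k) v = 0)"
    have k0: "(e (Suc t) t ^^ k0) v = 0"
      unfolding k0_def by (rule LeastI[of _ k]) (rule k)
    then have "k0 \<noteq> 0"
      using v by (metis funpow_0)
    then obtain m where m: "k0 = Suc m"
      using not0_implies_Suc by blast
    have ne: "(e (Suc t) t ^^ m) v \<noteq> 0"
      using not_less_Least[of m "\<lambda>k. (e (Suc t) t ^^ k) v = 0"] m by (auto simp: k0_def)
    have okt': "ok (Suc t) t" using okt by auto
    have hv: "h (Suc t) t v = (- c) *s v"
      using v(3) by (simp add: h_antisym[of "Suc t" t])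
    have lf: "lin (e (Suc t) t ^^ m)"
      by (rule lin_funpow) (use lin_e okt' in auto)
    have lf': "lin (e (Suc t) t ^^ Suc m)"
      by (rule lin_funpow) (use lin_e okt' in auto)
    \<comment> \<open>As \<open>v\<close> is killed by the raising operator, the commutation
      identity for the last nonzero power \<open>m\<close> of the lowering operator reduces to
      \<open>(m + 1) (m - c) = 0\<close>.\<close>
    have "of_nat (Suc m) *s ((- c + of_nat m) *s (e (Suc t) t ^^ m) v) = 0"
      using sl2_commutation[OF okt', of m v] k0 m ev
      unfolding hv module_hom.scale[OF lf]
      by (simp add: module_hom.zero[OF lf', simplified] e_simps[OF okt] scale_left_distrib
          scale_left_diff_distrib)
    then have "c = of_nat m"
      using ne by (simp del: of_nat_Suc)
    then have "\<forall>i<Suc t. h i (Suc i) v = of_nat ((a(t := m)) i) *s v"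
      using v by (auto simp: U_def less_Suc_eq)
    moreover have "v \<in> K"
      using v(1) by (simp add: U_def)
    ultimately show ?case
      using v(2) by blast
  qed
  from this[of "n - 1"] obtain v and a :: "nat \<Rightarrow> nat" where v: "v \<in> K" "v \<noteq> 0"
    and a: "\<And>i. i < n - 1 \<Longrightarrow> h i (Suc i) v = of_nat (a i) *s v"
    by auto
  define b where "b = (\<lambda>j. \<Sum>i<j. a i)"
  have b_up: "h i j v = of_int (int (b j) - int (b i)) *s v" if "i < j" "j < n" for i j
    using that
  proof (induction j)
    case (Suc j)
    show ?case
    proof (cases "i = j")
      case True
      then show ?thesis using a Suc.prems by (simp add: b_def)
    next
      case False
      then have "h i (Suc j) v = h i j v + h j (Suc j) v"
        using Suc.prems h_add[of i j "Suc j"] by auto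
      then show ?thesis
        using Suc False a[of j] by (simp add: b_def scale_left_distrib[symmetric])
    qed
  qed simp
  have b_all: "h i j v = of_int (int (b j) - int (b i)) *s v" if "ok i j" for i j
    using b_up[of i j] b_up[of j i] that h_antisym[of i j v]
    by (cases "i < j") (simp_all add: scale_minus_left[symmetric] del: scale_minus_left)
  have "mono b"
    unfolding b_def mono_def by (auto intro!: sum_mono2)
  moreover have "b (n - 1) > 0"
  proof -
    have "of_nat r *s v = of_int (int (b (n - 1)) - int (b 0)) *s v"
      using W_top[of v] b_all[OF ok0] v(1) unfolding K_def by (metis (lifting) mem_Collect_eq)
    then have "complex_of_nat r = of_int (int (b (n - 1)) - int (b 0))"
      using v(2) scale_cancel_right by blast
    moreover have "b 0 = 0"
      by (simp add: b_def)
    ultimately have "r = b (n - 1)"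
      by simp
    then show ?thesis using r(2) by simp
  qed
  ultimately show ?thesis
    using v b_all W_span by (intro exI[of _ v] exI[of _ b]) (auto simp: K_def b_def)
qed

text \<open>The weight is \<open>- b\<close>. Each pair \<open>p < q\<close> with
  \<open>b p < b q\<close> gives a nonzero vector \<open>e q p v\<close>; its weight and that of
  \<open>v\<close> are all distinct, so there are at most \<open>n - 1\<close> such pairs. This
  forces the single jump of \<open>b\<close> to sit next to an end, and a jump higher than 1 would
  produce one weight more.\<close>

lemma highest_weight_shape:
  assumes v: "v \<in> span B" "v \<noteq> 0" and ann: "\<And>i j. i < j \<Longrightarrow> j < n \<Longrightarrow> e i j v = 0"
    and b: "mono b" "b 0 = 0" "b (n - 1) > (0::nat)"
    and hv: "\<And>i j. ok i j \<Longrightarrow> h i j v = of_int (int (b j) - int (b i)) *s v"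
  shows "b (n - 1) = 1 \<and> ((\<forall>m. 0 < m \<and> m < n - 1 \<longrightarrow> b m = 0) \<or> (\<forall>m. 0 < m \<and> m < n - 1 \<longrightarrow> b m = 1))"
proof -
  define w0 where "w0 = (\<lambda>m. if m < n then - int (b m) else 0)"
  define s where "s = (\<Sum>m<n. w0 m)"
  have wv: "weight_vec v w0"
    using hv by (auto simp: weight_vec_def w0_def)
  define P where "P = {(p, q). p < q \<and> q < n \<and> b p < b q}"
  define G where "G = (\<lambda>(p, q). shift q p w0)"
  have "P \<subseteq> {..<n} \<times> {..<n}"
    by (auto simp: P_def)
  then have finP: "finite P"
    by (rule finite_subset) simp
  have sum_shift: "(\<Sum>m<n. shift q p \<mu> m) = (\<Sum>m<n. \<mu> m)" if "p < n" "q < n" for p q \<mu>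
    using that by (simp add: sum.distrib sum_subtractf of_bool_def)
  have inj: "inj_on G P"
  proof (rule inj_onI, clarify)
    fix p q p' q' assume pq: "(p, q) \<in> P" "(p', q') \<in> P" and eq: "G (p, q) = G (p', q')"
    have "of_bool (m = q) - of_bool (m = p) = (of_bool (m = q') - of_bool (m = p') :: int)" for m
      using fun_cong[OF eq, of m] by (simp add: G_def)
    from this[of q] this[of p] show "p = p' \<and> q = q'"
      using pq by (auto simp: P_def of_bool_def split: if_splits)
  qed
  have G_vec: "\<exists>x\<in>span B. x \<noteq> 0 \<and> weight_vec x \<mu>" if "\<mu> \<in> G ` P" for \<mu>
  proof -
    from that obtain p q where pq: "(p, q) \<in> P" "\<mu> = shift q p w0"
      by (auto simp: G_def)
    then have ok: "ok p q" "ok q p" and lt: "p < q" "q < n" "b p < b q"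
      by (auto simp: P_def)
    have "e p q (e q p v) = of_int (int (b q) - int (b p)) *s v"
      using e_e[of p q v] ann[OF lt(1,2)] hv[OF ok(1)] ok by (simp add: e_simps)
    moreover have "of_int (int (b q) - int (b p)) *s v \<noteq> 0"
      using v lt(3) by simp
    ultimately have "e q p v \<noteq> 0"
      using ok by (metis e_simps(4))
    then show ?thesis
      using e_in[of q p v] weight_vec_e[OF wv ok(2)] ok pq(2) by blast
  qed
  have base: "w0 \<notin> G ` P"
  proof
    assume "w0 \<in> G ` P"
    then obtain p q where pq: "(p, q) \<in> P" "w0 = shift q p w0"
      by (auto simp: G_def)
    from fun_cong[OF pq(2), of q] pq(1) show False
      by (auto simp: P_def)
  qed
  have G_sum: "(\<Sum>m<n. \<mu> m) = s" if "\<mu> \<in> insert w0 (G ` P)" for \<mu>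
    using that unfolding s_def G_def P_def by (auto simp: sum_shift)
  have G_ext: "\<mu> m = 0" if "\<mu> \<in> insert w0 (G ` P)" "m \<ge> n" for \<mu> m
    using that by (auto simp: G_def P_def w0_def)
  have "card (insert w0 (G ` P)) \<le> n"
    by (rule card_weights_le[where s = s]) (use finP G_vec G_sum G_ext v wv in blast)+
  then have cardP: "card P \<le> n - 1"
    using base finP inj by (simp add: card_image)
  \<comment> \<open>For each middle \<open>m\<close> at least one of \<open>(0, m)\<close>, \<open>(m, n - 1)\<close> lies in \<open>P\<close>, so \<open>P\<close> has at least
    \<open>n - 1\<close> elements; the bound just obtained leaves room for no others.\<close>
  define pr where "pr = (\<lambda>m. if b 0 < b m then (0, m) else (m, n - 1))"
  define Q where "Q = insert (0, n - 1) (pr ` {1..<n - 1})"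
  have "inj_on pr {1..<n - 1}"
    by (auto simp: inj_on_def pr_def split: if_splits)
  moreover have "(0, n - 1) \<notin> pr ` {1..<n - 1}"
    by (auto simp: pr_def split: if_splits)
  ultimately have cardQ: "card Q = n - 1"
    using n3 by (simp add: Q_def card_image)
  have "Q \<subseteq> P"
    using b n3 by (auto simp: Q_def P_def pr_def)
  then have PQ: "P = Q"
    using card_seteq[OF finP \<open>Q \<subseteq> P\<close>] cardP cardQ by simp
  have top: "b m \<le> b (n - 1)" if "m < n - 1" for m
    using b(1) that by (simp add: mono_def)
  \<comment> \<open>Otherwise both \<open>(0, m)\<close> and \<open>(m, n - 1)\<close> would be in
    \<open>P\<close>, but \<open>Q\<close> contains just one of them.\<close>
  have mid: "b m = b (n - 1)" if "0 < m" "m < n - 1" "b m \<noteq> 0" for m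
  proof (rule ccontr)
    assume "b m \<noteq> b (n - 1)"
    then have "(m, n - 1) \<in> P"
      using that top[of m] n3 by (auto simp: P_def)
    then show False
      using that b(2) unfolding PQ by (auto simp: Q_def pr_def split: if_splits)
  qed
  have const: "b m = b m'" if "0 < m" "m < m'" "m' < n - 1" for m m'
  proof (rule ccontr)
    assume "b m \<noteq> b m'"
    then have "b m < b m'"
      using b(1) that by (metis le_neq_implies_less less_imp_le mono_def)
    then have "(m, m') \<in> P"
      using that by (simp add: P_def)
    then show False
      using that unfolding PQ by (auto simp: Q_def pr_def split: if_splits)
  qed
  \<comment> \<open>With \<open>r = b (n - 1) \<ge> 2\<close> the square of the lowering operator
    \<open>f\<close> does not kill \<open>v\<close>, since \<open>e f f v = (2 r - 2) f v\<close>.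
    The weight of \<open>f f v\<close> is new because the last entry rises by 2.\<close>
  have "b (n - 1) = 1"
  proof (rule ccontr)
    assume "b (n - 1) \<noteq> 1"
    define f where "f = e (n - 1) 0"
    define \<mu> where "\<mu> = shift (n - 1) 0 (shift (n - 1) 0 w0)"
    have ok: "ok 0 (n - 1)" "ok (n - 1) 0"
      using n3 by auto
    let ?r = "of_nat (b (n - 1)) :: complex"
    have r: "?r \<noteq> 0" "?r \<noteq> 1"
      using b(3) \<open>b (n - 1) \<noteq> 1\<close> by (auto simp only: of_nat_eq_1_iff of_nat_eq_0_iff)
    have hv0: "h 0 (n - 1) v = ?r *s v"
      using hv[OF ok(1)] b(2) by simp
    have "e 0 (n - 1) (f v) = ?r *s v"
      using e_e[of 0 "n - 1" v] ann[of 0 "n - 1"] hv0 n3 ok by (simp add: f_def e_simps)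
    moreover have "h 0 (n - 1) (f v) = (?r - 2) *s f v"
      using h_e[OF ok(1) ok(2), of v] hv0 ok n3
      by (simp add: f_def e_simps wc_def scale_left_diff_distrib)
    ultimately have "e 0 (n - 1) (f (f v)) = (2 * ?r - 2) *s f v"
      using e_e[of 0 "n - 1" "f v"] ok
      by (simp add: f_def e_simps flip: scale_left_distrib)
    moreover have "f v \<noteq> 0"
      using \<open>e 0 (n - 1) (f v) = ?r *s v\<close> r(1) v(2) e_simps(4)[OF ok(1)] by auto
    ultimately have ne: "f (f v) \<noteq> 0"
      using r(2) e_simps(4)[OF ok(1)] by auto
    have wf: "weight_vec (f (f v)) \<mu>"
      unfolding f_def \<mu>_def by (intro weight_vec_e wv ok)
    have fin: "f (f v) \<in> span B"
      unfolding f_def by (rule e_in) (use ok in auto)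
    have new: "\<mu> \<notin> insert w0 (G ` P)"
    proof
      assume "\<mu> \<in> insert w0 (G ` P)"
      then have "\<mu> (n - 1) \<le> w0 (n - 1) + 1"
        by (auto simp: G_def)
      then show False
        using n3 by (simp add: \<mu>_def)
    qed
    have \<mu>_sum: "(\<Sum>m<n. \<mu> m) = s"
      using sum_shift[of 0 "n - 1" "shift (n - 1) 0 w0"] sum_shift[of 0 "n - 1" w0] n3
      unfolding \<mu>_def s_def by linarith
    have "card (insert \<mu> (insert w0 (G ` P))) \<le> n"
    proof (rule card_weights_le[where s = s])
      show "\<exists>x\<in>span B. x \<noteq> 0 \<and> weight_vec x \<nu>" if "\<nu> \<in> insert \<mu> (insert w0 (G ` P))" for \<nu>
        using that G_vec v wv ne wf fin by blast
      show "(\<Sum>m<n. \<nu> m) = s" if "\<nu> \<in> insert \<mu> (insert w0 (G ` P))" for \<nu>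
        using that G_sum \<mu>_sum by blast
      show "\<nu> m = 0" if "\<nu> \<in> insert \<mu> (insert w0 (G ` P))" "m \<ge> n" for \<nu> m
        using that G_ext n3 by (auto simp: \<mu>_def w0_def)
    qed (use finP in auto)
    moreover have "card (insert \<mu> (insert w0 (G ` P))) = Suc (Suc (card P))"
      using new base finP inj by (simp add: card_image)
    ultimately show False
      using PQ cardQ n3 by simp
  qed
  moreover have "(\<forall>m. 0 < m \<and> m < n - 1 \<longrightarrow> b m = 0) \<or> (\<forall>m. 0 < m \<and> m < n - 1 \<longrightarrow> b m = b (n - 1))"
  proof -
    have one: "b m = b 1" if "0 < m" "m < n - 1" for m
      using const[of 1 m] that by (cases "m = 1") auto
    have "b 1 = 0 \<or> b 1 = b (n - 1)"
      using mid[of 1] n3 by linarith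
    with one show ?thesis by metis
  qed
  ultimately show ?thesis by simp
qed

text \<open>Precomposition with the automorphism \<open>X \<mapsto> - X^T\<close> of sl_n; it
  reduces the dual case to the standard one.\<close>

lemma opposite: "steinberg_rep scale B n (\<lambda>i j x. - e j i x)"
proof (intro steinberg_rep.intro steinberg_rep_axioms.intro)
  show "fin_dim_subspace scale B"
    by (rule fin_dim_subspace_axioms)
next
  fix i j assume ij: "i < n" "j < n" "i \<noteq> j"
  then show "lin (\<lambda>x. - e j i x)"
    by (intro linI) (simp_all add: e_simps)
  show "- e j i x \<in> span B" for x
    using ij by (simp add: e_in span_neg)
  have "((\<lambda>x. - e j i x) ^^ k) x = (- 1) ^ k *s (e j i ^^ k) x" for k x
    using ij by (induction k) (simp_all add: e_simps)
  then show "\<exists>k. \<forall>x. ((\<lambda>x. - e j i x) ^^ k) x = 0"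
    using nil_e[of j i] ij by auto
next
  fix i j k x assume "i < n" "j < n" "k < n" "i \<noteq> j" "j \<noteq> k" "i \<noteq> k"
  then show "- e j i (- e k j x) = - e k j (- e j i x) + - e k i x"
    using e_bracket[of k j i x] by (simp add: e_simps)
next
  fix i j k l x assume "i < n" "j < n" "k < n" "l < n" "i \<noteq> j" "k \<noteq> l" "j \<noteq> k" "i \<noteq> l"
  then show "- e j i (- e l k x) = - e l k (- e j i x)"
    using e_comm[of j i l k x] by (simp add: e_simps)
qed (use n3 card_B in auto)

theorem classification:
  assumes ne: "e 0 (n - 1) x0 \<noteq> 0"
  shows "\<exists>u. (\<forall>q<n. u q \<in> span B)
    \<and> (\<forall>c. (\<Sum>q<n. c q *s u q) = 0 \<longrightarrow> (\<forall>q<n. c q = 0))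
    \<and> ((\<forall>i j q. ok i j \<and> q < n \<longrightarrow> e i j (u q) = (if q = j then u i else 0))
      \<or> (\<forall>i j q. ok i j \<and> q < n \<longrightarrow> e i j (u q) = (if q = i then - u j else 0)))"
proof -
  obtain v b where v: "v \<in> span B" "v \<noteq> 0" and ann: "\<And>i j. i < j \<Longrightarrow> j < n \<Longrightarrow> e i j v = 0"
    and b: "mono b" "b 0 = 0" "b (n - 1) > (0::nat)"
    and hv: "\<And>i j. ok i j \<Longrightarrow> h i j v = of_int (int (b j) - int (b i)) *s v"
    using highest_weight_vector[OF ne] by blast
  have "b (n - 1) = 1 \<and> ((\<forall>m. 0 < m \<and> m < n - 1 \<longrightarrow> b m = 0) \<or> (\<forall>m. 0 < m \<and> m < n - 1 \<longrightarrow> b m = 1))"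
    by (rule highest_weight_shape[OF v ann b hv])
  then consider
    (std) "\<And>m. m < n \<Longrightarrow> b m = of_bool (m \<noteq> 0)" | (dual) "\<And>m. m < n \<Longrightarrow> b m = of_bool (m = n - 1)"
  proof (elim conjE disjE)
    assume *: "b (n - 1) = 1" "\<forall>m. 0 < m \<and> m < n - 1 \<longrightarrow> b m = 0"
    have "b m = of_bool (m = n - 1)" if "m < n" for m
      using * b(2) that by (cases "m = 0"; cases "m = n - 1") auto
    then show thesis by (rule that(2))
  next
    assume *: "b (n - 1) = 1" "\<forall>m. 0 < m \<and> m < n - 1 \<longrightarrow> b m = 1"
    have "b m = of_bool (m \<noteq> 0)" if "m < n" for m
      using * b(2) that by (cases "m = 0"; cases "m = n - 1") auto
    then show thesis by (rule that(1))
  qed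
  then show ?thesis
  proof cases
    case std
    \<comment> \<open>\<open>- b\<close> and \<open>unit 0\<close> differ by the constant 1 on the
      indices below \<open>n\<close>, which \<open>weight_vec\<close> does not see.\<close>
    have "weight_vec v (unit 0)"
      using hv std by (auto simp: weight_vec_def of_bool_def)
    then show ?thesis
      using standard_basis[OF v, of 0] ann n3 by auto
  next
    case dual
    interpret op: steinberg_rep scale B n "\<lambda>i j x. - e j i x"
      by (rule opposite)
    have "op.h i j x = h j i x" if "ok i j" for i j x
      using that by (simp add: op.h_def h_def e_simps)
    \<comment> \<open>In the opposite representation the weight changes sign and becomes
      \<open>b\<close> itself, and the last index takes the place of the first.\<close>
    then have "op.weight_vec v (unit (n - 1))"
      using hv dual by (auto simp: op.weight_vec_def of_bool_def)
    moreover have "- e j (n - 1) v = 0" if "ok (n - 1) j" for j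
    proof -
      have "j < n - 1"
        using that by linarith
      then show ?thesis
        using ann[of j "n - 1"] that by simp
    qed
    ultimately obtain u where u: "\<forall>q<n. u q \<in> span B"
      "\<forall>c. (\<Sum>q<n. c q *s u q) = 0 \<longrightarrow> (\<forall>q<n. c q = 0)"
      "\<forall>i j q. ok i j \<and> q < n \<longrightarrow> - e j i (u q) = (if q = j then u i else 0)"
      using op.standard_basis[OF v, of "n - 1"] n3 by auto
    have "\<forall>i j q. ok i j \<and> q < n \<longrightarrow> e i j (u q) = (if q = i then - u j else 0)"
      using u(3) by (metis add.inverse_inverse add.inverse_neutral)
    with u(1,2) show ?thesis by blast
  qed
qed

end

section \<open>Unipotent operators and their logarithms\<close>

context fin_dim_subspace
begin

section \<open>Heisenberg relations and roots of unity\<close>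

lemma funpow_eigen:
  assumes "lin f" "f x = a *s x"
  shows "(f ^^ k) x = a ^ k *s x"
  by (induction k) (simp_all add: assms module_hom.scale[OF assms(1)] mult.commute)

lemma funpow_commute:
  assumes "\<And>x. f (g x) = g (f x)"
  shows "(f ^^ k) (g x) = g ((f ^^ k) x)"
  by (induction k) (simp_all add: assms)

text \<open>For an eigenvector \<open>w\<close> of \<open>Y\<close> inside the
  \<open>a\<close>-eigenspace of \<open>Z\<close>, the vectors \<open>X^k w\<close> are eigenvectors
  of \<open>Y\<close> for \<open>b / a^k\<close>. At most \<open>card B\<close> of these eigenvalues
  are distinct, so two of the powers \<open>a^0, ..., a^(card B)\<close> agree, and the order of
  \<open>a\<close> divides \<open>(card B)!\<close>.\<close>

lemma heisenberg_root_of_unity: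
  assumes lin: "lin X" "lin Y" "lin Z"
    and S: "X ` span B \<subseteq> span B" "Y ` span B \<subseteq> span B"
    and inj: "\<And>x. X x = 0 \<Longrightarrow> x = 0" "\<And>x. Y x = 0 \<Longrightarrow> x = 0" "\<And>x. Z x = 0 \<Longrightarrow> x = 0"
    and XY: "\<And>x. X (Y x) = Z (Y (X x))"
    and ZX: "\<And>x. Z (X x) = X (Z x)" and ZY: "\<And>x. Z (Y x) = Y (Z x)"
    and u: "u \<in> span B" "u \<noteq> 0" "Z u = a *s u"
  shows "a ^ fact (card B) = 1"
proof -
  define U where "U = {w \<in> span B. Z w = a *s w}"
  have "subspace U"
    unfolding U_def subspace_def
    by (auto simp: span_zero span_add span_scale module_hom.zero[OF lin(3)] module_hom.add[OF lin(3)]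
        module_hom.scale[OF lin(3)] scale_right_distrib mult.commute)
  moreover have "Y ` U \<subseteq> U"
    using S by (auto simp: U_def ZY module_hom.scale[OF lin(2)])
  moreover have "U \<subseteq> span B"
    by (auto simp: U_def)
  ultimately obtain w b where w: "w \<in> U" "w \<noteq> 0" "Y w = b *s w"
    using eigenvector_exists[OF lin(2), of U u] u by (auto simp: U_def)
  have Zw: "Z w = a *s w" and wS: "w \<in> span B"
    using w(1) by (auto simp: U_def)
  have a0: "a \<noteq> 0"
    using inj(3)[of u] u by auto
  have b0: "b \<noteq> 0"
    using inj(2)[of w] w by auto
  have XkY: "(X ^^ k) (Y x) = (Z ^^ k) (Y ((X ^^ k) x))" for k x
  proof (induction k)
    case (Suc k)
    have "X ((Z ^^ k) y) = (Z ^^ k) (X y)" for y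
      by (rule funpow_commute[symmetric]) (rule ZX)
    then show ?case
      using Suc by (simp add: XY funpow_swap1)
  qed simp
  have eig: "Y ((X ^^ k) w) = (b / a ^ k) *s (X ^^ k) w" for k
  proof -
    have "b *s (X ^^ k) w = (X ^^ k) (Y w)"
      using w(3) by (simp add: module_hom.scale[OF lin_funpow[OF lin(1)]])
    also have "\<dots> = (Z ^^ k) (Y ((X ^^ k) w))"
      by (rule XkY)
    also have "\<dots> = Y ((X ^^ k) ((Z ^^ k) w))"
    proof -
      have "(Z ^^ k) ((X ^^ k) y) = (X ^^ k) ((Z ^^ k) y)" for y
        by (rule funpow_commute) (rule funpow_commute[symmetric], rule ZX[symmetric])
      then show ?thesis
        by (simp add: funpow_commute[where f = Z and g = Y, OF ZY])
    qed
    also have "\<dots> = a ^ k *s Y ((X ^^ k) w)"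
      by (simp add: funpow_eigen[OF lin(3) Zw] module_hom.scale[OF lin_funpow[OF lin(1)]]
          module_hom.scale[OF lin(2)])
    finally have "inverse (a ^ k) *s (b *s (X ^^ k) w) = Y ((X ^^ k) w)"
      using a0 by simp
    then show ?thesis
      by (simp add: field_simps)
  qed
  have ne: "(X ^^ k) w \<noteq> 0" for k
    by (induction k) (use w(2) inj(1) in auto)
  have "\<not> inj_on (\<lambda>k. a ^ k) {..card B}"
  proof
    assume i: "inj_on (\<lambda>k. a ^ k) {..card B}"
    have "card {..card B} \<le> card B"
    proof (rule card_joint_eigenvectors_le[where K = "{()}" and h = "\<lambda>_. Y"
          and x = "\<lambda>k. (X ^^ k) w" and wt = "\<lambda>k _. b / a ^ k"])
      show "\<exists>k\<in>{()}. b / a ^ s \<noteq> b / a ^ t"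
        if "s \<in> {..card B}" "t \<in> {..card B}" "s \<noteq> t" for s t
        using inj_onD[OF i _ that(1,2)] that(3) a0 b0 by auto
    qed (use lin eig ne funpow_invariant[OF S(1) wS] in auto)
    then show False by simp
  qed
  then obtain s t where st: "s < t" "t \<le> card B" "a ^ s = a ^ t"
    by (auto simp: inj_on_def) (metis linorder_neqE_nat)
  then have "a ^ (t - s) = 1"
    using a0 by (simp add: power_diff)
  moreover have "(t - s) dvd fact (card B)"
    using st by (intro dvd_fact) auto
  ultimately show ?thesis
    by (metis dvdE power_mult power_one)
qed

text \<open>Put \<open>K = (card B)!\<close>. An eigenspace of \<open>Z^K\<close> is invariant under
  \<open>Z\<close> and so contains an eigenvector of \<open>Z\<close>, whose eigenvalue is a K-th
  root of unity. Hence \<open>Z^K - 1\<close> has no eigenvalue but 0 on the span.\<close>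

lemma heisenberg_centre_unipotent:
  assumes lin: "lin X" "lin Y" "lin Z"
    and S: "X ` span B \<subseteq> span B" "Y ` span B \<subseteq> span B" "Z ` span B \<subseteq> span B"
    and inj: "\<And>x. X x = 0 \<Longrightarrow> x = 0" "\<And>x. Y x = 0 \<Longrightarrow> x = 0" "\<And>x. Z x = 0 \<Longrightarrow> x = 0"
    and XY: "\<And>x. X (Y x) = Z (Y (X x))"
    and ZX: "\<And>x. Z (X x) = X (Z x)" and ZY: "\<And>x. Z (Y x) = Y (Z x)"
    and w: "w \<in> span B"
  shows "((\<lambda>x. (Z ^^ fact (card B)) x - x) ^^ card B) w = 0"
proof (rule nilpotent_of_eigenvalues[OF _ _ _ w])
  define K :: nat where "K = fact (card B)"
  have linK: "lin (Z ^^ K)"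
    by (rule lin_funpow[OF lin(3)])
  show "lin (\<lambda>x. (Z ^^ fact (card B)) x - x)"
    unfolding K_def[symmetric]
    by (rule linI) (simp_all add: module_hom.add[OF linK] module_hom.scale[OF linK]
        scale_right_diff_distrib)
  show "(\<lambda>x. (Z ^^ fact (card B)) x - x) ` span B \<subseteq> span B"
    using funpow_invariant[OF S(3)] by (auto intro: span_diff)
  fix v c assume v: "v \<in> span B" "v \<noteq> 0" "(Z ^^ fact (card B)) v - v = c *s v"
  define U where "U = {w \<in> span B. (Z ^^ K) w = (1 + c) *s w}"
  have "subspace U"
    unfolding U_def subspace_def
    by (auto simp: span_zero span_add span_scale module_hom.zero[OF linK] module_hom.add[OF linK]
        module_hom.scale[OF linK] scale_right_distrib mult.commute)
  moreover have "Z ` U \<subseteq> U"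
    using S by (auto simp: U_def funpow_swap1[symmetric] module_hom.scale[OF lin(3)])
  moreover have "U \<subseteq> span B"
    by (auto simp: U_def)
  moreover have "v \<in> U"
    using v by (simp add: U_def K_def scale_left_distrib algebra_simps)
  ultimately obtain u a where u: "u \<in> U" "u \<noteq> 0" "Z u = a *s u"
    using eigenvector_exists[OF lin(3), of U v] v(2) by auto
  have "a ^ K = 1"
    unfolding K_def
    by (rule heisenberg_root_of_unity[OF lin S(1,2) inj XY ZX ZY _ u(2,3)]) 
      (use u in \<open>simp_all add: U_def\<close>)
  then have "u = (1 + c) *s u"
    using funpow_eigen[OF lin(3) u(3), of K] u(1) by (simp add: U_def)
  then have "(1 + c) *s u = 1 *s u"
    by simp
  then show "c = 0"
    using u(2) by (simp only: scale_cancel_right) simp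
qed

section \<open>Vector-valued polynomial sequences and their coefficients\<close>

definition poly_seq :: "(nat \<Rightarrow> 'b) \<Rightarrow> (nat \<Rightarrow> 'b) \<Rightarrow> bool" where
  "poly_seq F c \<longleftrightarrow> (\<exists>d. (\<forall>k>d. c k = 0) \<and> (\<forall>a. F a = (\<Sum>k\<le>d. of_nat a ^ k *s c k)))"

lemma poly_seqE:
  assumes "poly_seq F c"
  obtains d where "\<And>N k. N \<ge> d \<Longrightarrow> k > N \<Longrightarrow> c k = 0"
    and "\<And>N a. N \<ge> d \<Longrightarrow> F a = (\<Sum>k\<le>N. of_nat a ^ k *s c k)"
proof -
  obtain d where d: "\<And>k. k > d \<Longrightarrow> c k = 0" "\<And>a. F a = (\<Sum>k\<le>d. of_nat a ^ k *s c k)"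
    using assms by (auto simp: poly_seq_def)
  have "F a = (\<Sum>k\<le>N. of_nat a ^ k *s c k)" if "N \<ge> d" for N a
    unfolding d(2) by (rule sum.mono_neutral_left) (use that d(1) in auto)
  then show thesis
    by (rule that[rotated]) (use d(1) in auto)
qed

lemma poly_seqI:
  assumes "\<And>k. k > d \<Longrightarrow> c k = 0" "\<And>a. F a = (\<Sum>k\<le>d. of_nat a ^ k *s c k)"
  shows "poly_seq F c"
  using assms by (auto simp: poly_seq_def)

text \<open>For the sum \<open>P a\<close> of degree \<open>d + 1\<close>, the combination
  \<open>P (2 a) - 2^(d+1) P a\<close> has no top term, and its lower coefficients are those of
  \<open>P\<close> multiplied by \<open>2^k - 2^(d+1) \<noteq> 0\<close>.\<close>

lemma poly_seq_zero_coeffs: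
  assumes "\<And>a. (\<Sum>k\<le>d. of_nat a ^ k *s c k) = 0" "k \<le> d"
  shows "c k = 0"
  using assms
proof (induction d arbitrary: c k)
  case 0
  from 0(1)[of 0] 0(2) show ?case by simp
next
  case (Suc d)
  have low: "c k = 0" if "k \<le> d" for k
  proof -
    have "(2 ^ k - 2 ^ Suc d) *s c k = 0"
    proof (rule Suc.IH[of "\<lambda>k. (2 ^ k - 2 ^ Suc d) *s c k", OF _ that])
      fix a
      have "(\<Sum>k\<le>d. of_nat a ^ k *s (2 ^ k - 2 ^ Suc d) *s c k)
          = (\<Sum>k\<le>Suc d. of_nat a ^ k *s (2 ^ k - 2 ^ Suc d) *s c k)"
        by simp
      also have "\<dots> = (\<Sum>k\<le>Suc d. of_nat (2 * a) ^ k *s c k) - 2 ^ Suc d *s (\<Sum>k\<le>Suc d. of_nat a ^ k *s c k)"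
        unfolding scale_sum_right sum_subtractf[symmetric]
      proof (rule sum.cong[OF refl])
        fix k
        have "of_nat a ^ k * (2 ^ k - 2 ^ Suc d) = (of_nat (2 * a) ^ k - 2 ^ Suc d * of_nat a ^ k :: complex)"
          by (simp add: power_mult_distrib algebra_simps)
        then show "of_nat a ^ k *s (2 ^ k - 2 ^ Suc d) *s c k
            = of_nat (2 * a) ^ k *s c k - 2 ^ Suc d *s of_nat a ^ k *s c k"
          by (simp only: scale_scale scale_left_diff_distrib[symmetric])
      qed
      also have "\<dots> = 0"
        unfolding Suc.prems(1) by simp
      finally show "(\<Sum>k\<le>d. of_nat a ^ k *s (2 ^ k - 2 ^ Suc d) *s c k) = 0" .
    qed
    moreover have "(2::complex) ^ k - 2 ^ Suc d \<noteq> 0"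
    proof
      assume "(2::complex) ^ k - 2 ^ Suc d = 0"
      then have "of_nat (2 ^ k) = (of_nat (2 ^ Suc d) :: complex)"
        by simp
      then have "(2::nat) ^ k = 2 ^ Suc d"
        by (simp only: of_nat_eq_iff)
      with that show False
        by (simp add: power_inject_exp del: power_Suc)
    qed
    ultimately show ?thesis by simp
  qed
  moreover have "c (Suc d) = 0"
    using Suc.prems(1)[of 1] low by simp
  ultimately show ?case
    using Suc.prems(2) le_Suc_eq by auto
qed

lemma poly_seq_unique:
  assumes "poly_seq F c" "poly_seq F c'"
  shows "c = c'"
proof
  fix k
  obtain d where d: "\<And>N k. N \<ge> d \<Longrightarrow> k > N \<Longrightarrow> c k = 0"
    "\<And>N a. N \<ge> d \<Longrightarrow> F a = (\<Sum>k\<le>N. of_nat a ^ k *s c k)"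
    by (rule poly_seqE[OF assms(1)]) (rule that, blast+)
  obtain d' where d': "\<And>N k. N \<ge> d' \<Longrightarrow> k > N \<Longrightarrow> c' k = 0"
    "\<And>N a. N \<ge> d' \<Longrightarrow> F a = (\<Sum>k\<le>N. of_nat a ^ k *s c' k)"
    by (rule poly_seqE[OF assms(2)]) (rule that, blast+)
  let ?N = "max k (max d d')"
  have "(\<Sum>k\<le>?N. of_nat a ^ k *s (c k - c' k)) = 0" for a
    using d(2)[of ?N a] d'(2)[of ?N a]
    by (simp add: scale_right_diff_distrib sum_subtractf)
  from poly_seq_zero_coeffs[OF this, of k] show "c k = c' k"
    by simp
qed

lemma poly_seq_0:
  assumes "poly_seq F c"
  shows "c 0 = F 0"
proof -
  obtain d where "F 0 = (\<Sum>k\<le>d. of_nat 0 ^ k *s c k)"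
    using assms by (auto simp: poly_seq_def)
  also have "\<dots> = (\<Sum>k\<in>{0}. of_nat 0 ^ k *s c k)"
    by (rule sum.mono_neutral_right) (auto simp: power_0_left)
  finally show ?thesis by simp
qed

lemma poly_seq_const: "poly_seq (\<lambda>_. x) (\<lambda>k. if k = 0 then x else 0)"
  by (rule poly_seqI[of 0]) simp_all

lemma poly_seq_add:
  assumes "poly_seq F c" "poly_seq G c'"
  shows "poly_seq (\<lambda>a. F a + G a) (\<lambda>k. c k + c' k)"
proof -
  obtain d where d: "\<And>N k. N \<ge> d \<Longrightarrow> k > N \<Longrightarrow> c k = 0"
    "\<And>N a. N \<ge> d \<Longrightarrow> F a = (\<Sum>k\<le>N. of_nat a ^ k *s c k)"
    by (rule poly_seqE[OF assms(1)]) (rule that, blast+)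
  obtain d' where d': "\<And>N k. N \<ge> d' \<Longrightarrow> k > N \<Longrightarrow> c' k = 0"
    "\<And>N a. N \<ge> d' \<Longrightarrow> G a = (\<Sum>k\<le>N. of_nat a ^ k *s c' k)"
    by (rule poly_seqE[OF assms(2)]) (rule that, blast+)
  show ?thesis
  proof (rule poly_seqI[of "max d d'"])
    show "c k + c' k = 0" if "k > max d d'" for k
      using d(1)[of d k] d'(1)[of d' k] that by simp
    show "F a + G a = (\<Sum>k\<le>max d d'. of_nat a ^ k *s (c k + c' k))" for a
      using d(2)[of "max d d'" a] d'(2)[of "max d d'" a]
      by (simp add: scale_right_distrib sum.distrib)
  qed
qed

lemma poly_seq_sum:
  assumes "\<And>i. i \<in> I \<Longrightarrow> poly_seq (F i) (c i)"
  shows "poly_seq (\<lambda>a. \<Sum>i\<in>I. F i a) (\<lambda>k. \<Sum>i\<in>I. c i k)"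
  using assms
proof (induction I rule: infinite_finite_induct)
  case (insert i I)
  then show ?case
    using poly_seq_add[of "F i" "c i"] by simp
qed (use poly_seq_const[of 0] in simp_all)

lemma poly_seq_lin:
  assumes "lin T" "poly_seq F c"
  shows "poly_seq (\<lambda>a. T (F a)) (\<lambda>k. T (c k))"
proof -
  obtain d where "\<And>k. k > d \<Longrightarrow> c k = 0" "\<And>a. F a = (\<Sum>k\<le>d. of_nat a ^ k *s c k)"
    using assms(2) by (auto simp: poly_seq_def)
  then show ?thesis
    by (intro poly_seqI[of d]) (simp_all add: module_hom.zero[OF assms(1)] module_hom.sum[OF assms(1)]
        module_hom.scale[OF assms(1)])
qed

lemma poly_seq_arg:
  assumes "poly_seq F c"
  shows "poly_seq (\<lambda>a. F (m * a)) (\<lambda>k. of_nat m ^ k *s c k)"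
proof -
  obtain d where "\<And>k. k > d \<Longrightarrow> c k = 0" "\<And>a. F a = (\<Sum>k\<le>d. of_nat a ^ k *s c k)"
    using assms by (auto simp: poly_seq_def)
  then show ?thesis
    by (intro poly_seqI[of d]) (simp_all add: power_mult_distrib mult.commute)
qed

lemma poly_seq_times:
  assumes "poly_seq F c"
  shows "poly_seq (\<lambda>a. of_nat a *s F a) (\<lambda>k. if k = 0 then 0 else c (k - 1))"
proof -
  obtain d where d: "\<And>k. k > d \<Longrightarrow> c k = 0" "\<And>a. F a = (\<Sum>k\<le>d. of_nat a ^ k *s c k)"
    using assms by (auto simp: poly_seq_def)
  show ?thesis
  proof (rule poly_seqI[of "Suc d"])
    show "of_nat a *s F a = (\<Sum>k\<le>Suc d. of_nat a ^ k *s (if k = 0 then 0 else c (k - 1)))" for a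
      unfolding d(2) by (simp add: sum.atMost_Suc_shift scale_sum_right del: sum.atMost_Suc)
  qed (use d(1) in auto)
qed

lemma poly_seq_times_power:
  assumes "poly_seq F c"
  shows "poly_seq (\<lambda>a. of_nat a ^ m *s F a) (\<lambda>k. if k < m then 0 else c (k - m))"
proof (induction m)
  case 0
  then show ?case using assms by simp
next
  case (Suc m)
  have eq: "(\<lambda>k. if k = 0 then 0 else if k - 1 < m then 0 else c (k - 1 - m))
      = (\<lambda>k. if k < Suc m then 0 else c (k - Suc m))"
    by (rule ext) auto
  then show ?case
    using poly_seq_times[OF Suc] unfolding eq by (simp only: scale_scale power_Suc)
qed

definition binom_poly :: "nat \<Rightarrow> complex poly" where
  "binom_poly k = smult (1 / fact k) (\<Prod>i<k. [:- of_nat i, 1:])"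

lemma poly_binom_poly: "poly (binom_poly k) (of_nat a) = of_nat (a choose k)"
  by (simp add: binom_poly_def poly_prod binomial_gbinomial gbinomial_prod_rev atLeast0LessThan)

lemma coeff_binom_poly [simp]: "coeff (binom_poly 0) (Suc 0) = 0" "coeff (binom_poly (Suc 0)) (Suc 0) = 1"
  by (simp_all add: binom_poly_def)

lemma poly_seq_poly: "poly_seq (\<lambda>a. poly p (of_nat a) *s x) (\<lambda>k. coeff p k *s x)"
  by (rule poly_seqI[of "degree p"])
    (simp_all add: coeff_eq_0 poly_altdef scale_sum_left mult.commute)

section \<open>Powers and logarithms of unipotent operators\<close>

definition nilp :: "('b \<Rightarrow> 'b) \<Rightarrow> 'b \<Rightarrow> 'b" where
  "nilp Y x = Y x - x"

text \<open>The bound \<open>d \<ge> 2\<close> guarantees that the linear term occurs in the series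
  \<open>log_op d\<close>, which stops before \<open>d\<close>.\<close>

definition unipotent :: "nat \<Rightarrow> ('b \<Rightarrow> 'b) \<Rightarrow> bool" where
  "unipotent d Y \<longleftrightarrow> d \<ge> 2 \<and> lin Y \<and> (\<forall>x. (nilp Y ^^ d) x = 0)"

text \<open>The coefficient of \<open>X\<close> in the polynomial \<open>X choose k\<close> is \<open>(-1)\<^sup>k\<^sup>-\<^sup>1 / k\<close> for \<open>k > 0\<close>, so this is
  the usual logarithm series; all that matters is that it is the linear coefficient of \<open>a \<mapsto> Y ^^ a\<close>.\<close>

definition log_op :: "nat \<Rightarrow> ('b \<Rightarrow> 'b) \<Rightarrow> 'b \<Rightarrow> 'b" where
  "log_op d Y x = (\<Sum>k<d. coeff (binom_poly k) 1 *s (nilp Y ^^ k) x)"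

context
  fixes d Y assumes Y: "unipotent d Y"
begin

lemma lin_unipotent: "lin Y" and unipotent_ge2: "d \<ge> 2" and unipotent_nil: "(nilp Y ^^ d) x = 0"
  using Y by (auto simp: unipotent_def)

lemma lin_nilp: "lin (nilp Y)"
  by (rule linI) (simp_all add: nilp_def module_hom.add[OF lin_unipotent]
      module_hom.scale[OF lin_unipotent] scale_right_diff_distrib)

lemma lin_log_op: "lin (log_op d Y)"
  by (rule linI) (simp_all add: log_op_def module_hom.add[OF lin_funpow[OF lin_nilp]]
      module_hom.scale[OF lin_funpow[OF lin_nilp]] scale_right_distrib sum.distrib scale_sum_right
      mult.commute)

lemma nilp_pow_zero: "k \<ge> j \<Longrightarrow> (nilp Y ^^ j) x = 0 \<Longrightarrow> (nilp Y ^^ k) x = 0"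
  by (induction k rule: dec_induct) (simp_all add: module_hom.zero[OF lin_nilp])

text \<open>Binomial expansion of \<open>(1 + N)^a\<close> with \<open>N = nilp Y\<close>; as
  \<open>N^d = 0\<close>, the range of summation can be made independent of \<open>a\<close>, so the
  powers are polynomial in \<open>a\<close>.\<close>

lemma unipotent_power: "(Y ^^ a) x = (\<Sum>k<d. of_nat (a choose k) *s (nilp Y ^^ k) x)"
proof -
  have "(Y ^^ a) x = (\<Sum>k\<le>a. of_nat (a choose k) *s (nilp Y ^^ k) x)"
  proof (induction a)
    case (Suc a)
    have Yy: "Y y = y + nilp Y y" for y
      by (simp add: nilp_def)
    have "(Y ^^ Suc a) x = (\<Sum>k\<le>a. of_nat (a choose k) *s (nilp Y ^^ k) x)
        + (\<Sum>k\<le>a. of_nat (a choose k) *s (nilp Y ^^ Suc k) x)"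
      using Yy[of "(Y ^^ a) x"]
      by (simp add: Suc module_hom.sum[OF lin_nilp] module_hom.scale[OF lin_nilp])
    also have "(\<Sum>k\<le>a. of_nat (a choose k) *s (nilp Y ^^ k) x)
        = (\<Sum>k\<le>Suc a. of_nat (a choose k) *s (nilp Y ^^ k) x)"
      by simp
    also have "\<dots> = x + (\<Sum>k\<le>a. of_nat (a choose Suc k) *s (nilp Y ^^ Suc k) x)"
      by (simp add: sum.atMost_Suc_shift del: sum.atMost_Suc)
    also have "\<dots> + (\<Sum>k\<le>a. of_nat (a choose k) *s (nilp Y ^^ Suc k) x)
        = x + (\<Sum>k\<le>a. of_nat (Suc a choose Suc k) *s (nilp Y ^^ Suc k) x)"
      by (simp add: scale_left_distrib sum.distrib add_ac)
    also have "\<dots> = (\<Sum>k\<le>Suc a. of_nat (Suc a choose k) *s (nilp Y ^^ k) x)"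
      by (simp add: sum.atMost_Suc_shift del: sum.atMost_Suc)
    finally show ?case .
  qed simp
  also have "\<dots> = (\<Sum>k<max d (Suc a). of_nat (a choose k) *s (nilp Y ^^ k) x)"
    by (rule sum.mono_neutral_left) auto
  also have "\<dots> = (\<Sum>k<d. of_nat (a choose k) *s (nilp Y ^^ k) x)"
    by (rule sum.mono_neutral_right) (use nilp_pow_zero[of d, OF _ unipotent_nil] in auto)
  finally show ?thesis .
qed

lemma poly_seq_power: "\<exists>c. poly_seq (\<lambda>a. (Y ^^ a) x) c \<and> c 0 = x \<and> c 1 = log_op d Y x"
proof -
  have "poly_seq (\<lambda>a. (Y ^^ a) x) (\<lambda>j. \<Sum>k<d. coeff (binom_poly k) j *s (nilp Y ^^ k) x)"
    unfolding unipotent_power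
    by (rule poly_seq_sum) (use poly_seq_poly[of "binom_poly _"] in \<open>simp add: poly_binom_poly\<close>)
  from this poly_seq_0[OF this] show ?thesis
    unfolding log_op_def by (intro exI conjI) auto
qed

text \<open>The product rule at order one: \<open>F\<close> is expanded into its coefficients,
  \<open>Y^(m a)\<close> is applied to each, and only the coefficients 0 and 1 of \<open>F\<close>
  reach the linear term.\<close>

lemma poly_seq_power_apply:
  assumes "poly_seq F c"
  shows "\<exists>c'. poly_seq (\<lambda>a. (Y ^^ (m * a)) (F a)) c' \<and> c' 0 = c 0
    \<and> c' 1 = c 1 + of_nat m *s log_op d Y (c 0)"
proof -
  obtain N where N: "\<And>k. k > N \<Longrightarrow> c k = 0" "\<And>a. F a = (\<Sum>k\<le>N. of_nat a ^ k *s c k)"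
    and N1: "N \<ge> 1"
  proof -
    obtain N where "\<And>M k. M \<ge> N \<Longrightarrow> k > M \<Longrightarrow> c k = 0"
      "\<And>M a. M \<ge> N \<Longrightarrow> F a = (\<Sum>k\<le>M. of_nat a ^ k *s c k)"
      by (rule poly_seqE[OF assms]) (rule that, blast+)
    from that[of "Suc N", OF this(1)[of "Suc N"] this(2)[of "Suc N"]] show thesis by simp
  qed
  have "\<exists>g. poly_seq (\<lambda>a. (Y ^^ (m * a)) x) g \<and> g 0 = x \<and> g 1 = of_nat m *s log_op d Y x" for x
    using poly_seq_power[of x] poly_seq_arg[where m = m] by fastforce
  then obtain g where g: "\<And>x. poly_seq (\<lambda>a. (Y ^^ (m * a)) x) (g x)" "\<And>x. g x 0 = x"
    "\<And>x. g x 1 = of_nat m *s log_op d Y x"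
    by metis
  define c' where "c' = (\<lambda>j. \<Sum>k\<le>N. if j < k then 0 else g (c k) (j - k))"
  have "poly_seq (\<lambda>a. \<Sum>k\<le>N. of_nat a ^ k *s (Y ^^ (m * a)) (c k)) c'"
    unfolding c'_def by (rule poly_seq_sum) (rule poly_seq_times_power[OF g(1)])
  also have "(\<lambda>a. \<Sum>k\<le>N. of_nat a ^ k *s (Y ^^ (m * a)) (c k)) = (\<lambda>a. (Y ^^ (m * a)) (F a))"
    by (simp add: N(2) module_hom.sum[OF lin_funpow[OF lin_unipotent]]
        module_hom.scale[OF lin_funpow[OF lin_unipotent]])
  finally have "poly_seq (\<lambda>a. (Y ^^ (m * a)) (F a)) c'" .
  moreover have "c' 0 = c 0"
  proof -
    have "c' 0 = (\<Sum>k\<le>N. if k = 0 then g (c 0) 0 else 0)"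
      unfolding c'_def by (rule sum.cong) auto
    then show ?thesis by (simp add: g)
  qed
  moreover have "c' 1 = c 1 + of_nat m *s log_op d Y (c 0)"
  proof -
    have "c' 1 = (\<Sum>k\<in>{0, 1}. if 1 < k then 0 else g (c k) (1 - k))"
      unfolding c'_def by (rule sum.mono_neutral_right) (use N1 in auto)
    then show ?thesis by (simp add: g[simplified] add.commute)
  qed
  ultimately show ?thesis by blast
qed

text \<open>If \<open>N^m w = 0\<close> with \<open>m \<ge> 2\<close> minimal, applying
  \<open>N^(m-2)\<close> to the series leaves only \<open>N^(m-1) w\<close>, which is not 0.\<close>

lemma log_op_eq_0D:
  assumes "log_op d Y w = 0"
  shows "Y w = w"
proof (rule ccontr)
  assume "Y w \<noteq> w"
  then have n1: "(nilp Y ^^ 1) w \<noteq> 0"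
    by (simp add: nilp_def)
  define m where "m = (LEAST k. (nilp Y ^^ k) w = 0)"
  have m: "(nilp Y ^^ m) w = 0"
    unfolding m_def by (rule LeastI[of _ d]) (rule unipotent_nil)
  have "\<not> m \<le> 1"
    using nilp_pow_zero[of m 1 w] m n1 by blast
  then obtain j where j: "m = Suc (Suc j)"
    by (metis One_nat_def Suc_le_eq not0_implies_Suc not_less_eq_eq le0)
  have nz: "(nilp Y ^^ Suc j) w \<noteq> 0"
    using not_less_Least[of "Suc j" "\<lambda>k. (nilp Y ^^ k) w = 0"] j by (auto simp: m_def)
  have "0 = (nilp Y ^^ j) (log_op d Y w)"
    using assms by (simp add: module_hom.zero[OF lin_funpow[OF lin_nilp]])
  also have "\<dots> = (\<Sum>k<d. coeff (binom_poly k) 1 *s (nilp Y ^^ (j + k)) w)"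
    by (simp add: log_op_def module_hom.sum[OF lin_funpow[OF lin_nilp]]
        module_hom.scale[OF lin_funpow[OF lin_nilp]] funpow_add)
  also have "\<dots> = (\<Sum>k\<in>{0, 1}. coeff (binom_poly k) 1 *s (nilp Y ^^ (j + k)) w)"
  proof (rule sum.mono_neutral_right)
    show "\<forall>k\<in>{..<d} - {0, 1}. coeff (binom_poly k) 1 *s (nilp Y ^^ (j + k)) w = 0"
      using nilp_pow_zero[of m, OF _ m] j by auto
  qed (use unipotent_ge2 in auto)
  also have "\<dots> = (nilp Y ^^ Suc j) w"
    by simp
  finally show False
    using nz by simp
qed

lemma log_op_nilp: "log_op d Y (nilp Y x) = nilp Y (log_op d Y x)"
  by (simp add: log_op_def module_hom.sum[OF lin_nilp] module_hom.scale[OF lin_nilp] funpow_swap1)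

text \<open>Two uses of the kernel property give \<open>N log w = 0\<close> and then
  \<open>N^2 w = 0\<close>, after which the series ends with its linear term.\<close>

lemma log_op_square_0D:
  assumes "log_op d Y (log_op d Y w) = 0"
  shows "Y w = w + log_op d Y w"
proof -
  have "nilp Y (log_op d Y w) = 0"
    using log_op_eq_0D[OF assms] by (simp add: nilp_def)
  then have "log_op d Y (nilp Y w) = 0"
    by (simp add: log_op_nilp)
  then have "nilp Y (nilp Y w) = 0"
    using log_op_eq_0D by (simp add: nilp_def[of Y "nilp Y w"])
  then have two: "(nilp Y ^^ 2) w = 0"
    by (simp add: numeral_2_eq_2)
  have "log_op d Y w = (\<Sum>k\<in>{0, 1}. coeff (binom_poly k) 1 *s (nilp Y ^^ k) w)"
    unfolding log_op_def
  proof (rule sum.mono_neutral_right)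
    show "\<forall>k\<in>{..<d} - {0, 1}. coeff (binom_poly k) 1 *s (nilp Y ^^ k) w = 0"
      using nilp_pow_zero[of 2, OF _ two] by auto
  qed (use unipotent_ge2 in auto)
  then show ?thesis
    by (simp add: nilp_def)
qed

text \<open>The series has no constant term, so each application of the logarithm uses up one power
  of \<open>N\<close>.\<close>

lemma log_op_nilpotent: "(log_op d Y ^^ d) x = 0"
proof -
  have "(log_op d Y ^^ k) x = 0" if "(nilp Y ^^ k) x = 0" for k x
    using that
  proof (induction k arbitrary: x)
    case (Suc k)
    have "(nilp Y ^^ k) (log_op d Y x) = (\<Sum>j<d. coeff (binom_poly j) 1 *s (nilp Y ^^ (k + j)) x)"
      by (simp add: log_op_def module_hom.sum[OF lin_funpow[OF lin_nilp]]
          module_hom.scale[OF lin_funpow[OF lin_nilp]] funpow_add)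
    also have "\<dots> = 0"
    proof (rule sum.neutral, safe)
      fix j
      show "coeff (binom_poly j) 1 *s (nilp Y ^^ (k + j)) x = 0"
        using nilp_pow_zero[OF _ Suc.prems, of "k + j"] by (cases j) auto
    qed
    finally show ?case
      using Suc.IH by (simp add: funpow_swap1)
  qed simp
  then show ?thesis
    using unipotent_nil by blast
qed

lemma log_op_in:
  assumes U: "subspace U" and Y_U: "\<And>x. Y x - x \<in> U"
  shows "log_op d Y x \<in> U"
  unfolding log_op_def
proof (rule subspace_sum[OF U])
  fix k
  show "coeff (binom_poly k) 1 *s (nilp Y ^^ k) x \<in> U"
    using Y_U by (cases k) (auto simp: subspace_0[OF U] nilp_def intro: subspace_scale[OF U])
qed

end

text \<open>Compare linear coefficients in \<open>b\<close> and then in \<open>a\<close> of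
  \<open>X\<^sup>a Y\<^sup>b = Z\<^sup>M\<^sup>a\<^sup>b Y\<^sup>b X\<^sup>a\<close>.\<close>

lemma log_op_bracket:
  assumes X: "unipotent d X" and Y: "unipotent d Y" and Z: "unipotent d Z"
    and XY: "\<And>x. X (Y x) = (Z ^^ M) (Y (X x))"
    and ZX: "\<And>x. Z (X x) = X (Z x)" and ZY: "\<And>x. Z (Y x) = Y (Z x)"
  shows "log_op d X (log_op d Y v) = log_op d Y (log_op d X v) + of_nat M *s log_op d Z v"
proof -
  have ZX': "X ((Z ^^ k) x) = (Z ^^ k) (X x)" for k x
    by (rule funpow_commute[symmetric]) (rule ZX)
  have ZY': "Y ((Z ^^ k) x) = (Z ^^ k) (Y x)" for k x
    by (rule funpow_commute[symmetric]) (rule ZY)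
  have ZZ: "(Z ^^ p) ((Z ^^ q) x) = (Z ^^ (p + q)) x" for p q x
    by (simp add: funpow_add)
  have XaY: "(X ^^ a) (Y x) = (Z ^^ (M * a)) (Y ((X ^^ a) x))" for a x
    by (induction a) (simp_all add: ZX' XY ZZ add.commute)
  have XaYb: "(X ^^ a) ((Y ^^ b) x) = (Z ^^ (M * a * b)) ((Y ^^ b) ((X ^^ a) x))" for a b x
    by (induction b) (simp_all add: XaY ZY' ZZ add.commute)
  have step: "(X ^^ a) (log_op d Y v)
      = log_op d Y ((X ^^ a) v) + (of_nat M * of_nat a) *s log_op d Z ((X ^^ a) v)" for a
  proof -
    obtain c where c: "poly_seq (\<lambda>b. (Y ^^ b) v) c" "c 1 = log_op d Y v"
      using poly_seq_power[OF Y] by blast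
    obtain c' where c': "poly_seq (\<lambda>b. (Y ^^ b) ((X ^^ a) v)) c'" "c' 0 = (X ^^ a) v"
      "c' 1 = log_op d Y ((X ^^ a) v)"
      using poly_seq_power[OF Y] by blast
    obtain c'' where c'': "poly_seq (\<lambda>b. (Z ^^ (M * a * b)) ((Y ^^ b) ((X ^^ a) v))) c''"
      "c'' 1 = c' 1 + of_nat (M * a) *s log_op d Z (c' 0)"
      using poly_seq_power_apply[OF Z c'(1), of "M * a"] by blast
    have "poly_seq (\<lambda>b. (Z ^^ (M * a * b)) ((Y ^^ b) ((X ^^ a) v))) (\<lambda>k. (X ^^ a) (c k))"
      using poly_seq_lin[OF lin_funpow[OF lin_unipotent[OF X]] c(1), of a] by (simp add: XaYb)
    from poly_seq_unique[OF this c''(1)] have "(X ^^ a) (c 1) = c'' 1"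
      by (rule fun_cong)
    then show ?thesis
      using c(2) c'(2,3) c''(2) by simp
  qed
  obtain f where f: "poly_seq (\<lambda>a. (X ^^ a) (log_op d Y v)) f" "f 1 = log_op d X (log_op d Y v)"
    using poly_seq_power[OF X] by blast
  obtain g where g: "poly_seq (\<lambda>a. (X ^^ a) v) g" "g 0 = v" "g 1 = log_op d X v"
    using poly_seq_power[OF X] by blast
  have linM: "lin (\<lambda>x. of_nat M *s log_op d Z x)"
    using lin_log_op[OF Z]
    by (intro linI) (simp_all add: module_hom.add module_hom.scale scale_right_distrib mult.commute)
  have "poly_seq (\<lambda>a. log_op d Y ((X ^^ a) v) + of_nat a *s (of_nat M *s log_op d Z ((X ^^ a) v)))
      (\<lambda>k. log_op d Y (g k) + (if k = 0 then 0 else of_nat M *s log_op d Z (g (k - 1))))"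
    by (intro poly_seq_add poly_seq_times poly_seq_lin[OF lin_log_op[OF Y]] poly_seq_lin[OF linM] g)
  then have "poly_seq (\<lambda>a. (X ^^ a) (log_op d Y v))
      (\<lambda>k. log_op d Y (g k) + (if k = 0 then 0 else of_nat M *s log_op d Z (g (k - 1))))"
    by (simp add: step mult.commute)
  from fun_cong[OF poly_seq_unique[OF f(1) this], of 1] show ?thesis
    using f g by simp
qed

lemma log_op_commute:
  assumes "unipotent d X" "unipotent d Y" "\<And>x. X (Y x) = Y (X x)"
  shows "log_op d X (log_op d Y v) = log_op d Y (log_op d X v)"
  using log_op_bracket[of d X Y X 0 v] assms by simp

text \<open>The logarithms satisfy \<open>[L_ij, L_jk] = M L_ik\<close>, since the commutator is an
  M-th power; dividing by \<open>M\<close> gives the relations of \<open>steinberg_rep\<close>. On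
  the basis found there every \<open>e i j\<close> has square 0, so \<open>Y i j\<close> acts
  exactly as \<open>1 + M e_ij\<close>.\<close>

theorem steinberg_unipotent:
  fixes M :: nat
  assumes n3: "n \<ge> 3" and card_B: "card B = n" and M: "M > 0"
    and unip: "\<And>i j. i < n \<Longrightarrow> j < n \<Longrightarrow> i \<noteq> j \<Longrightarrow> unipotent d (Y i j)"
    and Y_in: "\<And>i j x. i < n \<Longrightarrow> j < n \<Longrightarrow> i \<noteq> j \<Longrightarrow> Y i j x - x \<in> span B"
    and bracket: "\<And>i j k x. \<lbrakk>i < n; j < n; k < n; i \<noteq> j; j \<noteq> k; i \<noteq> k\<rbrakk> \<Longrightarrow>
      Y i j (Y j k x) = (Y i k ^^ M) (Y j k (Y i j x))"
    and comm: "\<And>i j k l x. \<lbrakk>i < n; j < n; k < n; l < n; i \<noteq> j; k \<noteq> l; j \<noteq> k; i \<noteq> l\<rbrakk> \<Longrightarrow>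
      Y i j (Y k l x) = Y k l (Y i j x)"
    and ne: "Y 0 (n - 1) x0 \<noteq> x0"
  shows "\<exists>u. (\<forall>q<n. u q \<in> span B)
    \<and> (\<forall>c. (\<Sum>q<n. c q *s u q) = 0 \<longrightarrow> (\<forall>q<n. c q = 0))
    \<and> ((\<forall>i j q. i < n \<and> j < n \<and> i \<noteq> j \<and> q < n \<longrightarrow>
            Y i j (u q) = u q + (if q = j then of_nat M *s u i else 0))
      \<or> (\<forall>i j q. i < n \<and> j < n \<and> i \<noteq> j \<and> q < n \<longrightarrow>
            Y i j (u q) = u q - (if q = i then of_nat M *s u j else 0)))"
proof -
  define e where "e = (\<lambda>i j x. (1 / of_nat M) *s log_op d (Y i j) x)"
  have L: "log_op d (Y i j) x = of_nat M *s e i j x" for i j x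
    using M by (simp add: e_def)
  have lin_L: "lin (log_op d (Y i j))" if "i < n" "j < n" "i \<noteq> j" for i j
    by (rule lin_log_op[OF unip[OF that]])
  have lin_e: "lin (e i j)" if "i < n" "j < n" "i \<noteq> j" for i j
    unfolding e_def using lin_L[OF that]
    by (intro linI) (simp_all add: module_hom.add module_hom.scale scale_right_distrib mult.commute)
  interpret rep: steinberg_rep scale B n e
  proof (intro steinberg_rep.intro steinberg_rep_axioms.intro)
    show "fin_dim_subspace scale B"
      by (rule fin_dim_subspace_axioms)
  next
    fix i j assume ij: "i < n" "j < n" "i \<noteq> j"
    then show "lin (e i j)"
      by (rule lin_e)
    show "e i j x \<in> span B" for x
      unfolding e_def by (intro span_scale log_op_in[OF unip[OF ij]] subspace_span Y_in ij)
    have "(e i j ^^ k) x = (1 / of_nat M) ^ k *s (log_op d (Y i j) ^^ k) x" for k x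
      by (induction k) (simp_all add: e_def module_hom.scale[OF lin_L[OF ij]])
    then show "\<exists>k. \<forall>x. (e i j ^^ k) x = 0"
      using log_op_nilpotent[OF unip[OF ij]] by (intro exI[of _ d]) simp
  next
    fix i j k x assume a: "i < n" "j < n" "k < n" "i \<noteq> j" "j \<noteq> k" "i \<noteq> k"
    have "log_op d (Y i j) (log_op d (Y j k) x)
        = log_op d (Y j k) (log_op d (Y i j) x) + of_nat M *s log_op d (Y i k) x"
      by (rule log_op_bracket) (use a unip bracket comm in auto)
    then show "e i j (e j k x) = e j k (e i j x) + e i k x"
      using a M lin_L
      by (simp add: e_def module_hom.scale[OF lin_L] scale_right_distrib)
  next
    fix i j k l x
    assume a: "i < n" "j < n" "k < n" "l < n" "i \<noteq> j" "k \<noteq> l" "j \<noteq> k" "i \<noteq> l"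
    have "log_op d (Y i j) (log_op d (Y k l) x) = log_op d (Y k l) (log_op d (Y i j) x)"
      by (rule log_op_commute) (use a unip comm in auto)
    then show "e i j (e k l x) = e k l (e i j x)"
      using a by (simp add: e_def module_hom.scale[OF lin_L])
  qed (use n3 card_B in auto)
  have "e 0 (n - 1) x0 \<noteq> 0"
    using log_op_eq_0D[OF unip, of 0 "n - 1" x0] ne n3 by (auto simp: L)
  from rep.classification[OF this] obtain u where u: "\<forall>q<n. u q \<in> span B"
      "\<forall>c. (\<Sum>q<n. c q *s u q) = 0 \<longrightarrow> (\<forall>q<n. c q = 0)"
    and cases: "(\<forall>i j q. rep.ok i j \<and> q < n \<longrightarrow> e i j (u q) = (if q = j then u i else 0))
      \<or> (\<forall>i j q. rep.ok i j \<and> q < n \<longrightarrow> e i j (u q) = (if q = i then - u j else 0))"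
    by blast
  have Yu: "Y i j (u q) = u q + of_nat M *s e i j (u q)"
    if ij: "i < n" "j < n" "i \<noteq> j" and "e i j (e i j (u q)) = 0" for i j q
    using log_op_square_0D[OF unip[OF ij], of "u q"] that
    by (simp add: L module_hom.scale[OF lin_e[OF ij]])
  from cases have "(\<forall>i j q. i < n \<and> j < n \<and> i \<noteq> j \<and> q < n \<longrightarrow>
            Y i j (u q) = u q + (if q = j then of_nat M *s u i else 0))
      \<or> (\<forall>i j q. i < n \<and> j < n \<and> i \<noteq> j \<and> q < n \<longrightarrow>
            Y i j (u q) = u q - (if q = i then of_nat M *s u j else 0))"
  proof (elim disjE)
    assume *: "\<forall>i j q. rep.ok i j \<and> q < n \<longrightarrow> e i j (u q) = (if q = j then u i else 0)"
    then have "Y i j (u q) = u q + (if q = j then of_nat M *s u i else 0)"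
      if "i < n" "j < n" "i \<noteq> j" "q < n" for i j q
      using that Yu[of i j q] by (simp add: rep.e_simps)
    then show ?thesis by blast
  next
    assume *: "\<forall>i j q. rep.ok i j \<and> q < n \<longrightarrow> e i j (u q) = (if q = i then - u j else 0)"
    then have "Y i j (u q) = u q - (if q = i then of_nat M *s u j else 0)"
      if "i < n" "j < n" "i \<noteq> j" "q < n" for i j q
      using that Yu[of i j q] by (simp add: rep.e_simps)
    then show ?thesis by blast
  qed
  with u show ?thesis by blast
qed

end

section \<open>Transvections\<close>

definition one_plus :: "nat \<Rightarrow> (nat \<Rightarrow> nat \<Rightarrow> 'a) \<Rightarrow> 'a::comm_ring_1 mat" where
  "one_plus n N = mat n n (\<lambda>(i, j). of_bool (i = j) + N i j)"

definition dot :: "nat \<Rightarrow> (nat \<Rightarrow> 'a) \<Rightarrow> (nat \<Rightarrow> 'a) \<Rightarrow> 'a::comm_ring_1" where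
  "dot n u v = (\<Sum>k<n. u k * v k)"

text \<open>The matrix \<open>1 + u v^T\<close>. It is a transvection when
  \<open>dot n v u = 0\<close>, a condition that the lemmas state where it is used.\<close>

definition transvec :: "nat \<Rightarrow> (nat \<Rightarrow> 'a) \<Rightarrow> (nat \<Rightarrow> 'a) \<Rightarrow> 'a::comm_ring_1 mat" where
  "transvec n u v = one_plus n (\<lambda>i j. u i * v j)"

definition unit :: "nat \<Rightarrow> nat \<Rightarrow> 'a::comm_ring_1" where
  "unit i = (\<lambda>m. of_bool (m = i))"

definition elem_mat :: "nat \<Rightarrow> nat \<Rightarrow> nat \<Rightarrow> 'a \<Rightarrow> 'a::comm_ring_1 mat" where
  "elem_mat n i j t = transvec n (\<lambda>m. t * unit i m) (unit j)"

lemma one_plus_carrier [simp]: "one_plus n N \<in> carrier_mat n n"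
  by (simp add: one_plus_def)

lemma transvec_carrier [simp]: "transvec n u v \<in> carrier_mat n n"
  by (simp add: transvec_def)

lemma elem_carrier [simp]: "elem_mat n i j t \<in> carrier_mat n n"
  by (simp add: elem_mat_def)

lemma one_plus_index: "i < n \<Longrightarrow> j < n \<Longrightarrow> one_plus n N $$ (i, j) = of_bool (i = j) + N i j"
  by (simp add: one_plus_def)

lemma one_plus_cong:
  "(\<And>i j. i < n \<Longrightarrow> j < n \<Longrightarrow> N i j = N' i j) \<Longrightarrow> one_plus n N = one_plus n N'"
  by (rule eq_matI) (simp_all add: one_plus_def)

lemma one_plus_0: "one_plus n (\<lambda>_ _. 0) = 1\<^sub>m n"
  by (rule eq_matI) (simp_all add: one_plus_def)

lemma mat_eq_one_plus: "A \<in> carrier_mat n n \<Longrightarrow> A = one_plus n (\<lambda>i j. A $$ (i, j) - of_bool (i = j))"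
  by (rule eq_matI) (simp_all add: one_plus_def)

lemma mult_index:
  "A \<in> carrier_mat n n \<Longrightarrow> B \<in> carrier_mat n n \<Longrightarrow> i < n \<Longrightarrow> j < n \<Longrightarrow>
    (A * B) $$ (i, j) = (\<Sum>k<n. A $$ (i, k) * B $$ (k, j))"
  by (auto simp: scalar_prod_def lessThan_atLeast0 intro!: sum.cong)

lemma sum_of_bool_mult [simp]:
  fixes f :: "nat \<Rightarrow> 'a::comm_ring_1"
  shows "(\<Sum>k<n. of_bool (k = i) * f k) = (if i < n then f i else 0)"
    "(\<Sum>k<n. of_bool (i = k) * f k) = (if i < n then f i else 0)"
    "(\<Sum>k<n. f k * of_bool (k = i)) = (if i < n then f i else 0)"
    "(\<Sum>k<n. f k * of_bool (i = k)) = (if i < n then f i else 0)"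
  by (simp_all add: of_bool_def if_distrib[of "\<lambda>z. z * _"] if_distrib[of "(*) _"] cong: if_cong)

lemma one_plus_mult:
  "one_plus n N * one_plus n N' = one_plus n (\<lambda>i j. N i j + N' i j + (\<Sum>k<n. N i k * N' k j))"
proof (rule eq_matI)
  fix i j assume "i < dim_row (one_plus n (\<lambda>i j. N i j + N' i j + (\<Sum>k<n. N i k * N' k j)))"
    "j < dim_col (one_plus n (\<lambda>i j. N i j + N' i j + (\<Sum>k<n. N i k * N' k j)))"
  then have ij: "i < n" "j < n"
    by (simp_all add: one_plus_def)
  have "(one_plus n N * one_plus n N') $$ (i, j)
      = (\<Sum>k<n. (of_bool (i = k) + N i k) * (of_bool (k = j) + N' k j))"
    unfolding mult_index[OF one_plus_carrier one_plus_carrier ij]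
    by (rule sum.cong) (simp_all add: one_plus_index ij)
  also have "\<dots> = of_bool (i = j) + N' i j + (N i j + (\<Sum>k<n. N i k * N' k j))"
    using ij by (simp add: distrib_right distrib_left sum.distrib)
  finally show "(one_plus n N * one_plus n N') $$ (i, j)
      = one_plus n (\<lambda>i j. N i j + N' i j + (\<Sum>k<n. N i k * N' k j)) $$ (i, j)"
    by (simp add: one_plus_index ij)
qed (simp_all add: one_plus_def)

lemma dot_simps:
  "dot n u (\<lambda>m. v m + w m) = dot n u v + dot n u w" "dot n (\<lambda>m. v m + w m) u = dot n v u + dot n w u"
  "dot n u (\<lambda>m. v m - w m) = dot n u v - dot n u w" "dot n (\<lambda>m. v m - w m) u = dot n v u - dot n w u"
  "dot n u (\<lambda>m. c * v m) = c * dot n u v" "dot n (\<lambda>m. c * v m) u = c * dot n v u"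
  "dot n u (\<lambda>m. - v m) = - dot n u v" "dot n (\<lambda>m. - v m) u = - dot n v u"
  by (simp_all add: dot_def algebra_simps sum.distrib sum_subtractf sum_distrib_left sum_negf)

lemma dot_unit: "i < n \<Longrightarrow> dot n (unit i) u = u i" "i < n \<Longrightarrow> dot n u (unit i) = u i"
  by (simp_all add: dot_def unit_def)

lemma unit_apply [simp]: "unit i i = 1" "i \<noteq> j \<Longrightarrow> unit i j = 0"
  by (simp_all add: unit_def)

lemma transvec_mult:
  "transvec n u v * transvec n u' v' = one_plus n (\<lambda>i j. u i * v j + u' i * v' j + dot n v u' * u i * v' j)"
  unfolding transvec_def one_plus_mult
  by (rule one_plus_cong) (simp add: dot_def sum_distrib_left sum_distrib_right mult_ac)

lemma transvec_add_left:
  "dot n v u' = 0 \<Longrightarrow> transvec n u v * transvec n u' v = transvec n (\<lambda>m. u m + u' m) v"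
  unfolding transvec_mult unfolding transvec_def by (rule one_plus_cong) (simp add: algebra_simps)

lemma transvec_add_right:
  "dot n v u = 0 \<Longrightarrow> transvec n u v * transvec n u v' = transvec n u (\<lambda>m. v m + v' m)"
  unfolding transvec_mult unfolding transvec_def by (rule one_plus_cong) (simp add: algebra_simps)

lemma transvec_0: "transvec n (\<lambda>_. 0) v = 1\<^sub>m n" "transvec n u (\<lambda>_. 0) = 1\<^sub>m n"
  by (simp_all add: transvec_def one_plus_0)

lemma transvec_inverse:
  "dot n v u = 0 \<Longrightarrow> transvec n u v * transvec n (\<lambda>m. - u m) v = 1\<^sub>m n"
  "dot n v u = 0 \<Longrightarrow> transvec n (\<lambda>m. - u m) v * transvec n u v = 1\<^sub>m n"
  by (subst transvec_add_left; simp add: dot_simps transvec_0)+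

lemma transvec_scale_move: "transvec n (\<lambda>m. c * u m) v = transvec n u (\<lambda>m. c * v m)"
  by (simp add: transvec_def mult_ac)

lemma transvec_index: "i < n \<Longrightarrow> j < n \<Longrightarrow> transvec n u v $$ (i, j) = of_bool (i = j) + u i * v j"
  by (simp add: transvec_def one_plus_index)

lemma transvec_conj:
  assumes G: "G \<in> carrier_mat n n" "H \<in> carrier_mat n n" "G * H = 1\<^sub>m n"
  shows "G * transvec n u v * H
    = transvec n (\<lambda>i. \<Sum>k<n. G $$ (i, k) * u k) (\<lambda>j. \<Sum>k<n. v k * H $$ (k, j))"
proof (rule eq_matI)
  define p where "p = (\<lambda>i. \<Sum>k<n. G $$ (i, k) * u k)"
  define q where "q = (\<lambda>j. \<Sum>k<n. v k * H $$ (k, j))"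
  let ?R = "transvec n (\<lambda>i. \<Sum>k<n. G $$ (i, k) * u k) (\<lambda>j. \<Sum>k<n. v k * H $$ (k, j))"
  fix i j assume "i < dim_row ?R" "j < dim_col ?R"
  then have ij: "i < n" "j < n"
    by (simp_all add: transvec_def one_plus_def)
  have GT: "G * transvec n u v \<in> carrier_mat n n"
    using G by (intro mult_carrier_mat) auto
  have entry: "(G * transvec n u v) $$ (i, k) = G $$ (i, k) + p i * v k" if k: "k < n" for k
  proof -
    have "(G * transvec n u v) $$ (i, k) = (\<Sum>l<n. G $$ (i, l) * of_bool (l = k) + G $$ (i, l) * u l * v k)"
      unfolding mult_index[OF G(1) transvec_carrier ij(1) k]
      by (intro sum.cong refl) (simp add: transvec_index k distrib_left mult.assoc)
    then show ?thesis
      using k by (simp only: sum.distrib sum_of_bool_mult p_def sum_distrib_right if_True)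
  qed
  have "(G * transvec n u v * H) $$ (i, j) = (\<Sum>k<n. G $$ (i, k) * H $$ (k, j) + p i * (v k * H $$ (k, j)))"
    unfolding mult_index[OF GT G(2) ij]
    by (intro sum.cong refl) (simp add: entry distrib_right mult.assoc)
  also have "\<dots> = (G * H) $$ (i, j) + p i * q j"
    unfolding mult_index[OF G(1,2) ij] by (simp only: sum.distrib q_def sum_distrib_left)
  also have "\<dots> = ?R $$ (i, j)"
    unfolding G(3) transvec_index[OF ij] p_def q_def using ij by simp
  finally show "(G * transvec n u v * H) $$ (i, j) = ?R $$ (i, j)" .
qed (use G in \<open>simp_all add: transvec_def one_plus_def\<close>)

lemma transvec_apply:
  assumes "i < n"
  shows "(\<Sum>k<n. transvec n y w $$ (i, k) * u k) = u i + dot n w u * y i"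
proof -
  have "(\<Sum>k<n. transvec n y w $$ (i, k) * u k) = (\<Sum>k<n. of_bool (i = k) * u k + w k * u k * y i)"
    by (intro sum.cong refl) (simp add: assms transvec_index algebra_simps)
  then show ?thesis
    using assms by (simp only: sum.distrib dot_def sum_distrib_right sum_of_bool_mult if_True)
qed

lemma transvec_apply_left:
  assumes "j < n"
  shows "(\<Sum>k<n. v k * transvec n y w $$ (k, j)) = v j + dot n v y * w j"
proof -
  have "(\<Sum>k<n. v k * transvec n y w $$ (k, j)) = (\<Sum>k<n. v k * of_bool (k = j) + v k * y k * w j)"
    by (intro sum.cong refl) (simp add: assms transvec_index algebra_simps)
  then show ?thesis
    using assms by (simp only: sum.distrib dot_def sum_distrib_right sum_of_bool_mult if_True)
qed

lemma transvec_cong: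
  "(\<And>i. i < n \<Longrightarrow> u i = u' i) \<Longrightarrow> (\<And>i. i < n \<Longrightarrow> v i = v' i) \<Longrightarrow> transvec n u v = transvec n u' v'"
  unfolding transvec_def by (rule one_plus_cong) simp

lemma transvec_conj_transvec:
  assumes "dot n w y = 0"
  shows "transvec n y w * transvec n u v * transvec n (\<lambda>m. - y m) w
    = transvec n (\<lambda>i. u i + dot n w u * y i) (\<lambda>j. v j - dot n v y * w j)"
  unfolding transvec_conj[OF transvec_carrier transvec_carrier transvec_inverse(1)[OF assms]]
  by (rule transvec_cong) (simp_all add: transvec_apply transvec_apply_left dot_simps)

text \<open>Doubling makes the transvection a square, which gives determinant one without computing it.\<close>

lemma det_transvec_even:
  fixes u v :: "nat \<Rightarrow> int"
  assumes "dot n v u = 0"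
  shows "det (transvec n (\<lambda>m. 2 * u m) v) = 1"
proof -
  have "det (transvec n u v) * det (transvec n (\<lambda>m. - u m) v)
      = det (transvec n u v * transvec n (\<lambda>m. - u m) v)"
    by (rule det_mult[symmetric, OF transvec_carrier transvec_carrier])
  also have "\<dots> = 1"
    by (simp add: transvec_inverse(1)[OF assms])
  finally have d: "det (transvec n u v) = 1 \<or> det (transvec n u v) = - 1"
    unfolding zmult_eq_1_iff by blast
  have "transvec n (\<lambda>m. 2 * u m) v = transvec n u v * transvec n u v"
    by (simp only: transvec_add_left[OF assms] mult_2)
  then have "det (transvec n (\<lambda>m. 2 * u m) v) = det (transvec n u v) * det (transvec n u v)"
    by (simp only: det_mult[OF transvec_carrier transvec_carrier])
  with d show ?thesis
    by (elim disjE) simp_all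
qed

section \<open>Elementary matrices\<close>

lemma elem_index:
  "a < n \<Longrightarrow> b < n \<Longrightarrow> elem_mat n i j t $$ (a, b) = of_bool (a = b) + t * of_bool (a = i \<and> b = j)"
  by (simp add: elem_mat_def transvec_def one_plus_index unit_def of_bool_conj)

lemma dot_unit_unit: "i < n \<Longrightarrow> dot n (unit i) (unit j) = of_bool (i = j)"
  by (subst dot_unit(1)) (simp_all add: unit_def)

lemma elem_add:
  "i < n \<Longrightarrow> j < n \<Longrightarrow> i \<noteq> j \<Longrightarrow> elem_mat n i j s * elem_mat n i j t = elem_mat n i j (s + t)"
  unfolding elem_mat_def by (subst transvec_add_left) (simp_all add: dot_simps dot_unit_unit algebra_simps)

lemma elem_0: "elem_mat n i j 0 = 1\<^sub>m n"
  by (simp add: elem_mat_def transvec_0)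

lemma elem_inverse:
  "i < n \<Longrightarrow> j < n \<Longrightarrow> i \<noteq> j \<Longrightarrow> elem_mat n i j s * elem_mat n i j (- s) = 1\<^sub>m n"
  "i < n \<Longrightarrow> j < n \<Longrightarrow> i \<noteq> j \<Longrightarrow> elem_mat n i j (- s) * elem_mat n i j s = 1\<^sub>m n"
  by (simp_all add: elem_add elem_0)

lemma elem_bracket:
  assumes "i < n" "j < n" "k < n" "i \<noteq> j" "j \<noteq> k" "i \<noteq> k"
  shows "elem_mat n i j s * elem_mat n j k t = elem_mat n i k (s * t) * elem_mat n j k t * elem_mat n i j s"
proof -
  have d: "dot n (unit k) (\<lambda>m. t * unit j m) = 0" "dot n (unit k) (\<lambda>m. s * unit i m) = 0"
    "dot n (unit j) (\<lambda>m. t * unit j m) = t"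
    using assms by (simp_all only: dot_simps dot_unit) (simp_all add: unit_def)
  have "elem_mat n i k (s * t) * elem_mat n j k t = transvec n (\<lambda>m. s * t * unit i m + t * unit j m) (unit k)"
    unfolding elem_mat_def by (rule transvec_add_left[OF d(1)])
  then have "elem_mat n i k (s * t) * elem_mat n j k t * elem_mat n i j s
      = one_plus n (\<lambda>a b. (s * t * unit i a + t * unit j a) * unit k b + s * unit i a * unit j b)"
    unfolding elem_mat_def[of n i j] by (simp only: transvec_mult d mult_zero_left add_0_right)
  moreover have "elem_mat n i j s * elem_mat n j k t
      = one_plus n (\<lambda>a b. s * unit i a * unit j b + t * unit j a * unit k b + t * (s * unit i a) * unit k b)"
    unfolding elem_mat_def by (simp only: transvec_mult d)
  ultimately show ?thesis
    by (simp only:) (rule one_plus_cong, simp add: algebra_simps)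
qed

lemma elem_commute:
  assumes "i < n" "j < n" "k < n" "l < n" "j \<noteq> k" "i \<noteq> l"
  shows "elem_mat n i j s * elem_mat n k l t = elem_mat n k l t * elem_mat n i j s"
  using assms unfolding elem_mat_def transvec_mult
  by (intro one_plus_cong) (simp add: dot_simps dot_unit_unit algebra_simps)

text \<open>Column \<open>j\<close> of the two products shows that column \<open>i\<close> of
  \<open>C\<close> is \<open>C_jj\<close> times a unit vector. The parameter \<open>t\<close> may
  vary with the pair, as only certain multiples will be available.\<close>

lemma commutes_elem_imp_scalar:
  fixes C :: "'a::idom mat"
  assumes C: "C \<in> carrier_mat n n" and n: "n \<ge> 2"
    and comm: "\<And>i j. i < n \<Longrightarrow> j < n \<Longrightarrow> i \<noteq> j \<Longrightarrow> \<exists>t. t \<noteq> 0 \<and> C * elem_mat n i j t = elem_mat n i j t * C"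
  shows "\<exists>c. C = c \<cdot>\<^sub>m 1\<^sub>m n"
proof -
  have entry: "C $$ (a, i) = of_bool (a = i) * C $$ (j, j)" if "i < n" "j < n" "i \<noteq> j" "a < n" for i j a
  proof -
    from comm[OF that(1-3)] obtain t where t: "t \<noteq> 0" "C * elem_mat n i j t = elem_mat n i j t * C"
      by blast
    have "(C * elem_mat n i j t) $$ (a, j) = (\<Sum>k<n. C $$ (a, k) * of_bool (k = j) + t * C $$ (a, k) * of_bool (k = i))"
      unfolding mult_index[OF C elem_carrier that(4,2)]
      by (intro sum.cong refl) (use that in \<open>simp add: elem_index distrib_left\<close>)
    then have "(C * elem_mat n i j t) $$ (a, j) = C $$ (a, j) + t * C $$ (a, i)"
      using that by (simp only: sum.distrib sum_of_bool_mult if_True)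
    moreover have "(elem_mat n i j t * C) $$ (a, j)
        = (\<Sum>k<n. of_bool (a = k) * C $$ (k, j) + of_bool (k = j) * (t * of_bool (a = i) * C $$ (k, j)))"
      unfolding mult_index[OF elem_carrier C that(4,2)]
      by (intro sum.cong refl) (use that in \<open>auto simp add: elem_index distrib_right of_bool_def\<close>)
    then have "(elem_mat n i j t * C) $$ (a, j) = C $$ (a, j) + t * of_bool (a = i) * C $$ (j, j)"
      using that by (simp only: sum.distrib sum_of_bool_mult if_True)
    ultimately show ?thesis
      using t by simp
  qed
  have "C = C $$ (0, 0) \<cdot>\<^sub>m 1\<^sub>m n"
  proof (rule eq_matI)
    fix a i assume ai: "a < dim_row (C $$ (0, 0) \<cdot>\<^sub>m 1\<^sub>m n)" "i < dim_col (C $$ (0, 0) \<cdot>\<^sub>m 1\<^sub>m n)"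
    show "C $$ (a, i) = (C $$ (0, 0) \<cdot>\<^sub>m 1\<^sub>m n) $$ (a, i)"
    proof (cases "i = 0")
      case True
      then show ?thesis
        using entry[of 0 1 a] entry[of 0 1 0] ai n by simp
    next
      case False
      then show ?thesis
        using entry[of i 0 a] ai n by simp
    qed
  qed (use C in auto)
  then show ?thesis ..
qed

section \<open>Normal subgroups of the special linear group\<close>

lemma exists_third:
  fixes n :: nat
  assumes n3: "n \<ge> 3"
  shows "\<exists>k<n. k \<noteq> i \<and> k \<noteq> j"
proof -
  have "\<not> {..<n} \<subseteq> {i, j}"
  proof
    assume "{..<n} \<subseteq> {i, j}"
    then have "card {..<n} \<le> card {i, j}"
      by (rule card_mono[rotated]) simp
    also have "\<dots> \<le> 2"
      by (simp add: card_insert_if)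
    finally show False
      using n3 by simp
  qed
  then show ?thesis by auto
qed

text \<open>The closure conditions are phrased with matrix products and explicit inverses, so that
  commutators can be computed as matrices.\<close>

locale normal_in_SL =
  fixes n :: nat and L :: "int mat set"
  assumes n3: "n \<ge> 3"
    and L_carrier: "x \<in> L \<Longrightarrow> x \<in> carrier_mat n n"
    and L_mult: "x \<in> L \<Longrightarrow> y \<in> L \<Longrightarrow> x * y \<in> L"
    and L_inverse: "x \<in> L \<Longrightarrow> \<exists>y\<in>L. x * y = 1\<^sub>m n \<and> y * x = 1\<^sub>m n"
    and L_conj: "x \<in> L \<Longrightarrow> g \<in> carrier_mat n n \<Longrightarrow> h \<in> carrier_mat n n \<Longrightarrow> det g = 1 \<Longrightarrow>
      g * h = 1\<^sub>m n \<Longrightarrow> g * x * h \<in> L"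
begin

lemma assoc: "x \<in> carrier_mat n n \<Longrightarrow> y \<in> carrier_mat n n \<Longrightarrow> z \<in> carrier_mat n n \<Longrightarrow>
    x * y * z = x * (y * z)" for x y z :: "int mat"
  by (rule assoc_mult_mat)

lemma L_inverseI:
  assumes "x \<in> L" "y \<in> carrier_mat n n" "x * y = 1\<^sub>m n"
  shows "y \<in> L"
proof -
  obtain z where z: "z \<in> L" "z * x = 1\<^sub>m n"
    using L_inverse[OF assms(1)] by blast
  have "y = (z * x) * y"
    using assms(2) by (simp add: z)
  also have "\<dots> = z * (x * y)"
    using assms z L_carrier by (intro assoc)
  also have "\<dots> = z"
    using L_carrier[OF z(1)] assms(3) by simp
  finally show ?thesis using z by simp
qed

lemma commutator_in:
  assumes x: "x \<in> L" "xi \<in> L"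
    and g: "g \<in> carrier_mat n n" "h \<in> carrier_mat n n" "det g = 1" "g * h = 1\<^sub>m n"
  shows "x * g * xi * h \<in> L"
proof -
  have "x * (g * xi * h) \<in> L"
    using x g by (intro L_mult L_conj)
  moreover have "x * (g * xi * h) = x * g * xi * h"
    using x[THEN L_carrier] g by (simp add: assoc mult_carrier_mat[of _ n n _ n])
  ultimately show ?thesis by simp
qed

section \<open>Commutators with transvections\<close>

lemma transvec_uminus_in:
  assumes "transvec n y w \<in> L" "dot n w y = 0"
  shows "transvec n (\<lambda>m. - y m) w \<in> L"
  using assms by (intro L_inverseI[OF assms(1)] transvec_inverse) auto

text \<open>Conjugation by \<open>1 + y w^T\<close> turns \<open>1 + 2 z x^T\<close> into
  \<open>1 + 2 z (x - <x,y> w)^T\<close>, so the commutator is \<open>1 - 2 <x,y> z w^T\<close>: the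
  direction \<open>y\<close> has been replaced by \<open>z\<close>.\<close>

lemma transvec_move_left:
  assumes T: "transvec n y w \<in> L" "dot n w y = 0" and z: "dot n w z = 0" "dot n x z = 0"
  shows "transvec n (\<lambda>m. - 2 * dot n x y * z m) w \<in> L"
proof -
  let ?h = "transvec n (\<lambda>m. - (2 * z m)) x"
  have xz: "dot n x (\<lambda>m. 2 * z m) = 0"
    using z by (simp add: dot_simps)
  have "transvec n y w * transvec n (\<lambda>m. 2 * z m) x * transvec n (\<lambda>m. - y m) w * ?h \<in> L"
    by (rule commutator_in[OF T(1) transvec_uminus_in[OF T] _ _ det_transvec_even[OF z(2)] transvec_inverse(1)[OF xz]])
      simp_all
  also have "transvec n y w * transvec n (\<lambda>m. 2 * z m) x * transvec n (\<lambda>m. - y m) w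
      = transvec n (\<lambda>m. 2 * z m) (\<lambda>m. x m - dot n x y * w m)"
    unfolding transvec_conj_transvec[OF T(2)] by (simp add: dot_simps z)
  also have "?h = transvec n (\<lambda>m. 2 * z m) (\<lambda>m. - x m)"
    unfolding transvec_def by simp
  also have "transvec n (\<lambda>m. 2 * z m) (\<lambda>m. x m - dot n x y * w m) * transvec n (\<lambda>m. 2 * z m) (\<lambda>m. - x m)
      = transvec n (\<lambda>m. 2 * z m) (\<lambda>m. x m - dot n x y * w m + - x m)"
    by (rule transvec_add_right) (use z in \<open>simp add: dot_simps\<close>)
  also have "\<dots> = transvec n (\<lambda>m. - 2 * dot n x y * z m) w"
    unfolding transvec_def by (rule one_plus_cong) (simp add: algebra_simps)
  finally show ?thesis .
qed

text \<open>The same commutator under the other orthogonality conditions: now the column vector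
  changes to \<open>2 z + 2 <w,z> y\<close>, and the row vector \<open>w\<close> is replaced by
  \<open>x\<close>.\<close>

lemma transvec_move_right:
  assumes T: "transvec n y w \<in> L" "dot n w y = 0" and x: "dot n x y = 0" "dot n x z = 0"
  shows "transvec n (\<lambda>m. 2 * dot n w z * y m) x \<in> L"
proof -
  let ?h = "transvec n (\<lambda>m. - (2 * z m)) x"
  have xz: "dot n x (\<lambda>m. 2 * z m) = 0"
    using x by (simp add: dot_simps)
  have "transvec n y w * transvec n (\<lambda>m. 2 * z m) x * transvec n (\<lambda>m. - y m) w * ?h \<in> L"
    by (rule commutator_in[OF T(1) transvec_uminus_in[OF T] _ _ det_transvec_even[OF x(2)] transvec_inverse(1)[OF xz]])
      simp_all
  also have "transvec n y w * transvec n (\<lambda>m. 2 * z m) x * transvec n (\<lambda>m. - y m) w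
      = transvec n (\<lambda>m. 2 * z m + 2 * dot n w z * y m) x"
    unfolding transvec_conj_transvec[OF T(2)] by (simp add: dot_simps x)
  also have "\<dots> * ?h = transvec n (\<lambda>m. 2 * z m + 2 * dot n w z * y m + - (2 * z m)) x"
    by (rule transvec_add_left) (use x in \<open>simp add: dot_simps\<close>)
  also have "\<dots> = transvec n (\<lambda>m. 2 * dot n w z * y m) x"
    by simp
  finally show ?thesis .
qed

lemma one_plus_square_zero_power_in:
  assumes "one_plus n N \<in> L" "\<And>a b. a < n \<Longrightarrow> b < n \<Longrightarrow> (\<Sum>k<n. N a k * N k b) = 0"
  shows "one_plus n (\<lambda>a b. int (Suc k) * N a b) \<in> L"
proof (induction k)
  case 0
  then show ?case using assms(1) by simp
next
  case (Suc k)
  have "one_plus n (\<lambda>a b. int (Suc k) * N a b) * one_plus n N \<in> L"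
    by (rule L_mult[OF Suc assms(1)])
  also have "one_plus n (\<lambda>a b. int (Suc k) * N a b) * one_plus n N
      = one_plus n (\<lambda>a b. int (Suc (Suc k)) * N a b)"
    unfolding one_plus_mult
  proof (rule one_plus_cong)
    fix a b assume "a < n" "b < n"
    then have "(\<Sum>l<n. int (Suc k) * N a l * N l b) = 0"
      by (simp only: mult.assoc sum_distrib_left[symmetric] assms(2) mult_zero_right)
    then show "int (Suc k) * N a b + N a b + (\<Sum>l<n. int (Suc k) * N a l * N l b)
        = int (Suc (Suc k)) * N a b"
      by (simp only: of_nat_Suc distrib_right)
  qed
  finally show ?case .
qed

text \<open>Two coordinates \<open>p\<close>, \<open>q\<close> different from \<open>i\<close> leave
  room for a vector orthogonal to \<open>u\<close>; this is where \<open>n \<ge> 3\<close> enters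
  the search for a transvection.\<close>

lemma exists_orthogonal:
  assumes "i < n"
  shows "\<exists>w :: nat \<Rightarrow> int. dot n w u = 0 \<and> w i = 0 \<and> (\<exists>p<n. w p \<noteq> 0)"
proof -
  obtain p where p: "p < n" "p \<noteq> i"
    using exists_third[OF n3, of i i] by blast
  obtain q where q: "q < n" "q \<noteq> i" "q \<noteq> p"
    using exists_third[OF n3, of i p] by blast
  show ?thesis
  proof (cases "u p = 0")
    case True
    then show ?thesis
      using p by (intro exI[of _ "unit p"]) (auto simp: dot_unit)
  next
    case False
    then show ?thesis
      using p q
      by (intro exI[of _ "\<lambda>m. u q * unit p m - u p * unit q m"] conjI exI[of _ q])
        (simp_all add: dot_simps dot_unit)
  qed
qed

definition transvection_vectors :: "(nat \<Rightarrow> int) \<Rightarrow> (nat \<Rightarrow> int) \<Rightarrow> bool" where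
  "transvection_vectors y w \<longleftrightarrow> transvec n y w \<in> L \<and> dot n w y = 0 \<and> (\<exists>a<n. y a \<noteq> 0) \<and> (\<exists>p<n. w p \<noteq> 0)"

text \<open>The commutator \<open>c\<close> of \<open>x\<close> with \<open>E_ij(2)\<close> is a
  product of two transvections, so it fixes a row vector \<open>w\<close> orthogonal to both of
  their directions. Commutators of \<open>c\<close> with \<open>1 + 2 z w^T\<close>, for
  \<open>z\<close> orthogonal to \<open>w\<close>, are then transvections
  \<open>1 + (2 c z - 2 z) w^T\<close>. If all of them are trivial, \<open>c\<close> fixes the
  hyperplane orthogonal to \<open>w\<close>, and a power of \<open>c\<close> itself is the desired
  transvection.\<close>

lemma exists_transvection:
  assumes x: "x \<in> L" and ij: "i < n" "j < n" "i \<noteq> j" and ne: "x * elem_mat n i j 2 \<noteq> elem_mat n i j 2 * x"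
  shows "\<exists>y w. transvection_vectors y w"
proof -
  obtain xi where xi: "xi \<in> L" "x * xi = 1\<^sub>m n" "xi * x = 1\<^sub>m n"
    using L_inverse[OF x] by blast
  note xc = L_carrier[OF x] and xic = L_carrier[OF xi(1)]
  define c where "c = x * elem_mat n i j 2 * xi * elem_mat n i j (- 2)"
  have det1: "det (elem_mat n i j (2::int)) = 1"
    unfolding elem_mat_def by (rule det_transvec_even) (use ij in \<open>simp add: dot_unit\<close>)
  have c: "c \<in> L"
    unfolding c_def by (rule commutator_in[OF x xi(1) elem_carrier elem_carrier det1 elem_inverse(1)[OF ij]])
  have c_ne: "c \<noteq> 1\<^sub>m n"
  proof
    assume c1: "c = 1\<^sub>m n"
    have "c * (elem_mat n i j 2 * x)
        = x * elem_mat n i j 2 * (xi * ((elem_mat n i j (- 2) * elem_mat n i j 2) * x))"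
      unfolding c_def using xc xic by (simp add: assoc mult_carrier_mat[of _ n n _ n])
    also have "\<dots> = x * elem_mat n i j 2"
      using xc xi(3)
      by (simp add: elem_inverse(2)[OF ij] right_mult_one_mat[OF mult_carrier_mat[OF xc elem_carrier]])
    finally have "x * elem_mat n i j 2 = c * (elem_mat n i j 2 * x)" ..
    also have "\<dots> = elem_mat n i j 2 * x"
      unfolding c1 by (rule left_mult_one_mat[OF mult_carrier_mat[OF elem_carrier xc]])
    finally show False using ne by simp
  qed
  define U where "U = (\<lambda>a. \<Sum>k<n. x $$ (a, k) * (2 * unit i k))"
  define V where "V = (\<lambda>b. \<Sum>k<n. unit j k * xi $$ (k, b))"
  have c_eq: "c = transvec n U V * transvec n (\<lambda>m. - 2 * unit i m) (unit j)"
    unfolding c_def elem_mat_def transvec_conj[OF xc xic xi(2)] U_def V_def ..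
  obtain w p where w: "dot n w U = 0" "w i = 0" and p: "p < n" "w p \<noteq> 0"
    using exists_orthogonal[OF ij(1), of U] by blast
  have wc: "(\<Sum>a<n. w a * c $$ (a, b)) = w b" if b: "b < n" for b
  proof -
    have "(\<Sum>a<n. w a * c $$ (a, b)) = (\<Sum>a<n. w a * of_bool (a = b) + w a * U a * (V b + dot n V (\<lambda>m. - 2 * unit i m) * unit j b)
        + w a * unit i a * (- 2 * unit j b))"
      unfolding c_eq transvec_mult
      by (intro sum.cong refl) (simp add: one_plus_index b algebra_simps)
    also have "\<dots> = w b + dot n w U * (V b + dot n V (\<lambda>m. - 2 * unit i m) * unit j b) + dot n w (unit i) * (- 2 * unit j b)"
      using b by (simp only: sum.distrib dot_def sum_distrib_right sum_of_bool_mult if_True)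
    finally show ?thesis
      using w ij by (simp add: dot_unit)
  qed
  obtain ci where ci: "ci \<in> L" "c * ci = 1\<^sub>m n"
    using L_inverse[OF c] by blast
  note cc = L_carrier[OF c] and cic = L_carrier[OF ci(1)]
  have wci: "(\<Sum>a<n. w a * ci $$ (a, b)) = w b" if b: "b < n" for b
  proof -
    have "(\<Sum>a<n. w a * ci $$ (a, b)) = (\<Sum>a<n. (\<Sum>k<n. w k * c $$ (k, a)) * ci $$ (a, b))"
      by (intro sum.cong refl) (simp add: wc)
    also have "\<dots> = (\<Sum>k<n. \<Sum>a<n. w k * (c $$ (k, a) * ci $$ (a, b)))"
      by (subst sum.swap) (simp add: sum_distrib_right mult.assoc)
    also have "\<dots> = (\<Sum>k<n. w k * (c * ci) $$ (k, b))"
      by (intro sum.cong refl) (simp add: mult_index[OF cc cic] b sum_distrib_left)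
    also have "\<dots> = (\<Sum>k<n. w k * of_bool (k = b))"
      by (intro sum.cong refl) (simp add: ci b)
    finally show ?thesis
      using b by simp
  qed
  define y where "y = (\<lambda>z a. (\<Sum>k<n. c $$ (a, k) * (2 * z k)) - 2 * z a)"
  have y_in: "transvec n (y z) w \<in> L" "dot n w (y z) = 0" if z: "dot n w z = 0" for z
  proof -
    have z2: "dot n w (\<lambda>m. 2 * z m) = 0" "dot n w (\<lambda>m. - (2 * z m)) = 0"
      using z by (simp_all add: dot_simps)
    have "c * transvec n (\<lambda>m. 2 * z m) w * ci * transvec n (\<lambda>m. - (2 * z m)) w \<in> L"
      by (rule commutator_in[OF c ci(1) _ _ det_transvec_even[OF z] transvec_inverse(1)[OF z2(1)]]) simp_all
    also have "c * transvec n (\<lambda>m. 2 * z m) w * ci = transvec n (\<lambda>a. \<Sum>k<n. c $$ (a, k) * (2 * z k)) w"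
      unfolding transvec_conj[OF cc cic ci(2)] by (rule transvec_cong) (simp_all add: wci)
    also have "\<dots> * transvec n (\<lambda>m. - (2 * z m)) w = transvec n (y z) w"
      unfolding y_def transvec_add_left[OF z2(2)] by simp
    finally show "transvec n (y z) w \<in> L" .
    have "(\<Sum>a<n. w a * (\<Sum>k<n. c $$ (a, k) * (2 * z k))) = (\<Sum>k<n. (\<Sum>a<n. w a * c $$ (a, k)) * (2 * z k))"
      unfolding sum_distrib_left sum_distrib_right by (subst sum.swap) (simp add: mult.assoc)
    also have "\<dots> = (\<Sum>k<n. w k * (2 * z k))"
      by (intro sum.cong refl) (simp add: wc)
    finally have "dot n w (\<lambda>a. \<Sum>k<n. c $$ (a, k) * (2 * z k)) = dot n w (\<lambda>m. 2 * z m)"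
      by (simp only: dot_def)
    then show "dot n w (y z) = 0"
      unfolding y_def dot_simps by simp
  qed
  show ?thesis
  proof (cases "\<exists>z a. dot n w z = 0 \<and> a < n \<and> y z a \<noteq> 0")
    case True
    then show ?thesis
      using y_in p unfolding transvection_vectors_def by blast
  next
    case False
    define N where "N = (\<lambda>a b. c $$ (a, b) - of_bool (a = b))"
    have c_N: "c = one_plus n N"
      unfolding N_def by (rule mat_eq_one_plus[OF cc])
    have wN: "(\<Sum>a<n. w a * N a b) = 0" if b: "b < n" for b
      using wc[OF b] b unfolding N_def by (simp add: right_diff_distrib sum_subtractf)
    \<comment> \<open>\<open>N = c - 1\<close> kills the vectors \<open>w_p e_m - w_m e_p\<close>,
      so its rows are rational multiples of \<open>w\<close>; together with \<open>w N = 0\<close>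
      this gives \<open>N^2 = 0\<close>.\<close>
    have rel: "w p * N a m = w m * N a p" if am: "a < n" "m < n" for a m
    proof -
      let ?z = "\<lambda>k. w p * unit m k - w m * unit p k"
      have "dot n w ?z = 0"
        using am p by (simp add: dot_simps dot_unit)
      then have "y ?z a = 0"
        using False am by blast
      moreover have "(\<Sum>k<n. c $$ (a, k) * (2 * ?z k)) = 2 * (w p * c $$ (a, m) - w m * c $$ (a, p))"
      proof -
        have "(\<Sum>k<n. c $$ (a, k) * (2 * ?z k)) = dot n (\<lambda>k. c $$ (a, k)) (\<lambda>k. 2 * ?z k)"
          by (simp only: dot_def)
        then show ?thesis
          using am p by (simp only: dot_simps dot_unit)
      qed
      ultimately show ?thesis
        by (simp add: y_def N_def unit_def algebra_simps)
    qed
    have sq: "(\<Sum>k<n. N a k * N k b) = 0" if ab: "a < n" "b < n" for a b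
    proof -
      have "w p * (\<Sum>k<n. N a k * N k b) = (\<Sum>k<n. N a p * (w k * N k b))"
        unfolding sum_distrib_left
      proof (intro sum.cong refl)
        fix k assume "k \<in> {..<n}"
        then have "(w p * N a k) * N k b = (w k * N a p) * N k b"
          using rel[of a k] ab by simp
        then show "w p * (N a k * N k b) = N a p * (w k * N k b)"
          by (simp only: mult_ac)
      qed
      also have "\<dots> = 0"
        using wN[OF ab(2)] by (simp add: sum_distrib_left[symmetric])
      finally show ?thesis using p by simp
    qed
    \<comment> \<open>The \<open>|w p|\<close>-th power of \<open>c = 1 + N\<close> clears the
      denominator \<open>w p\<close>; its sign goes into the column vector.\<close>
    obtain k where k: "\<bar>w p\<bar> = int (Suc k)"
      using p by (metis abs_ge_zero abs_eq_0 int_nat_eq nat_0_iff not0_implies_Suc of_nat_0 zero_le_imp_eq_int)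
    let ?y = "\<lambda>a. sgn (w p) * N a p"
    have "one_plus n (\<lambda>a b. int (Suc k) * N a b) \<in> L"
      using c sq unfolding c_N by (rule one_plus_square_zero_power_in)
    also have "one_plus n (\<lambda>a b. int (Suc k) * N a b) = transvec n ?y w"
      unfolding transvec_def k[symmetric]
    proof (rule one_plus_cong)
      fix a b assume "a < n" "b < n"
      then show "\<bar>w p\<bar> * N a b = sgn (w p) * N a p * w b"
        using rel[of a b] by (simp add: abs_sgn mult.commute mult.left_commute)
    qed
    finally have "transvec n ?y w \<in> L" .
    moreover have "dot n w ?y = 0"
      using wN[OF p(1)] unfolding dot_simps by (simp add: dot_def)
    moreover have "\<exists>a<n. ?y a \<noteq> 0"
    proof (rule ccontr)
      assume *: "\<not> ?thesis"
      have "N a m = 0" if "a < n" "m < n" for a m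
        using * rel[OF that] p that by (auto simp: sgn_eq_0_iff)
      then have "c = one_plus n (\<lambda>_ _. 0)"
        unfolding c_N by (rule one_plus_cong)
      then show False
        using c_ne by (simp add: one_plus_0)
    qed
    ultimately show ?thesis
      using p unfolding transvection_vectors_def by blast
  qed
qed

text \<open>Three moves turn \<open>1 + y w^T\<close> into an elementary matrix: \<open>y\<close>
  becomes a multiple of \<open>z\<close>, then \<open>w\<close> becomes \<open>unit k\<close>, then
  \<open>z\<close> becomes \<open>unit p\<close>. The index \<open>k\<close> exists because
  \<open>dot n w y = 0\<close> with \<open>w p \<noteq> 0\<close> prevents \<open>y\<close> from
  being supported at \<open>p\<close> alone.\<close>

lemma exists_elem:
  assumes "transvection_vectors y w"
  shows "\<exists>p k m. p < n \<and> k < n \<and> p \<noteq> k \<and> m \<noteq> 0 \<and> elem_mat n p k m \<in> L"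
proof -
  have T: "transvec n y w \<in> L" "dot n w y = 0" and yw: "\<exists>a<n. y a \<noteq> 0" "\<exists>p<n. w p \<noteq> 0"
    using assms by (auto simp: transvection_vectors_def)
  obtain p where p: "p < n" "w p \<noteq> 0"
    using yw by blast
  have "\<exists>k<n. k \<noteq> p \<and> y k \<noteq> 0"
  proof (rule ccontr)
    assume *: "\<not> ?thesis"
    then have "dot n w y = (\<Sum>k\<in>{p}. w k * y k)"
      unfolding dot_def by (intro sum.mono_neutral_right) (use p in auto)
    then have "y p = 0"
      using T p by simp
    with * yw show False by metis
  qed
  then obtain k where k: "k < n" "k \<noteq> p" "y k \<noteq> 0" by blast
  obtain b where b: "b < n" "b \<noteq> p" "b \<noteq> k"
    using exists_third[OF n3, of p k] by blast
  \<comment> \<open>Orthogonal to \<open>w\<close> and zero at \<open>k\<close>, while the entry at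
    the third index \<open>b\<close> is nonzero, which keeps the last move nontrivial.\<close>
  define z where "z = (\<lambda>m. w b * unit p m - w p * unit b m)"
  have z: "dot n w z = 0" "dot n (unit k) z = 0" "z b = - w p" "z k = 0"
    using p k b by (simp_all add: z_def dot_simps dot_unit)
  let ?y1 = "\<lambda>m. - 2 * dot n (unit k) y * z m"
  have 1: "transvec n ?y1 w \<in> L"
    by (rule transvec_move_left[OF T z(1,2)])
  have d1: "dot n w ?y1 = 0" "dot n (unit k) ?y1 = 0" "dot n (unit k) (unit p) = (0::int)"
    using z k p by (simp_all add: dot_simps dot_unit)
  let ?y2 = "\<lambda>m. 2 * dot n w (unit p) * ?y1 m"
  have 2: "transvec n ?y2 (unit k) \<in> L"
    by (rule transvec_move_right[OF 1 d1])
  have d2: "dot n (unit k) ?y2 = 0" "dot n (unit b) (unit p) = (0::int)"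
    using d1 b p by (simp_all add: dot_simps dot_unit)
  have 3: "transvec n (\<lambda>m. - 2 * dot n (unit b) ?y2 * unit p m) (unit k) \<in> L"
    by (rule transvec_move_left[OF 2 d2(1) d1(3) d2(2)])
  have "- 2 * dot n (unit b) ?y2 \<noteq> 0"
    using p k b z by (simp add: dot_simps dot_unit)
  then show ?thesis
    using 3 p k unfolding elem_mat_def by blast
qed

lemma elem_move_row:
  assumes "elem_mat n p k m \<in> L" "p < n" "k < n" "i < n" "p \<noteq> k" "i \<noteq> k" "m \<noteq> 0"
  shows "\<exists>m'. m' \<noteq> 0 \<and> elem_mat n i k m' \<in> L"
proof (cases "i = p")
  case False
  have "transvec n (\<lambda>l. - 2 * dot n (unit p) (\<lambda>l. m * unit p l) * unit i l) (unit k) \<in> L"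
    by (rule transvec_move_left) (use assms False in \<open>simp_all add: elem_mat_def dot_simps dot_unit\<close>)
  moreover have "- 2 * dot n (unit p) (\<lambda>l. m * unit p l) = - 2 * m"
    using assms by (simp add: dot_simps dot_unit)
  ultimately have "elem_mat n i k (- 2 * m) \<in> L"
    unfolding elem_mat_def by simp
  then show ?thesis
    using assms(7) by (intro exI[of _ "- 2 * m"]) simp
qed (use assms in auto)

lemma elem_move_col:
  assumes "elem_mat n p k m \<in> L" "p < n" "k < n" "j < n" "p \<noteq> k" "j \<noteq> p" "m \<noteq> 0"
  shows "\<exists>m'. m' \<noteq> 0 \<and> elem_mat n p j m' \<in> L"
proof (cases "j = k")
  case False
  have "transvec n (\<lambda>l. 2 * dot n (unit k) (unit k) * (m * unit p l)) (unit j) \<in> L"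
    by (rule transvec_move_right) (use assms False in \<open>simp_all add: elem_mat_def dot_simps dot_unit\<close>)
  moreover have "dot n (unit k) (unit k) = (1::int)"
    using assms by (simp add: dot_unit)
  ultimately have "elem_mat n p j (2 * m) \<in> L"
    unfolding elem_mat_def by (simp add: mult.assoc)
  then show ?thesis
    using assms(7) by (intro exI[of _ "2 * m"]) simp
qed (use assms in auto)

text \<open>The row index first moves to \<open>l\<close>, chosen away from both \<open>k\<close>
  and \<open>j\<close>, so that no intermediate position is diagonal.\<close>

lemma all_elem:
  assumes "elem_mat n p k m \<in> L" "p < n" "k < n" "p \<noteq> k" "m \<noteq> 0" "i < n" "j < n" "i \<noteq> j"
  shows "\<exists>m'. m' \<noteq> 0 \<and> elem_mat n i j m' \<in> L"
proof -
  obtain l where l: "l < n" "l \<noteq> k" "l \<noteq> j"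
    using exists_third[OF n3, of k j] by blast
  obtain m1 where "m1 \<noteq> 0" "elem_mat n l k m1 \<in> L"
    using elem_move_row[of p k m l] assms l by blast
  then obtain m2 where "m2 \<noteq> 0" "elem_mat n l j m2 \<in> L"
    using elem_move_col[of l k m1 j] assms l by blast
  then show ?thesis
    using elem_move_row[of l j m2 i] assms l by blast
qed

lemma one_in: "x \<in> L \<Longrightarrow> 1\<^sub>m n \<in> L"
  using L_inverse L_mult by metis

lemma elem_multiple_in:
  assumes e: "elem_mat n i j m \<in> L" "i < n" "j < n" "i \<noteq> j"
  shows "elem_mat n i j (m * k) \<in> L"
proof -
  have nat: "elem_mat n i j (m * int k) \<in> L" for k
  proof (induction k)
    case 0
    then show ?case using one_in[OF e(1)] by (simp add: elem_0)
  next
    case (Suc k)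
    then show ?case
      using L_mult[OF Suc e(1)] e by (simp add: elem_add algebra_simps)
  qed
  show ?thesis
  proof (cases "k \<ge> 0")
    case True
    then show ?thesis using nat[of "nat k"] by simp
  next
    case False
    then have "elem_mat n i j (- (m * k)) \<in> L"
      using nat[of "nat (- k)"] by simp
    then show ?thesis
      using elem_inverse(2)[OF e(2-4)] by (rule L_inverseI[OF _ elem_carrier])
  qed
qed

theorem contains_level:
  assumes x: "x \<in> L" and ij: "i < n" "j < n" "i \<noteq> j" and ne: "x * elem_mat n i j 2 \<noteq> elem_mat n i j 2 * x"
  shows "\<exists>m>0. \<forall>i j k. i < n \<and> j < n \<and> i \<noteq> j \<longrightarrow> elem_mat n i j (m * k) \<in> L"
proof -
  have "\<exists>m. m \<noteq> 0 \<and> elem_mat n i j m \<in> L" if "i < n" "j < n" "i \<noteq> j" for i j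
    using exists_transvection[OF assms] exists_elem all_elem that by blast
  then obtain f where f: "\<And>i j. i < n \<Longrightarrow> j < n \<Longrightarrow> i \<noteq> j \<Longrightarrow> f i j \<noteq> 0 \<and> elem_mat n i j (f i j) \<in> L"
    by metis
  define P where "P = {(i, j). i < n \<and> j < n \<and> i \<noteq> j}"
  have finP: "finite P"
    by (rule finite_subset[of _ "{..<n} \<times> {..<n}"]) (auto simp: P_def)
  define m where "m = (\<Prod>(i, j)\<in>P. \<bar>f i j\<bar>)"
  have "m > 0"
    unfolding m_def using f by (intro prod_pos) (auto simp: P_def)
  moreover have "elem_mat n i j (m * k) \<in> L" if "i < n" "j < n" "i \<noteq> j" for i j k
  proof -
    have "f i j dvd m"
      unfolding m_def using dvd_prodI[OF finP, of "(i, j)" "\<lambda>(i, j). \<bar>f i j\<bar>"] that by (simp add: P_def)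
    then show ?thesis
      using elem_multiple_in f that by (metis dvdE mult.assoc)
  qed
  ultimately show ?thesis by blast
qed

end

section \<open>Transvections in a multiplicatively closed set of matrices\<close>

locale elem_closed =
  fixes n :: nat and M :: int and G :: "int mat set"
  assumes n3: "n \<ge> 3"
    and G_mult: "x \<in> G \<Longrightarrow> y \<in> G \<Longrightarrow> x * y \<in> G"
    and G_elem: "i < n \<Longrightarrow> j < n \<Longrightarrow> i \<noteq> j \<Longrightarrow> elem_mat n i j (M * k) \<in> G"
begin

lemma G_one: "1\<^sub>m n \<in> G"
  using G_elem[of 0 1 0] n3 by (simp add: elem_0)

text \<open>Transvections with a common row vector add up; the condition
  \<open>c i * v i = 0\<close> keeps each partial sum orthogonal to \<open>v\<close>.\<close>

lemma transvec_left_sum: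
  assumes G: "\<And>i. i < n \<Longrightarrow> transvec n (\<lambda>m. c i * unit i m) v \<in> G"
    and z: "\<And>i. i < n \<Longrightarrow> c i * v i = 0"
  shows "transvec n c v \<in> G"
proof -
  have "transvec n (\<lambda>m. of_bool (m < r) * c m) v \<in> G" if "r \<le> n" for r
    using that
  proof (induction r)
    case 0
    then show ?case by (simp add: transvec_0 G_one)
  next
    case (Suc r)
    have "transvec n (\<lambda>m. of_bool (m < r) * c m) v * transvec n (\<lambda>m. c r * unit r m) v \<in> G"
      using Suc G by (intro G_mult) auto
    also have "transvec n (\<lambda>m. of_bool (m < r) * c m) v * transvec n (\<lambda>m. c r * unit r m) v
        = transvec n (\<lambda>m. of_bool (m < r) * c m + c r * unit r m) v"
      by (rule transvec_add_left) (use Suc.prems z in \<open>simp add: dot_simps dot_unit\<close>)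
    also have "\<dots> = transvec n (\<lambda>m. of_bool (m < Suc r) * c m) v"
      by (rule transvec_cong) (auto simp: unit_def less_Suc_eq)
    finally show ?case .
  qed
  from this[of n] have "transvec n (\<lambda>m. of_bool (m < n) * c m) v \<in> G"
    by simp
  also have "transvec n (\<lambda>m. of_bool (m < n) * c m) v = transvec n c v"
    by (rule transvec_cong) simp_all
  finally show ?thesis .
qed

lemma transvec_right_sum:
  fixes r :: nat
  assumes G: "\<And>i. i < r \<Longrightarrow> transvec n u (W i) \<in> G"
    and z: "\<And>i. i < r \<Longrightarrow> dot n (W i) u = 0"
  shows "transvec n u (\<lambda>m. \<Sum>i<r. W i m) \<in> G \<and> dot n (\<lambda>m. \<Sum>i<r. W i m) u = 0"
  using assms
proof (induction r)
  case 0
  then show ?case by (simp add: transvec_0 G_one dot_def)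
next
  case (Suc r)
  then have IH: "transvec n u (\<lambda>m. \<Sum>i<r. W i m) \<in> G" "dot n (\<lambda>m. \<Sum>i<r. W i m) u = 0"
    by auto
  have "transvec n u (\<lambda>m. \<Sum>i<r. W i m) * transvec n u (W r) \<in> G"
    using IH Suc.prems by (intro G_mult) auto
  then show ?case
    using IH(2) Suc.prems unfolding transvec_add_right[OF IH(2)] by (simp add: dot_simps)
qed

lemma transvec_unit_right:
  assumes "k < n" "a k = 0"
  shows "transvec n (\<lambda>m. M * a m) (unit k) \<in> G"
proof (rule transvec_left_sum)
  fix i assume i: "i < n"
  show "transvec n (\<lambda>m. M * a i * unit i m) (unit k) \<in> G"
    using G_elem[of i k "a i"] i assms by (cases "i = k") (simp_all add: elem_mat_def transvec_0 G_one)
  show "M * a i * unit k i = 0"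
    using assms by (cases "i = k") simp_all
qed

lemma transvec_unit_left:
  assumes "k < n" "b k = 0"
  shows "transvec n (unit k) (\<lambda>m. M * b m) \<in> G"
proof -
  have "transvec n (unit k) (\<lambda>m. \<Sum>i<n. M * b i * unit i m) \<in> G"
  proof (rule transvec_right_sum[THEN conjunct1])
    fix i assume i: "i < n"
    show "transvec n (unit k) (\<lambda>m. M * b i * unit i m) \<in> G"
      using G_elem[of k i "b i"] i assms
      by (cases "i = k") (simp_all add: elem_mat_def transvec_0 G_one transvec_scale_move)
    show "dot n (\<lambda>m. M * b i * unit i m) (unit k) = 0"
      using assms i by (cases "i = k") (simp_all add: dot_simps dot_unit)
  qed
  also have "transvec n (unit k) (\<lambda>m. \<Sum>i<n. M * b i * unit i m) = transvec n (unit k) (\<lambda>m. M * b m)"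
    by (rule transvec_cong) (simp_all add: unit_def)
  finally show ?thesis .
qed

text \<open>At a coordinate \<open>k\<close> where both vectors vanish, \<open>1 + M^2 a b^T\<close>
  is the commutator of \<open>1 + M a e_k^T\<close> and \<open>1 + M e_k b^T\<close>. The inverses
  are obtained by negating \<open>a\<close> and \<open>b\<close>.\<close>

lemma transvec_orthogonal_unit:
  assumes k: "k < n" "a k = 0" "b k = 0" and ba: "dot n b a = 0"
  shows "transvec n (\<lambda>m. M * M * a m) b \<in> G"
proof -
  have "transvec n (\<lambda>m. M * a m) (unit k) * transvec n (unit k) (\<lambda>m. M * b m)
      * transvec n (\<lambda>m. M * (- a m)) (unit k) * transvec n (unit k) (\<lambda>m. M * (- b m)) \<in> G"
    using k by (intro G_mult transvec_unit_left transvec_unit_right) auto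
  also have "transvec n (\<lambda>m. M * (- a m)) (unit k) = transvec n (\<lambda>m. - (M * a m)) (unit k)"
    by simp
  also have "transvec n (\<lambda>m. M * a m) (unit k) * transvec n (unit k) (\<lambda>m. M * b m) * \<dots>
      = transvec n (\<lambda>m. unit k m + M * a m) (\<lambda>m. M * b m)"
    by (subst transvec_conj_transvec) (use k ba in \<open>simp_all add: dot_simps dot_unit\<close>)
  also have "transvec n (unit k) (\<lambda>m. M * (- b m)) = transvec n (\<lambda>m. - unit k m) (\<lambda>m. M * b m)"
    by (simp add: transvec_def)
  also have "transvec n (\<lambda>m. unit k m + M * a m) (\<lambda>m. M * b m) * \<dots>
      = transvec n (\<lambda>m. unit k m + M * a m + - unit k m) (\<lambda>m. M * b m)"
    by (rule transvec_add_left) (use k in \<open>simp add: dot_simps dot_unit\<close>)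
  also have "\<dots> = transvec n (\<lambda>m. M * M * a m) b"
    by (simp add: transvec_def mult_ac)
  finally show ?thesis .
qed

text \<open>Split \<open>u\<close> into the part off \<open>i\<close> and \<open>p\<close>, where
  each coordinate gives a transvection along one unit vector, and the part on \<open>i\<close> and
  \<open>p\<close>, which is orthogonal to the row vector and misses the third index
  \<open>k\<close>.\<close>

lemma transvec_two_coordinates:
  assumes ip: "i < n" "p < n" "i \<noteq> p"
  shows "transvec n (\<lambda>m. M * M * u m) (\<lambda>m. c * (u p * unit i m - u i * unit p m)) \<in> G"
    (is "transvec n _ ?w \<in> G")
proof -
  obtain k where k: "k < n" "k \<noteq> i" "k \<noteq> p"
    using exists_third[OF n3, of i p] by blast
  define u1 where "u1 = (\<lambda>m. if m = i \<or> m = p then 0 else u m)"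
  define u2 where "u2 = (\<lambda>m. u i * unit i m + u p * unit p m)"
  have "transvec n (\<lambda>m. M * M * u1 m) ?w \<in> G"
  proof (rule transvec_left_sum)
    fix l assume l: "l < n"
    show "transvec n (\<lambda>m. M * M * u1 l * unit l m) ?w \<in> G"
    proof (cases "l = i \<or> l = p")
      case True
      then show ?thesis by (auto simp: u1_def transvec_0 G_one)
    next
      case False
      have "transvec n (unit l) (\<lambda>m. M * (M * u l * ?w m)) \<in> G"
        using l False by (intro transvec_unit_left) simp_all
      also have "transvec n (unit l) (\<lambda>m. M * (M * u l * ?w m)) = transvec n (\<lambda>m. M * M * u1 l * unit l m) ?w"
        using False by (simp add: transvec_def u1_def mult_ac)
      finally show ?thesis .
    qed
    show "M * M * u1 l * ?w l = 0"
      by (cases "l = i \<or> l = p") (simp_all add: u1_def)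
  qed
  moreover have d: "dot n ?w u2 = 0"
    using ip by (simp add: u2_def dot_simps dot_unit)
  have "transvec n (\<lambda>m. M * M * u2 m) ?w \<in> G"
    by (rule transvec_orthogonal_unit[OF k(1) _ _ d]) (use k in \<open>simp_all add: u2_def\<close>)
  ultimately have "transvec n (\<lambda>m. M * M * u1 m) ?w * transvec n (\<lambda>m. M * M * u2 m) ?w \<in> G"
    by (rule G_mult)
  also have "transvec n (\<lambda>m. M * M * u1 m) ?w * transvec n (\<lambda>m. M * M * u2 m) ?w
      = transvec n (\<lambda>m. M * M * u1 m + M * M * u2 m) ?w"
    by (rule transvec_add_left) (use d in \<open>simp only: dot_simps mult_zero_right\<close>)
  also have "\<dots> = transvec n (\<lambda>m. M * M * u m) ?w"
    by (rule transvec_cong) (use ip in \<open>auto simp: u1_def u2_def unit_def\<close>)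
  finally show ?thesis .
qed

text \<open>A vector orthogonal to \<open>u\<close> becomes, after multiplication by \<open>u p\<close>, an integral combination of the
  vectors \<open>u p * unit i - u i * unit p\<close>.\<close>

theorem transvec_multiple_in:
  assumes p: "p < n" and uv: "dot n v u = 0"
  shows "transvec n (\<lambda>m. M * M * u p * u m) v \<in> G"
proof -
  define W where "W = (\<lambda>i m. v i * (u p * unit i m - u i * unit p m))"
  have "transvec n (\<lambda>m. M * M * u m) (\<lambda>m. \<Sum>i<n. W i m) \<in> G"
  proof (rule transvec_right_sum[THEN conjunct1])
    fix i assume i: "i < n"
    show "transvec n (\<lambda>m. M * M * u m) (W i) \<in> G"
      using transvec_two_coordinates[OF i p] by (cases "i = p") (simp_all add: W_def transvec_0 G_one)
    show "dot n (W i) (\<lambda>m. M * M * u m) = 0"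
      using i p by (simp add: W_def dot_simps dot_unit)
  qed
  also have "transvec n (\<lambda>m. M * M * u m) (\<lambda>m. \<Sum>i<n. W i m)
      = transvec n (\<lambda>m. M * M * u m) (\<lambda>m. u p * v m)"
  proof (rule transvec_cong)
    fix m assume m: "m < n"
    have "(\<Sum>i<n. W i m) = (\<Sum>i<n. (u p * v i) * of_bool (m = i) - v i * u i * unit p m)"
      by (intro sum.cong refl) (simp add: W_def unit_def algebra_simps)
    also have "\<dots> = u p * v m - dot n v u * unit p m"
      using m by (simp only: sum_subtractf dot_def sum_distrib_right sum_of_bool_mult if_True)
    finally show "(\<Sum>i<n. W i m) = u p * v m"
      by (simp add: uv)
  qed simp
  also have "\<dots> = transvec n (\<lambda>m. M * M * u p * u m) v"
    by (simp add: transvec_def mult_ac)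
  finally show ?thesis .
qed

end

section \<open>Rigidity of injective endomorphisms\<close>

text \<open>Vectors are functions on all naturals, so the vector space is a type while the dimension
  \<open>n\<close> is carried by \<open>unit_vecs\<close>.\<close>

definition cscale :: "complex \<Rightarrow> (nat \<Rightarrow> complex) \<Rightarrow> nat \<Rightarrow> complex" where
  "cscale c f = (\<lambda>i. c * f i)"

definition unit_vecs :: "nat \<Rightarrow> (nat \<Rightarrow> complex) set" where
  "unit_vecs n = unit ` {..<n}"

interpretation cfun: vector_space cscale
  by unfold_locales (auto simp: cscale_def fun_eq_iff algebra_simps)

lemma fin_dim_unit_vecs: "fin_dim_subspace cscale (unit_vecs n)"
  by unfold_locales (simp add: unit_vecs_def)

lemma card_unit_vecs: "card (unit_vecs n) = n"
proof -
  have "inj_on (unit :: nat \<Rightarrow> nat \<Rightarrow> complex) {..<n}"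
    by (rule inj_onI) (metis unit_apply zero_neq_one)
  then show ?thesis
    by (simp add: unit_vecs_def card_image)
qed

lemma sum_fun_apply: "(\<Sum>i\<in>I. f i) x = (\<Sum>i\<in>I. f i x)" for f :: "'i \<Rightarrow> 'a \<Rightarrow> 'b::comm_monoid_add"
  by (induction I rule: infinite_finite_induct) auto

lemma span_unit_vecs: "cfun.span (unit_vecs n) = {f. \<forall>i\<ge>n. f i = 0}"
proof
  have "cfun.subspace {f. \<forall>i\<ge>n. f i = 0}"
    by (auto simp: cfun.subspace_def cscale_def)
  then show "cfun.span (unit_vecs n) \<subseteq> {f. \<forall>i\<ge>n. f i = 0}"
    by (intro cfun.span_minimal) (auto simp: unit_vecs_def unit_def)
  show "{f. \<forall>i\<ge>n. f i = 0} \<subseteq> cfun.span (unit_vecs n)"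
  proof
    fix f :: "nat \<Rightarrow> complex" assume f: "f \<in> {f. \<forall>i\<ge>n. f i = 0}"
    have "f = (\<Sum>i<n. cscale (f i) (unit i))"
      using f by (auto simp: fun_eq_iff sum_fun_apply cscale_def unit_def)
    also have "\<dots> \<in> cfun.span (unit_vecs n)"
      by (intro cfun.span_sum cfun.span_scale cfun.span_base) (simp add: unit_vecs_def)
    finally show "f \<in> cfun.span (unit_vecs n)" .
  qed
qed

text \<open>Acting as the identity on the coordinates from \<open>n\<close> on makes \<open>act\<close> multiplicative and unital.\<close>

definition act :: "nat \<Rightarrow> complex mat \<Rightarrow> (nat \<Rightarrow> complex) \<Rightarrow> nat \<Rightarrow> complex" where
  "act n A f = (\<lambda>i. if i < n then \<Sum>j<n. A $$ (i, j) * f j else f i)"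

lemma act_mult:
  assumes "A \<in> carrier_mat n n" "B \<in> carrier_mat n n"
  shows "act n (A * B) f = act n A (act n B f)"
proof
  fix i
  show "act n (A * B) f i = act n A (act n B f) i"
  proof (cases "i < n")
    case True
    have "(\<Sum>j<n. (A * B) $$ (i, j) * f j) = (\<Sum>j<n. \<Sum>k<n. A $$ (i, k) * (B $$ (k, j) * f j))"
      by (intro sum.cong refl) (simp add: mult_index[OF assms] True sum_distrib_right mult.assoc)
    also have "\<dots> = (\<Sum>k<n. A $$ (i, k) * (\<Sum>j<n. B $$ (k, j) * f j))"
      unfolding sum_distrib_left by (rule sum.swap)
    finally show ?thesis
      using True by (simp add: act_def)
  qed (simp add: act_def)
qed

lemma act_one: "act n (1\<^sub>m n) f = f"
proof
  fix i
  have "i < n \<Longrightarrow> (\<Sum>j<n. 1\<^sub>m n $$ (i, j) * f j) = (\<Sum>j<n. of_bool (i = j) * f j)"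
    by (intro sum.cong refl) simp
  then show "act n (1\<^sub>m n) f i = f i"
    by (simp add: act_def)
qed

lemma act_linear: "Modules.module_hom cscale cscale (act n A)"
proof -
  interpret fin_dim_subspace cscale "unit_vecs n"
    by (rule fin_dim_unit_vecs)
  show ?thesis
    by (rule linI) (auto simp: act_def cscale_def fun_eq_iff algebra_simps sum.distrib sum_distrib_left)
qed

lemma act_diff_in: "act n A f - f \<in> cfun.span (unit_vecs n)"
  by (simp add: span_unit_vecs act_def)

lemma act_span: "act n A ` cfun.span (unit_vecs n) \<subseteq> cfun.span (unit_vecs n)"
  by (auto simp: span_unit_vecs act_def)

abbreviation cmat :: "int mat \<Rightarrow> complex mat" where
  "cmat \<equiv> map_mat of_int"

lemma cmat_mult:
  "x \<in> carrier_mat n n \<Longrightarrow> y \<in> carrier_mat n n \<Longrightarrow> cmat (x * y) = cmat x * cmat y"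
  by (rule of_int_hom.mat_hom_mult)

lemma cmat_one: "cmat (1\<^sub>m n) = 1\<^sub>m n"
  by (rule of_int_hom.mat_hom_one)

lemma cmat_elem: "cmat (elem_mat n i j t) = elem_mat n i j (of_int t)"
  by (rule eq_matI) (auto simp: elem_index elem_mat_def transvec_def one_plus_def unit_def)

lemma inverse_mat_exists:
  fixes A :: "complex mat"
  assumes "A \<in> carrier_mat n n" "det A \<noteq> 0"
  shows "\<exists>B\<in>carrier_mat n n. A * B = 1\<^sub>m n \<and> B * A = 1\<^sub>m n"
  using det_non_zero_imp_unit[OF assms, of undefined] unfolding Units_def ring_mat_def by auto

lemma adj_mat_eqI:
  fixes x y :: "int mat"
  assumes xy: "x \<in> carrier_mat n n" "y \<in> carrier_mat n n" "x * y = 1\<^sub>m n" and d: "det x = 1"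
  shows "adj_mat x = y"
proof -
  have adj: "adj_mat x \<in> carrier_mat n n" "adj_mat x * x = 1\<^sub>m n"
    using adj_mat[OF xy(1)] d by auto
  have "adj_mat x = adj_mat x * (x * y)"
    using adj xy by simp
  also have "\<dots> = adj_mat x * x * y"
    using adj xy by (intro assoc_mult_mat[symmetric])
  also have "\<dots> = y"
    using adj xy by simp
  finally show ?thesis .
qed

section \<open>The complex representation given by an injective endomorphism\<close>

locale injective_endo = normal_in_SL n L for n L +
  fixes \<phi> :: "int mat \<Rightarrow> int mat" and m :: int
  assumes L_det: "x \<in> L \<Longrightarrow> det x = 1"
    and \<phi>_in: "x \<in> L \<Longrightarrow> \<phi> x \<in> L"
    and \<phi>_mult: "x \<in> L \<Longrightarrow> y \<in> L \<Longrightarrow> \<phi> (x * y) = \<phi> x * \<phi> y"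
    and \<phi>_inj: "inj_on \<phi> L"
    and m_pos: "m > 0"
    and level: "i < n \<Longrightarrow> j < n \<Longrightarrow> i \<noteq> j \<Longrightarrow> elem_mat n i j (m * k) \<in> L"
begin

lemma L_one: "1\<^sub>m n \<in> L"
  using level[of 0 1 0] n3 by (simp add: elem_0)

lemma \<phi>_carrier: "x \<in> L \<Longrightarrow> \<phi> x \<in> carrier_mat n n"
  using \<phi>_in L_carrier by blast

lemma \<phi>_one: "\<phi> (1\<^sub>m n) = 1\<^sub>m n"
proof -
  let ?e = "\<phi> (1\<^sub>m n)"
  have e: "?e * ?e = ?e" "?e \<in> L"
    using \<phi>_mult[OF L_one L_one] \<phi>_in[OF L_one] by auto
  obtain y where y: "y \<in> L" "?e * y = 1\<^sub>m n"
    using L_inverse[OF e(2)] by blast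
  have "?e = ?e * (?e * y)"
    using L_carrier[OF e(2)] y by simp
  also have "\<dots> = ?e * ?e * y"
    using e y L_carrier by (intro assoc[symmetric])
  also have "\<dots> = 1\<^sub>m n"
    by (simp add: e y)
  finally show ?thesis .
qed

definition rho :: "int mat \<Rightarrow> (nat \<Rightarrow> complex) \<Rightarrow> nat \<Rightarrow> complex" where
  "rho x = act n (cmat (\<phi> x))"

lemma rho_mult: "x \<in> L \<Longrightarrow> y \<in> L \<Longrightarrow> rho (x * y) f = rho x (rho y f)"
  unfolding rho_def by (simp add: \<phi>_mult \<phi>_carrier cmat_mult[of _ n] act_mult)

lemma rho_one: "rho (1\<^sub>m n) f = f"
  by (simp add: rho_def \<phi>_one cmat_one act_one)

lemma rho_zero: "rho x 0 = 0"
  by (auto simp: rho_def act_def)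

lemma rho_eq_0D:
  assumes "x \<in> L" "rho x f = 0"
  shows "f = 0"
proof -
  obtain y where y: "y \<in> L" "y * x = 1\<^sub>m n"
    using L_inverse[OF assms(1)] by blast
  have "f = rho (y * x) f"
    by (simp add: y rho_one)
  also have "\<dots> = 0"
    using rho_mult[OF y(1) assms(1)] assms(2) by (simp add: rho_zero)
  finally show ?thesis .
qed

lemma rho_elem_pow:
  assumes ij: "i < n" "j < n" "i \<noteq> j"
  shows "(rho (elem_mat n i j (m * s)) ^^ k) f = rho (elem_mat n i j (m * s * int k)) f"
proof (induction k)
  case 0
  then show ?case by (simp add: elem_0 rho_one)
next
  case (Suc k)
  have "elem_mat n i j (m * s * int (Suc k)) = elem_mat n i j (m * s) * elem_mat n i j (m * (s * int k))"
    using ij by (simp add: elem_add algebra_simps)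
  then show ?case
    using Suc rho_mult[OF level[OF ij] level[OF ij], of s "s * int k"] by (simp add: mult.assoc)
qed

text \<open>\<open>E_ij(m * m)\<close> is the commutator of \<open>E_ik(m)\<close> and
  \<open>E_kj(m)\<close>, and the eigenvalues of its image are roots of unity of order dividing
  \<open>n!\<close>; the last factor makes them 1.\<close>

definition M :: int where "M = m * (m * fact n)"

lemma M_pos: "M > 0"
  using m_pos by (simp add: M_def)

abbreviation E :: "nat \<Rightarrow> nat \<Rightarrow> int mat" where
  "E i j \<equiv> elem_mat n i j M"

lemma E_in: "i < n \<Longrightarrow> j < n \<Longrightarrow> i \<noteq> j \<Longrightarrow> elem_mat n i j (M * k) \<in> L"
  "i < n \<Longrightarrow> j < n \<Longrightarrow> i \<noteq> j \<Longrightarrow> E i j \<in> L"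
  using level[of i j "m * fact n * k"] level[of i j "m * fact n"] by (simp_all add: M_def mult.assoc)

sublocale fd: fin_dim_subspace cscale "unit_vecs n"
  by (rule fin_dim_unit_vecs)

lemma lin_rho: "fd.lin (rho x)"
  unfolding rho_def by (rule act_linear)

lemma rho_span: "rho x ` cfun.span (unit_vecs n) \<subseteq> cfun.span (unit_vecs n)"
  unfolding rho_def by (rule act_span)

lemma rho_diff_in: "rho x f - f \<in> cfun.span (unit_vecs n)"
  unfolding rho_def by (rule act_diff_in)

lemma rho_comm:
  assumes "x \<in> L" "y \<in> L" "x * y = y * x"
  shows "rho x (rho y f) = rho y (rho x f)"
  using rho_mult assms by metis

lemma rho_bracket:
  assumes "i < n" "j < n" "k < n" "i \<noteq> j" "j \<noteq> k" "i \<noteq> k"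
  shows "rho (elem_mat n i j (m * s)) (rho (elem_mat n j k (m * t)) f)
    = rho (elem_mat n i k (m * (s * (m * t)))) (rho (elem_mat n j k (m * t)) (rho (elem_mat n i j (m * s)) f))"
proof -
  have "elem_mat n i j (m * s) * elem_mat n j k (m * t)
      = elem_mat n i k (m * (s * (m * t))) * elem_mat n j k (m * t) * elem_mat n i j (m * s)"
    using elem_bracket[OF assms, of "m * s" "m * t"] by (simp add: mult.assoc)
  moreover have "elem_mat n i j (m * s) \<in> L" "elem_mat n j k (m * t) \<in> L" "elem_mat n i k (m * (s * (m * t))) \<in> L"
    using level assms by auto
  ultimately show ?thesis
    by (metis rho_mult L_mult)
qed

lemma rho_E_unipotent:
  assumes ij: "i < n" "j < n" "i \<noteq> j"
  shows "fd.unipotent (Suc n) (rho (E i j))"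
proof -
  obtain k where k: "k < n" "k \<noteq> i" "k \<noteq> j"
    using exists_third[OF n3, of i j] by blast
  let ?X = "elem_mat n i k (m * 1)" and ?Y = "elem_mat n k j (m * 1)" and ?Z = "elem_mat n i j (m * m)"
  have in_L: "?X \<in> L" "?Y \<in> L" "?Z \<in> L"
    using level[of i k 1] level[of k j 1] level[of i j m] ij k by simp_all
  have pow: "(rho ?Z ^^ fact n) f = rho (E i j) f" for f
    unfolding rho_elem_pow[OF ij] by (simp add: M_def mult.assoc)
  have nil: "((\<lambda>x. (rho ?Z ^^ fact n) x - x) ^^ n) w = 0" if "w \<in> cfun.span (unit_vecs n)" for w
  proof -
    have "((\<lambda>x. (rho ?Z ^^ fact (card (unit_vecs n))) x - x) ^^ card (unit_vecs n)) w = 0"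
    proof (rule fd.heisenberg_centre_unipotent[OF lin_rho lin_rho lin_rho rho_span rho_span rho_span _ _ _ _ _ _ that])
      show "rho ?X (rho ?Y f) = rho ?Z (rho ?Y (rho ?X f))" for f
        using rho_bracket[of i k j, where s = 1 and t = 1] ij k by simp
      show "rho ?Z (rho ?X f) = rho ?X (rho ?Z f)" for f
        by (rule rho_comm) (use in_L ij k in \<open>auto intro!: elem_commute\<close>)
      show "rho ?Z (rho ?Y f) = rho ?Y (rho ?Z f)" for f
        by (rule rho_comm) (use in_L ij k in \<open>auto intro!: elem_commute\<close>)
    qed (use rho_eq_0D in_L in blast)+
    then show ?thesis
      by (simp add: card_unit_vecs)
  qed
  have nilp: "fd.nilp (rho (E i j)) = (\<lambda>x. (rho ?Z ^^ fact n) x - x)"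
    by (simp add: fun_eq_iff fd.nilp_def pow)
  \<comment> \<open>\<open>nil\<close> is available on the span; one application of
    \<open>nilp\<close> maps any function into the span, which accounts for the exponent
    \<open>Suc n\<close>.\<close>
  have "(fd.nilp (rho (E i j)) ^^ n) (fd.nilp (rho (E i j)) f) = 0" for f
    unfolding nilp by (rule nil) (simp only: pow rho_diff_in)
  then have "(fd.nilp (rho (E i j)) ^^ Suc n) f = 0" for f
    by (simp add: funpow_swap1)
  then show ?thesis
    using n3 lin_rho by (simp add: fd.unipotent_def del: funpow.simps)
qed

lemma rho_E_nontrivial:
  assumes ij: "i < n" "j < n" "i \<noteq> j"
  shows "\<exists>f. rho (E i j) f \<noteq> f"
proof (rule ccontr)
  assume "\<not> ?thesis"
  then have id: "rho (E i j) f = f" for f by blast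
  have "\<phi> (E i j) = 1\<^sub>m n"
  proof (rule eq_matI)
    fix a b assume "a < dim_row (1\<^sub>m n :: int mat)" "b < dim_col (1\<^sub>m n :: int mat)"
    then have ab: "a < n" "b < n" by auto
    have "rho (E i j) (unit b) a = of_int (\<phi> (E i j) $$ (a, b))"
    proof -
      have "rho (E i j) (unit b) a = (\<Sum>k<n. of_int (\<phi> (E i j) $$ (a, k)) * of_bool (k = b))"
        using ab \<phi>_carrier[OF E_in(2)[OF ij]] unfolding rho_def act_def
        by (auto simp: unit_def intro!: sum.cong)
      then show ?thesis
        using ab by simp
    qed
    then have "of_int (\<phi> (E i j) $$ (a, b)) = (of_bool (a = b) :: complex)"
      unfolding id by (simp add: unit_def)
    then show "\<phi> (E i j) $$ (a, b) = 1\<^sub>m n $$ (a, b)"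
      using ab by (cases "a = b") simp_all
  qed (use \<phi>_carrier[OF E_in(2)[OF ij]] in auto)
  then have "E i j = 1\<^sub>m n"
    using \<phi>_inj \<phi>_one E_in(2)[OF ij] L_one by (metis inj_onD)
  then have "E i j $$ (i, j) = 1\<^sub>m n $$ (i, j)"
    by simp
  then show False
    using ij M_pos by (simp add: elem_index)
qed

text \<open>The columns of \<open>A\<close> are the basis vectors \<open>u q\<close>; the two
  descriptions of the action on this basis become the two intertwining relations, the dual one with
  the inverse transpose of \<open>E i j\<close>.\<close>

lemma intertwiner_exists:
  "\<exists>A B. A \<in> carrier_mat n n \<and> B \<in> carrier_mat n n \<and> A * B = 1\<^sub>m n \<and> B * A = 1\<^sub>m n \<and>
    ((\<forall>i j. i < n \<and> j < n \<and> i \<noteq> j \<longrightarrow> cmat (\<phi> (E i j)) * A = A * elem_mat n i j (of_int M))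
    \<or> (\<forall>i j. i < n \<and> j < n \<and> i \<noteq> j \<longrightarrow> cmat (\<phi> (E i j)) * A = A * elem_mat n j i (- of_int M)))"
proof -
  have M: "int (nat M) = M"
    using M_pos by simp
  obtain x0 where x0: "rho (E 0 (n - 1)) x0 \<noteq> x0"
    using rho_E_nontrivial[of 0 "n - 1"] n3 by auto
  have "\<exists>u. (\<forall>q<n. u q \<in> cfun.span (unit_vecs n))
    \<and> (\<forall>c. (\<Sum>q<n. cscale (c q) (u q)) = 0 \<longrightarrow> (\<forall>q<n. c q = 0))
    \<and> ((\<forall>i j q. i < n \<and> j < n \<and> i \<noteq> j \<and> q < n \<longrightarrow>
            rho (E i j) (u q) = u q + (if q = j then cscale (of_nat (nat M)) (u i) else 0))
      \<or> (\<forall>i j q. i < n \<and> j < n \<and> i \<noteq> j \<and> q < n \<longrightarrow>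
            rho (E i j) (u q) = u q - (if q = i then cscale (of_nat (nat M)) (u j) else 0)))"
  proof (rule fd.steinberg_unipotent[where d = "Suc n" and Y = "\<lambda>i j. rho (E i j)", OF n3 card_unit_vecs])
    show "nat M > 0"
      using M_pos by simp
    show "fd.unipotent (Suc n) (rho (E i j))" if "i < n" "j < n" "i \<noteq> j" for i j
      using that by (rule rho_E_unipotent)
    show "rho (E i j) x - x \<in> cfun.span (unit_vecs n)" for i j x
      by (rule rho_diff_in)
    show "rho (E 0 (n - 1)) x0 \<noteq> x0"
      by (rule x0)
  next
    fix i j k x assume a: "i < n" "j < n" "k < n" "i \<noteq> j" "j \<noteq> k" "i \<noteq> k"
    have "(rho (E i k) ^^ nat M) f = rho (elem_mat n i k (M * M)) f" for f
      using rho_elem_pow[OF a(1,3,6), where s = "m * fact n" and k = "nat M"] M by (simp add: M_def mult.assoc)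
    then show "rho (E i j) (rho (E j k) x) = (rho (E i k) ^^ nat M) (rho (E j k) (rho (E i j) x))"
      using rho_bracket[OF a, where s = "m * fact n" and t = "m * fact n"] by (simp add: M_def mult.assoc)
  next
    fix i j k l x
    assume a: "i < n" "j < n" "k < n" "l < n" "i \<noteq> j" "k \<noteq> l" "j \<noteq> k" "i \<noteq> l"
    then show "rho (E i j) (rho (E k l) x) = rho (E k l) (rho (E i j) x)"
      by (intro rho_comm E_in elem_commute) auto
  qed
  then obtain u where u: "\<And>q. q < n \<Longrightarrow> u q \<in> cfun.span (unit_vecs n)"
    and indep: "\<And>c. (\<Sum>q<n. cscale (c q) (u q)) = 0 \<Longrightarrow> (\<forall>q<n. c q = 0)"
    and cases: "(\<forall>i j q. i < n \<and> j < n \<and> i \<noteq> j \<and> q < n \<longrightarrow>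
            rho (E i j) (u q) = u q + (if q = j then cscale (of_nat (nat M)) (u i) else 0))
      \<or> (\<forall>i j q. i < n \<and> j < n \<and> i \<noteq> j \<and> q < n \<longrightarrow>
            rho (E i j) (u q) = u q - (if q = i then cscale (of_nat (nat M)) (u j) else 0))"
    by blast
  define A where "A = mat n n (\<lambda>(i, q). u q i)"
  have A: "A \<in> carrier_mat n n"
    by (simp add: A_def)
  have "det A \<noteq> 0"
  proof
    assume "det A = 0"
    then obtain v where v: "v \<in> carrier_vec n" "v \<noteq> 0\<^sub>v n" "A *\<^sub>v v = 0\<^sub>v n"
      using det_0_iff_vec_prod_zero[OF A] by blast
    have "(\<Sum>q<n. cscale (v $ q) (u q)) = 0"
    proof
      fix i
      show "(\<Sum>q<n. cscale (v $ q) (u q)) i = 0 i"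
      proof (cases "i < n")
        case True
        have "0 = (A *\<^sub>v v) $ i"
          using True by (simp add: v)
        also have "\<dots> = (\<Sum>q<n. u q i * v $ q)"
          using True v(1) A
          by (auto simp: scalar_prod_def A_def lessThan_atLeast0 intro!: sum.cong)
        finally show ?thesis
          by (simp add: sum_fun_apply cscale_def mult.commute)
      next
        case False
        then show ?thesis
          using u by (auto simp: sum_fun_apply cscale_def span_unit_vecs)
      qed
    qed
    from indep[OF this] have "v = 0\<^sub>v n"
      using v(1) by (intro eq_vecI) auto
    with v(2) show False ..
  qed
  then obtain B where B: "B \<in> carrier_mat n n" "A * B = 1\<^sub>m n" "B * A = 1\<^sub>m n"
    using inverse_mat_exists[OF A] by blast
  have left: "(cmat (\<phi> (E i j)) * A) $$ (a, q) = rho (E i j) (u q) a"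
    if "i < n" "j < n" "i \<noteq> j" "a < n" "q < n" for i j a q
  proof -
    have c: "cmat (\<phi> (E i j)) \<in> carrier_mat n n"
      using \<phi>_carrier[OF E_in(2)[OF that(1-3)]] by simp
    show ?thesis
      unfolding mult_index[OF c A that(4,5)] using that by (simp add: rho_def act_def A_def)
  qed
  have right: "(A * elem_mat n i j t) $$ (a, q) = u q a + (if q = j then t * u i a else 0)"
    if "i < n" "j < n" "a < n" "q < n" for i j t a q
  proof -
    have "(A * elem_mat n i j t) $$ (a, q) = (\<Sum>k<n. u k a * of_bool (k = q) + (of_bool (q = j) * t * u k a) * of_bool (k = i))"
      unfolding mult_index[OF A elem_carrier that(3,4)]
      by (intro sum.cong refl) (use that in \<open>auto simp: A_def elem_index algebra_simps\<close>)
    also have "\<dots> = u q a + of_bool (q = j) * t * u i a"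
      using that by (simp only: sum.distrib sum_of_bool_mult if_True)
    finally show ?thesis by simp
  qed
  have nM: "of_nat (nat M) = (of_int M :: complex)"
    using M by (metis of_int_of_nat_eq)
  have dims: "cmat (\<phi> (E i j)) * A \<in> carrier_mat n n" "A * elem_mat n k l t \<in> carrier_mat n n"
    if "i < n" "j < n" "i \<noteq> j" for i j k l t
    using \<phi>_carrier[OF E_in(2)[OF that]] A by (auto intro!: mult_carrier_mat[of _ n n])
  from cases have "(\<forall>i j. i < n \<and> j < n \<and> i \<noteq> j \<longrightarrow> cmat (\<phi> (E i j)) * A = A * elem_mat n i j (of_int M))
    \<or> (\<forall>i j. i < n \<and> j < n \<and> i \<noteq> j \<longrightarrow> cmat (\<phi> (E i j)) * A = A * elem_mat n j i (- of_int M))"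
  proof (elim disjE)
    assume *: "\<forall>i j q. i < n \<and> j < n \<and> i \<noteq> j \<and> q < n \<longrightarrow>
      rho (E i j) (u q) = u q + (if q = j then cscale (of_nat (nat M)) (u i) else 0)"
    have "cmat (\<phi> (E i j)) * A = A * elem_mat n i j (of_int M)" if ij: "i < n" "j < n" "i \<noteq> j" for i j
    proof (rule eq_matI)
      fix a q assume "a < dim_row (A * elem_mat n i j (of_int M))" "q < dim_col (A * elem_mat n i j (of_int M))"
      then have aq: "a < n" "q < n"
        using carrier_matD[OF dims(2)[OF ij]] by simp_all
      show "(cmat (\<phi> (E i j)) * A) $$ (a, q) = (A * elem_mat n i j (of_int M)) $$ (a, q)"
        unfolding left[OF ij aq] right[OF ij(1,2) aq] using * ij aq by (simp add: cscale_def nM)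
    qed (use carrier_matD[OF dims(1)[OF ij]] carrier_matD[OF dims(2)[OF ij]] in simp_all)
    then show ?thesis by blast
  next
    assume *: "\<forall>i j q. i < n \<and> j < n \<and> i \<noteq> j \<and> q < n \<longrightarrow>
      rho (E i j) (u q) = u q - (if q = i then cscale (of_nat (nat M)) (u j) else 0)"
    have "cmat (\<phi> (E i j)) * A = A * elem_mat n j i (- of_int M)" if ij: "i < n" "j < n" "i \<noteq> j" for i j
    proof (rule eq_matI)
      fix a q assume "a < dim_row (A * elem_mat n j i (- of_int M))" "q < dim_col (A * elem_mat n j i (- of_int M))"
      then have aq: "a < n" "q < n"
        using carrier_matD[OF dims(2)[OF ij]] by simp_all
      show "(cmat (\<phi> (E i j)) * A) $$ (a, q) = (A * elem_mat n j i (- of_int M)) $$ (a, q)"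
        unfolding left[OF ij aq] right[OF ij(2,1) aq] using * ij aq by (simp add: cscale_def nM)
    qed (use carrier_matD[OF dims(1)[OF ij]] carrier_matD[OF dims(2)[OF ij]] in simp_all)
    then show ?thesis by blast
  qed
  with A B show ?thesis by blast
qed

end

section \<open>Invariants of twisted conjugacy\<close>

text \<open>The inverse transpose: for determinant one the adjugate is the inverse, and it stays
  integral.\<close>

definition contragredient :: "int mat \<Rightarrow> complex mat" where
  "contragredient x = transpose_mat (cmat (adj_mat x))"

lemma adj_mat_SL:
  fixes x :: "int mat"
  assumes "x \<in> carrier_mat n n" "det x = 1"
  shows "adj_mat x \<in> carrier_mat n n" "x * adj_mat x = 1\<^sub>m n" "adj_mat x * x = 1\<^sub>m n"
  using adj_mat[OF assms(1)] assms(2) by auto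

lemma adj_mat_mult:
  fixes x y :: "int mat"
  assumes x: "x \<in> carrier_mat n n" "det x = 1" and y: "y \<in> carrier_mat n n" "det y = 1"
  shows "adj_mat (x * y) = adj_mat y * adj_mat x"
proof (rule adj_mat_eqI)
  note ax = adj_mat_SL[OF x] and ay = adj_mat_SL[OF y]
  have "x * y * (adj_mat y * adj_mat x) = x * (y * (adj_mat y * adj_mat x))"
    by (rule assoc_mult_mat[OF x(1) y(1) mult_carrier_mat[OF ay(1) ax(1)]])
  also have "y * (adj_mat y * adj_mat x) = y * adj_mat y * adj_mat x"
    by (rule assoc_mult_mat[OF y(1) ay(1) ax(1), symmetric])
  also have "x * \<dots> = 1\<^sub>m n"
    using ax ay by simp
  finally show "x * y * (adj_mat y * adj_mat x) = 1\<^sub>m n" .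
  show "det (x * y) = 1"
    using x y by (simp add: det_mult)
qed (use x(1) y(1) adj_mat_SL[OF x] adj_mat_SL[OF y] in \<open>auto intro: mult_carrier_mat\<close>)

lemma transpose_elem: "transpose_mat (elem_mat n i j t) = elem_mat n j i t"
  by (rule eq_matI) (auto simp: elem_mat_def transvec_def one_plus_def unit_def)

section \<open>Traces of products with elementary matrices\<close>

definition tr :: "'a::comm_ring_1 mat \<Rightarrow> 'a" where
  "tr A = (\<Sum>i<dim_row A. A $$ (i, i))"

lemma tr_mult:
  assumes "A \<in> carrier_mat n n" "B \<in> carrier_mat n n"
  shows "tr (A * B) = (\<Sum>i<n. \<Sum>k<n. A $$ (i, k) * B $$ (k, i))"
proof -
  have "dim_row (A * B) = n"
    using assms by simp
  then show ?thesis
    unfolding tr_def by (simp only:) (intro sum.cong refl, simp only: lessThan_iff mult_index[OF assms])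
qed

lemma tr_commute:
  assumes "A \<in> carrier_mat n n" "B \<in> carrier_mat n n"
  shows "tr (A * B) = tr (B * A)"
  unfolding tr_mult[OF assms] tr_mult[OF assms(2,1)]
  by (subst sum.swap) (simp add: mult.commute)

lemma tr_smult: "tr (c \<cdot>\<^sub>m A) = c * tr A" if "A \<in> carrier_mat n n"
  using that by (auto simp: tr_def sum_distrib_left intro!: sum.cong)

lemma elem_mult_index:
  assumes "Y \<in> carrier_mat n n" "i < n" "j < n" "a < n" "b < n"
  shows "(elem_mat n i j t * Y) $$ (a, b) = Y $$ (a, b) + of_bool (a = i) * t * Y $$ (j, b)"
proof -
  have "(elem_mat n i j t * Y) $$ (a, b)
      = (\<Sum>k<n. of_bool (a = k) * Y $$ (k, b) + of_bool (k = j) * (of_bool (a = i) * t * Y $$ (k, b)))"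
    unfolding mult_index[OF elem_carrier assms(1,4,5)]
    by (intro sum.cong refl) (use assms in \<open>auto simp: elem_index algebra_simps\<close>)
  then show ?thesis
    using assms by (simp only: sum.distrib sum_of_bool_mult if_True)
qed

lemma mult_elem_index:
  assumes "Y \<in> carrier_mat n n" "i < n" "j < n" "a < n" "b < n"
  shows "(Y * elem_mat n i j t) $$ (a, b) = Y $$ (a, b) + of_bool (b = j) * t * Y $$ (a, i)"
proof -
  have "(Y * elem_mat n i j t) $$ (a, b)
      = (\<Sum>k<n. Y $$ (a, k) * of_bool (k = b) + (of_bool (b = j) * t * Y $$ (a, k)) * of_bool (k = i))"
    unfolding mult_index[OF assms(1) elem_carrier assms(4,5)]
    by (intro sum.cong refl) (use assms in \<open>auto simp: elem_index algebra_simps\<close>)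
  then show ?thesis
    using assms by (simp only: sum.distrib sum_of_bool_mult if_True)
qed

lemma tr_elem_mult:
  assumes "Y \<in> carrier_mat n n" "i < n" "j < n"
  shows "tr (elem_mat n i j t * Y) = tr Y + t * Y $$ (j, i)"
proof -
  have "tr (elem_mat n i j t * Y) = (\<Sum>a<n. Y $$ (a, a) + of_bool (a = i) * (t * Y $$ (j, a)))"
  proof -
    have "dim_row (elem_mat n i j t * Y) = n"
      by (simp add: elem_mat_def transvec_def one_plus_def)
    then show ?thesis
      unfolding tr_def
      by (simp only:) (intro sum.cong refl, simp only: lessThan_iff elem_mult_index[OF assms] mult_ac)
  qed
  then show ?thesis
    using assms by (simp add: sum.distrib tr_def)
qed

text \<open>For \<open>R = Z^-1\<close> this is the trace of the cosquare of
  \<open>E_ij(s) Z\<close> as a polynomial in \<open>s\<close>. Only the quadratic coefficient will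
  matter, so the linear one stays existential.\<close>

lemma tr_elem_conj_transpose:
  assumes Z: "Z \<in> carrier_mat n n" "R \<in> carrier_mat n n" and ij: "i < n" "j < n"
  shows "\<exists>\<beta>. \<forall>s. tr (R * elem_mat n i j (- s) * (transpose_mat Z * elem_mat n j i s))
    = tr (R * transpose_mat Z) + s * \<beta> - s\<^sup>2 * (R $$ (i, i) * Z $$ (j, j))"
proof (intro exI allI)
  fix s
  let ?Q = "transpose_mat Z"
  have Q: "?Q \<in> carrier_mat n n"
    using Z by simp
  have RE: "R * elem_mat n i j (- s) \<in> carrier_mat n n" and QE: "?Q * elem_mat n j i s \<in> carrier_mat n n"
    using Z Q by (auto intro: mult_carrier_mat)
  have summand: "(R * elem_mat n i j (- s)) $$ (a, k) * (?Q * elem_mat n j i s) $$ (k, a)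
      = R $$ (a, k) * ?Q $$ (k, a) + s * (of_bool (a = i) * (R $$ (a, k) * ?Q $$ (k, j)))
        - s * (of_bool (k = j) * (R $$ (a, i) * ?Q $$ (k, a)))
        - s\<^sup>2 * (of_bool (a = i) * (of_bool (k = j) * (R $$ (a, i) * ?Q $$ (k, j))))"
    if "a < n" "k < n" for a k
    unfolding mult_elem_index[OF Z(2) ij that] mult_elem_index[OF Q ij(2,1) that(2,1)]
    by (simp add: algebra_simps power2_eq_square)
  have "tr (R * elem_mat n i j (- s) * (?Q * elem_mat n j i s)) = (\<Sum>a<n. \<Sum>k<n.
      R $$ (a, k) * ?Q $$ (k, a) + s * (of_bool (a = i) * (R $$ (a, k) * ?Q $$ (k, j)))
        - s * (of_bool (k = j) * (R $$ (a, i) * ?Q $$ (k, a)))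
        - s\<^sup>2 * (of_bool (a = i) * (of_bool (k = j) * (R $$ (a, i) * ?Q $$ (k, j)))))"
    unfolding tr_mult[OF RE QE] by (intro sum.cong refl) (simp add: summand)
  also have "\<dots> = tr (R * ?Q) + s * (\<Sum>k<n. R $$ (i, k) * ?Q $$ (k, j)) - s * (\<Sum>a<n. R $$ (a, i) * ?Q $$ (j, a))
      - s\<^sup>2 * (R $$ (i, i) * ?Q $$ (j, j))"
    using ij unfolding tr_mult[OF Z(2) Q]
    by (simp add: sum.distrib sum_subtractf flip: sum_distrib_left)
  finally show "tr (R * elem_mat n i j (- s) * (?Q * elem_mat n j i s))
    = tr (R * ?Q) + s * ((\<Sum>k<n. R $$ (i, k) * ?Q $$ (k, j)) - (\<Sum>a<n. R $$ (a, i) * ?Q $$ (j, a)))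
      - s\<^sup>2 * (R $$ (i, i) * Z $$ (j, j))"
    using Z ij by (simp add: algebra_simps)
qed

text \<open>Otherwise, by pigeonhole, one value would be taken at infinitely many naturals, and
  \<open>p\<close> minus that value would have infinitely many roots.\<close>

lemma infinite_polynomial_values:
  fixes p :: "complex poly"
  assumes "degree p > 0"
  shows "infinite (range (\<lambda>k. poly p (of_nat k)))"
proof
  assume fin: "finite (range (\<lambda>k::nat. poly p (of_nat k)))"
  then obtain k0 where k0: "infinite {k. poly p (of_nat k) = poly p (of_nat k0)}"
    using pigeonhole_infinite[of "UNIV :: nat set" "\<lambda>k. poly p (of_nat k)"] by auto
  define q where "q = p - [:poly p (of_nat k0):]"
  have "q \<noteq> 0"
    using assms unfolding q_def by (metis degree_pCons_0 eq_iff_diff_eq_0 less_irrefl)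
  then have "finite {z. poly q z = 0}"
    by (rule poly_roots_finite)
  moreover have "of_nat ` {k. poly p (of_nat k) = poly p (of_nat k0)} \<subseteq> {z. poly q z = 0}"
    by (auto simp: q_def)
  ultimately have "finite (of_nat ` {k. poly p (of_nat k) = poly p (of_nat k0)} :: complex set)"
    by (rule rev_finite_subset)
  then have "finite {k. poly p (of_nat k) = poly p (of_nat k0)}"
    by (rule finite_imageD) (simp add: inj_on_def)
  with k0 show False ..
qed

context injective_endo
begin

section \<open>Comparing an endomorphism with the standard and the dual representation\<close>

lemma cassoc: "X \<in> carrier_mat n n \<Longrightarrow> Y \<in> carrier_mat n n \<Longrightarrow> Z \<in> carrier_mat n n \<Longrightarrow>
    X * Y * Z = X * (Y * Z)" for X Y Z :: "complex mat"
  by (rule assoc_mult_mat)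

lemma cclosed: "X \<in> carrier_mat n n \<Longrightarrow> Y \<in> carrier_mat n n \<Longrightarrow> X * Y \<in> carrier_mat n n"
  for X Y :: "complex mat"
  by (rule mult_carrier_mat)

lemma ccancel:
  fixes X Y Z :: "complex mat"
  assumes "X \<in> carrier_mat n n" "Y \<in> carrier_mat n n" "Z \<in> carrier_mat n n" "X * Y = 1\<^sub>m n"
  shows "X * (Y * Z) = Z"
  using assms cassoc[of X Y Z] by simp

lemma cmat_phi_carrier: "x \<in> L \<Longrightarrow> cmat (\<phi> x) \<in> carrier_mat n n"
  using \<phi>_carrier by simp

lemma cmat_phi_mult: "x \<in> L \<Longrightarrow> y \<in> L \<Longrightarrow> cmat (\<phi> (x * y)) = cmat (\<phi> x) * cmat (\<phi> y)"
  by (simp add: \<phi>_mult cmat_mult[of _ n] \<phi>_carrier)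

lemma cmat_phi_inverse:
  "x \<in> L \<Longrightarrow> y \<in> L \<Longrightarrow> x * y = 1\<^sub>m n \<Longrightarrow> cmat (\<phi> x) * cmat (\<phi> y) = 1\<^sub>m n"
  using cmat_phi_mult[of x y] by (simp add: \<phi>_one cmat_one)

text \<open>\<theta> is kept abstract to serve the inclusion and the inverse transpose alike;
  \<open>scal\<close> is Schur's lemma for it, in a form that asks for just one nonzero multiple for
  each pair of indices.\<close>

lemma rigidity:
  assumes A: "A \<in> carrier_mat n n" "B \<in> carrier_mat n n" "A * B = 1\<^sub>m n" "B * A = 1\<^sub>m n"
    and th_carrier: "\<And>x. x \<in> L \<Longrightarrow> \<theta> x \<in> carrier_mat n n"
    and th_mult: "\<And>x y. x \<in> L \<Longrightarrow> y \<in> L \<Longrightarrow> \<theta> (x * y) = \<theta> x * \<theta> y"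
    and th_one: "\<theta> (1\<^sub>m n) = 1\<^sub>m n"
    and th_det: "\<And>x. x \<in> L \<Longrightarrow> det (\<theta> x) = 1"
    and inter: "\<And>i j. i < n \<Longrightarrow> j < n \<Longrightarrow> i \<noteq> j \<Longrightarrow> cmat (\<phi> (E i j)) * A = A * \<theta> (E i j)"
    and scal: "\<And>C. C \<in> carrier_mat n n \<Longrightarrow> (\<And>i j. i < n \<Longrightarrow> j < n \<Longrightarrow> i \<noteq> j \<Longrightarrow>
      \<exists>k. k \<noteq> 0 \<and> C * \<theta> (elem_mat n i j (M * k)) = \<theta> (elem_mat n i j (M * k)) * C) \<Longrightarrow> \<exists>c. C = c \<cdot>\<^sub>m 1\<^sub>m n"
    and g: "g \<in> L"
  shows "\<exists>c. c ^ n = 1 \<and> cmat (\<phi> g) * A = c \<cdot>\<^sub>m (A * \<theta> g)"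
proof -
  define Good where "Good = {x \<in> L. cmat (\<phi> x) * A = A * \<theta> x}"
  have Good_mult: "x * y \<in> Good" if "x \<in> Good" "y \<in> Good" for x y
  proof -
    have xy: "x \<in> L" "y \<in> L" "cmat (\<phi> x) * A = A * \<theta> x" "cmat (\<phi> y) * A = A * \<theta> y"
      using that by (auto simp: Good_def)
    have "cmat (\<phi> (x * y)) * A = cmat (\<phi> x) * (cmat (\<phi> y) * A)"
      using xy A by (simp add: cmat_phi_mult cassoc \<phi>_carrier)
    also have "\<dots> = cmat (\<phi> x) * A * \<theta> y"
      unfolding xy(4) by (rule cassoc[OF cmat_phi_carrier[OF xy(1)] A(1) th_carrier[OF xy(2)], symmetric])
    also have "\<dots> = A * (\<theta> x * \<theta> y)"
      unfolding xy(3) by (rule cassoc[OF A(1) th_carrier[OF xy(1)] th_carrier[OF xy(2)]])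
    also have "\<dots> = A * \<theta> (x * y)"
      using xy by (simp add: th_mult)
    finally show ?thesis
      using xy L_mult by (simp add: Good_def)
  qed
  have Good_inverse: "y \<in> Good" if "x \<in> Good" "y \<in> L" "x * y = 1\<^sub>m n" "y * x = 1\<^sub>m n" for x y
  proof -
    have x: "x \<in> L" "cmat (\<phi> x) * A = A * \<theta> x"
      using that by (auto simp: Good_def)
    have txy: "\<theta> x * \<theta> y = 1\<^sub>m n"
      using th_mult[OF x(1) that(2)] that th_one by simp
    have "cmat (\<phi> y) * A = cmat (\<phi> y) * (A * (\<theta> x * \<theta> y))"
      using A by (simp add: txy)
    also have "A * (\<theta> x * \<theta> y) = cmat (\<phi> x) * (A * \<theta> y)"
      using cassoc[OF A(1) th_carrier[OF x(1)] th_carrier[OF that(2)]]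
        cassoc[OF cmat_phi_carrier[OF x(1)] A(1) th_carrier[OF that(2)]] x(2) by simp
    also have "cmat (\<phi> y) * \<dots> = A * \<theta> y"
      by (rule ccancel[OF cmat_phi_carrier[OF that(2)] cmat_phi_carrier[OF x(1)]
            cclosed[OF A(1) th_carrier[OF that(2)]] cmat_phi_inverse[OF that(2) x(1) that(4)]])
    finally show ?thesis
      using that by (simp add: Good_def)
  qed
  have nat: "elem_mat n i j (M * int k) \<in> Good" if ij: "i < n" "j < n" "i \<noteq> j" for i j k
  proof (induction k)
    case 0
    then show ?case
      using A L_one by (simp add: elem_0 Good_def \<phi>_one th_one cmat_one)
  next
    case (Suc k)
    have "E i j \<in> Good"
      using inter[OF ij] E_in(2)[OF ij] by (simp add: Good_def)
    with Suc have "elem_mat n i j (M * int k) * E i j \<in> Good"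
      by (rule Good_mult)
    then show ?case
      using ij by (simp add: elem_add algebra_simps)
  qed
  interpret cl: elem_closed n M Good
  proof
    show "elem_mat n i j (M * k) \<in> Good" if ij: "i < n" "j < n" "i \<noteq> j" for i j k
    proof (cases "k \<ge> 0")
      case True
      then show ?thesis using nat[OF ij, of "nat k"] by simp
    next
      case False
      then have "elem_mat n i j (- (M * k)) \<in> Good"
        using nat[OF ij, of "nat (- k)"] by simp
      then show ?thesis
        by (rule Good_inverse[OF _ E_in(1)[OF ij] elem_inverse(2)[OF ij] elem_inverse(1)[OF ij]])
    qed
  qed (use n3 Good_mult in auto)
  obtain gi where gi: "gi \<in> L" "g * gi = 1\<^sub>m n" "gi * g = 1\<^sub>m n"
    using L_inverse[OF g] by blast
  note gc = L_carrier[OF g] and gic = L_carrier[OF gi(1)]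
  let ?P = "cmat (\<phi> g)" and ?Q = "cmat (\<phi> gi)"
  have P: "?P \<in> carrier_mat n n" "?Q \<in> carrier_mat n n" "?Q * ?P = 1\<^sub>m n"
    using cmat_phi_carrier g gi cmat_phi_inverse by auto
  have tg: "\<theta> g \<in> carrier_mat n n" "\<theta> gi \<in> carrier_mat n n"
    "\<theta> g * \<theta> gi = 1\<^sub>m n" "\<theta> gi * \<theta> g = 1\<^sub>m n"
    using th_carrier g gi th_mult[OF g gi(1)] th_mult[OF gi(1) g] th_one by auto
  \<comment> \<open>\<open>F\<close> is \<open>\<theta>(g)^-1 A^-1 \<phi>(g) A\<close>; the
    intertwining relation up to \<open>c\<close> says that \<open>F\<close> is scalar.\<close>
  define F where "F = \<theta> gi * (B * (?P * A))"
  have F: "F \<in> carrier_mat n n"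
    using A P tg by (simp add: F_def cclosed)
  have "\<exists>c. F = c \<cdot>\<^sub>m 1\<^sub>m n"
  proof (rule scal[OF F])
    fix i j assume ij: "i < n" "j < n" "i \<noteq> j"
    \<comment> \<open>\<open>g E_ij(t) g^-1 = 1 + t u v^T\<close> with \<open>u\<close> the i-th
      column of \<open>g\<close> and \<open>v\<close> the j-th row of its inverse. The parameter of
      \<open>T\<close> is chosen so that both \<open>T\<close> and its conjugate by \<open>g\<close>
      lie in \<open>Good\<close>.\<close>
    define u where "u = (\<lambda>a. g $$ (a, i))"
    define v where "v = (\<lambda>b. gi $$ (j, b))"
    have "\<exists>p<n. u p \<noteq> 0"
    proof (rule ccontr)
      assume "\<not> ?thesis"
      then have "(gi * g) $$ (i, i) = 0"
        unfolding mult_index[OF gic gc ij(1) ij(1)] by (simp add: u_def)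
      then show False
        using ij by (simp add: gi)
    qed
    then obtain p where p: "p < n" "u p \<noteq> 0" by blast
    have "dot n v u = (gi * g) $$ (j, i)"
      unfolding mult_index[OF gic gc ij(2,1)] by (simp add: dot_def u_def v_def)
    then have vu: "dot n v u = 0"
      using ij by (simp add: gi)
    define T where "T = elem_mat n i j (M * (M * u p))"
    have T: "T \<in> Good" "T \<in> L"
      using cl.G_elem[OF ij] by (auto simp: T_def Good_def)
    have "g * T * gi = transvec n (\<lambda>m. M * M * u p * u m) v"
      unfolding T_def elem_mat_def transvec_conj[OF gc gic gi(2)]
    proof (rule transvec_cong)
      fix a
      have "(\<Sum>k<n. g $$ (a, k) * (M * (M * u p) * unit i k)) = (\<Sum>k<n. (M * M * u p * g $$ (a, k)) * of_bool (k = i))"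
        by (intro sum.cong refl) (simp add: unit_def)
      then show "(\<Sum>k<n. g $$ (a, k) * (M * (M * u p) * unit i k)) = M * M * u p * u a"
        using ij by (simp add: u_def)
      show "(\<Sum>k<n. unit j k * gi $$ (k, a)) = v a"
        using ij by (simp add: unit_def v_def)
    qed
    then have gTg: "g * T * gi \<in> Good"
      using cl.transvec_multiple_in[OF p(1) vu] by simp
    let ?R = "cmat (\<phi> T)"
    have R: "?R \<in> carrier_mat n n" "\<theta> T \<in> carrier_mat n n" "?R * A = A * \<theta> T"
      using T cmat_phi_carrier th_carrier by (auto simp: Good_def)
    have eq: "?P * (?R * (?Q * A)) = A * (\<theta> g * (\<theta> T * \<theta> gi))"
    proof -
      have "cmat (\<phi> (g * T * gi)) * A = A * \<theta> (g * T * gi)"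
        using gTg by (simp add: Good_def)
      then show ?thesis
        using g gi(1) T(2) A P R tg
        by (simp add: cmat_phi_mult th_mult L_mult cassoc cclosed)
    qed
    let ?X = "B * (?P * A)"
    have X: "?X \<in> carrier_mat n n"
      using A P by (simp add: cclosed)
    have "A * (\<theta> g * (\<theta> T * F)) = (A * (\<theta> g * (\<theta> T * \<theta> gi))) * ?X"
      using A P R tg X by (simp add: F_def cassoc cclosed)
    also have "\<dots> = ?P * (?R * (?Q * (A * ?X)))"
      unfolding eq[symmetric] using A P R X by (simp add: cassoc cclosed)
    also have "\<dots> = ?P * (?R * A)"
      using A P R by (simp add: ccancel cclosed)
    also have "\<dots> = ?P * (A * \<theta> T)"
      by (simp add: R)
    finally have step: "A * (\<theta> g * (\<theta> T * F)) = ?P * (A * \<theta> T)" .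
    have "F * \<theta> T = \<theta> gi * (B * (?P * (A * \<theta> T)))"
      using A P R tg by (simp add: F_def cassoc cclosed)
    also have "\<dots> = \<theta> T * F"
      unfolding step[symmetric] using A R tg F by (simp add: ccancel cclosed)
    finally show "\<exists>k. k \<noteq> 0 \<and> F * \<theta> (elem_mat n i j (M * k)) = \<theta> (elem_mat n i j (M * k)) * F"
      using p M_pos by (intro exI[of _ "M * u p"]) (simp add: T_def)
  qed
  then obtain c where c: "F = c \<cdot>\<^sub>m 1\<^sub>m n" by blast
  have "?P * A = A * (\<theta> g * F)"
    using A P tg by (simp add: F_def ccancel cclosed)
  also have "\<dots> = c \<cdot>\<^sub>m (A * \<theta> g)"
    using A tg unfolding c by (simp add: mult_smult_distrib[of _ n n _ n])
  finally have PA: "?P * A = c \<cdot>\<^sub>m (A * \<theta> g)" .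
  \<comment> \<open>Determinants turn \<open>\<phi>(g) A = c A \<theta>(g)\<close> into
    \<open>c^n = 1\<close>.\<close>
  have dA: "det A \<noteq> 0"
    using det_mult[OF A(1,2)] A(3) by auto
  have "det ?P = 1"
    using L_det[OF \<phi>_in[OF g]] by simp
  then have "det A = c ^ n * det A"
    using arg_cong[OF PA, of det] det_mult[OF P(1) A(1)] det_mult[OF A(1) tg(1)] th_det[OF g] A(1)
      carrier_matD[OF tg(1)] by simp
  then have "c ^ n = 1"
    using dA by simp
  with PA show ?thesis by blast
qed

lemma tr_conj:
  assumes "X \<in> carrier_mat n n" "Y \<in> carrier_mat n n" "Z \<in> carrier_mat n n" "Y * X = 1\<^sub>m n"
  shows "tr (X * (Z * Y)) = tr (Z::complex mat)"
proof -
  have "tr (X * (Z * Y)) = tr (Z * Y * X)"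
    by (rule tr_commute[OF assms(1) cclosed[OF assms(3,2)]])
  also have "Z * Y * X = Z"
    using assms by (simp add: cassoc)
  finally show ?thesis .
qed

lemma invertible_entry:
  assumes "A \<in> carrier_mat n n" "B \<in> carrier_mat n n" "A * B = 1\<^sub>m n" "i < n"
  shows "\<exists>k<n. A $$ (i, k) * B $$ (k, i) \<noteq> (0::complex)"
proof (rule ccontr)
  assume "\<not> ?thesis"
  then have "(A * B) $$ (i, i) = 0"
    unfolding mult_index[OF assms(1,2,4,4)] by (intro sum.neutral) auto
  then show False
    using assms by simp
qed

text \<open>As \<open>\<phi>(h) A = c A h\<close>, the matrix \<open>x A\<close> changes to
  \<open>c g (x A) g^-1\<close>, and the n-th power of the trace removes \<open>c\<close>. For
  infinitely many values, \<open>tr (E_ij(s) Z) = tr Z + s Z_ji\<close> shows that one nonzero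
  off-diagonal entry of some \<open>Z\<close> suffices.\<close>

lemma standard_case:
  assumes A: "A \<in> carrier_mat n n" "B \<in> carrier_mat n n" "A * B = 1\<^sub>m n" "B * A = 1\<^sub>m n"
    and inter: "\<And>i j. i < n \<Longrightarrow> j < n \<Longrightarrow> i \<noteq> j \<Longrightarrow> cmat (\<phi> (E i j)) * A = A * elem_mat n i j (of_int M)"
  shows "\<exists>f :: int mat \<Rightarrow> complex. (\<forall>g\<in>L. \<forall>h\<in>L. \<forall>x\<in>L. g * h = 1\<^sub>m n \<longrightarrow> f (g * x * \<phi> h) = f x) \<and> infinite (f ` L)"
proof -
  define f where "f = (\<lambda>x. tr (cmat x * A) ^ n)"
  have "f (g * x * \<phi> h) = f x" if g: "g \<in> L" and h: "h \<in> L" and x: "x \<in> L" and gh: "g * h = 1\<^sub>m n" for g h x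
  proof -
    have "\<exists>c. c ^ n = 1 \<and> cmat (\<phi> h) * A = c \<cdot>\<^sub>m (A * cmat h)"
    proof (rule rigidity[OF A _ _ _ _ _ _ h])
      fix C :: "complex mat"
      assume C: "C \<in> carrier_mat n n" "\<And>i j. i < n \<Longrightarrow> j < n \<Longrightarrow> i \<noteq> j \<Longrightarrow>
        \<exists>k. k \<noteq> 0 \<and> C * cmat (elem_mat n i j (M * k)) = cmat (elem_mat n i j (M * k)) * C"
      show "\<exists>c. C = c \<cdot>\<^sub>m 1\<^sub>m n"
      proof (rule commutes_elem_imp_scalar[OF C(1)])
        fix i j assume "i < n" "j < n" "i \<noteq> j"
        then obtain k where "k \<noteq> 0" "C * elem_mat n i j (of_int (M * k)) = elem_mat n i j (of_int (M * k)) * C"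
          using C(2) unfolding cmat_elem by blast
        then show "\<exists>t. t \<noteq> 0 \<and> C * elem_mat n i j t = elem_mat n i j t * C"
          using M_pos by (intro exI[of _ "of_int (M * k)"]) simp
      qed (use n3 in simp)
    qed (use L_carrier L_det inter in \<open>auto simp: cmat_mult[of _ n] cmat_one cmat_elem\<close>)
    then obtain c where c: "c ^ n = 1" "cmat (\<phi> h) * A = c \<cdot>\<^sub>m (A * cmat h)"
      by blast
    have car: "cmat g \<in> carrier_mat n n" "cmat h \<in> carrier_mat n n" "cmat x \<in> carrier_mat n n"
      "cmat (\<phi> h) \<in> carrier_mat n n"
      using L_carrier g h x \<phi>_carrier by auto
    have hg: "cmat h * cmat g = 1\<^sub>m n"
    proof -
      obtain y where "y \<in> L" "y * g = 1\<^sub>m n" "g * y = 1\<^sub>m n"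
        using L_inverse[OF g] by blast
      moreover have "y = h"
        using L_inverseI L_carrier calculation h gh g assoc[of y g h]
        by (metis left_mult_one_mat right_mult_one_mat)
      ultimately show ?thesis
        using L_carrier g h by (simp add: cmat_mult[of _ n, symmetric] cmat_one)
    qed
    have "cmat (g * x * \<phi> h) * A = cmat g * (cmat x * (cmat (\<phi> h) * A))"
      using L_carrier[OF g] L_carrier[OF x] L_carrier[OF \<phi>_in[OF h]] A
      by (simp add: cmat_mult[of _ n] mult_carrier_mat[of _ n n _ n] cassoc cclosed)
    also have "\<dots> = c \<cdot>\<^sub>m (cmat g * (cmat x * A * cmat h))"
      using car A(1) unfolding c(2)
      by (simp add: mult_smult_distrib[of _ n n _ n] cassoc cclosed)
    finally have "tr (cmat (g * x * \<phi> h) * A) = c * tr (cmat g * (cmat x * A * cmat h))"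
      using car A by (simp add: tr_smult[of _ n] cclosed)
    also have "\<dots> = c * tr (cmat x * A)"
      by (simp only: tr_conj[OF car(1,2) cclosed[OF car(3) A(1)] hg])
    finally show ?thesis
      by (simp add: f_def power_mult_distrib c(1))
  qed
  moreover have "infinite (f ` L)"
  proof -
    have "\<exists>x0\<in>L. \<exists>i<n. \<exists>j<n. i \<noteq> j \<and> (cmat x0 * A) $$ (j, i) \<noteq> 0"
    proof (cases "\<exists>i<n. \<exists>j<n. i \<noteq> j \<and> A $$ (j, i) \<noteq> 0")
      case True
      then show ?thesis
        using L_one A by (intro bexI[of _ "1\<^sub>m n"]) (simp_all add: cmat_one)
    next
      case False
      \<comment> \<open>Here \<open>A\<close> is diagonal and invertible, so
        \<open>A_00 \<noteq> 0\<close>, and the row operation by \<open>E 1 0\<close> copies a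
        multiple of it to position (1, 0).\<close>
      have nz: "0 < n" "1 < n"
        using n3 by auto
      obtain k where k: "k < n" "A $$ (0, k) * B $$ (k, 0) \<noteq> 0"
        using invertible_entry[OF A(1-3) nz(1)] by blast
      then have "k = 0"
        using False nz by (metis mult_zero_left)
      then have "A $$ (0, 0) \<noteq> 0"
        using k by auto
      moreover have "A $$ (1, 0) = 0"
        using False nz by (metis zero_neq_one)
      ultimately have "(cmat (E 1 0) * A) $$ (1, 0) \<noteq> 0"
        unfolding cmat_elem elem_mult_index[OF A(1) nz(2,1) nz(2,1)] using M_pos by simp
      then show ?thesis
        using E_in(2)[of 1 0] nz by (intro bexI[of _ "E 1 0"] exI[of _ 0] exI[of _ 1]) auto
    qed
    then obtain x0 i j where x0: "x0 \<in> L" and ij: "i < n" "j < n" "i \<noteq> j" and nz: "(cmat x0 * A) $$ (j, i) \<noteq> 0"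
      by blast
    let ?Z = "cmat x0 * A"
    have Z: "?Z \<in> carrier_mat n n"
      using L_carrier[OF x0] A by (simp add: cclosed)
    define p where "p = [:tr ?Z, of_int M * ?Z $$ (j, i):] ^ n"
    have "f (elem_mat n i j (M * int k) * x0) = poly p (of_nat k)" for k
    proof -
      have "cmat (elem_mat n i j (M * int k) * x0) * A = elem_mat n i j (of_int (M * int k)) * ?Z"
        using L_carrier[OF x0] A by (simp add: cmat_mult[of _ n] cmat_elem cassoc)
      then show ?thesis
        unfolding f_def p_def using tr_elem_mult[OF Z ij(1,2)] by (simp add: poly_power mult_ac)
    qed
    then have "range (\<lambda>k. poly p (of_nat k)) \<subseteq> f ` L"
      using L_mult[OF E_in(1)[OF ij] x0] by (metis image_subsetI imageI)
    moreover have "degree p > 0"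
      using nz M_pos n3 by (simp add: p_def degree_power_eq)
    ultimately show ?thesis
      using infinite_polynomial_values finite_subset by blast
  qed
  ultimately show ?thesis
    by (intro exI[of _ f]) blast
qed

lemma contragredient_mult:
  assumes "x \<in> L" "y \<in> L"
  shows "contragredient (x * y) = contragredient x * contragredient y"
proof -
  have x: "x \<in> carrier_mat n n" "det x = 1" and y: "y \<in> carrier_mat n n" "det y = 1"
    using assms L_carrier L_det by auto
  show ?thesis
    unfolding contragredient_def adj_mat_mult[OF x y] cmat_mult[OF adj_mat_SL(1)[OF y] adj_mat_SL(1)[OF x]]
    by (rule transpose_mult[of _ n n _ n]) (use adj_mat_SL(1)[OF x] adj_mat_SL(1)[OF y] in auto)
qed

lemma contragredient_elem:
  assumes "i < n" "j < n" "i \<noteq> j" "elem_mat n i j t \<in> L"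
  shows "contragredient (elem_mat n i j t) = elem_mat n j i (- of_int t)"
proof -
  have "adj_mat (elem_mat n i j t) = elem_mat n i j (- t)"
    by (rule adj_mat_eqI[OF elem_carrier elem_carrier elem_inverse(1)[OF assms(1-3)] L_det[OF assms(4)]])
  then show ?thesis
    by (simp add: contragredient_def cmat_elem transpose_elem)
qed

text \<open>With \<open>h = g^-1\<close> the relation reads \<open>\<phi>(h) A = c A g^T\<close>, so
  \<open>Z = x A\<close> changes to \<open>c g Z g^T\<close> and \<open>Z^-1 Z^T\<close> to its
  conjugate by \<open>g^-T\<close>. Its trace takes infinitely many values because it is quadratic
  in \<open>s\<close> along \<open>E_ij(s) x\<close>, with leading coefficient
  \<open>- (Z^-1)_ii Z_jj\<close>; the work lies in making this product nonzero.\<close>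

lemma contragredient_case:
  assumes A: "A \<in> carrier_mat n n" "B \<in> carrier_mat n n" "A * B = 1\<^sub>m n" "B * A = 1\<^sub>m n"
    and inter: "\<And>i j. i < n \<Longrightarrow> j < n \<Longrightarrow> i \<noteq> j \<Longrightarrow> cmat (\<phi> (E i j)) * A = A * elem_mat n j i (- of_int M)"
  shows "\<exists>f :: int mat \<Rightarrow> complex. (\<forall>g\<in>L. \<forall>h\<in>L. \<forall>x\<in>L. g * h = 1\<^sub>m n \<longrightarrow> f (g * x * \<phi> h) = f x) \<and> infinite (f ` L)"
proof -
  define Z where "Z = (\<lambda>x. cmat x * A)"
  define R where "R = (\<lambda>x. B * cmat (adj_mat x))"
  define f where "f = (\<lambda>x. tr (R x * transpose_mat (Z x)))"
  have adj: "adj_mat x \<in> carrier_mat n n" "x * adj_mat x = 1\<^sub>m n" "adj_mat x * x = 1\<^sub>m n" if "x \<in> L" for x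
    using adj_mat_SL L_carrier L_det that by auto
  have car: "Z x \<in> carrier_mat n n" "R x \<in> carrier_mat n n" if "x \<in> L" for x
    using A adj[OF that] L_carrier[OF that] by (auto simp: Z_def R_def cclosed)
  have "f (g * x * \<phi> h) = f x" if g: "g \<in> L" and h: "h \<in> L" and x: "x \<in> L" and gh: "g * h = 1\<^sub>m n" for g h x
  proof -
    have "\<exists>c. c ^ n = 1 \<and> cmat (\<phi> h) * A = c \<cdot>\<^sub>m (A * contragredient h)"
    proof (rule rigidity[OF A _ _ _ _ _ _ h])
      fix C :: "complex mat"
      assume C: "C \<in> carrier_mat n n" "\<And>i j. i < n \<Longrightarrow> j < n \<Longrightarrow> i \<noteq> j \<Longrightarrow>
        \<exists>k. k \<noteq> 0 \<and> C * contragredient (elem_mat n i j (M * k)) = contragredient (elem_mat n i j (M * k)) * C"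
      show "\<exists>c. C = c \<cdot>\<^sub>m 1\<^sub>m n"
      proof (rule commutes_elem_imp_scalar[OF C(1)])
        fix i j assume ij: "i < n" "j < n" "i \<noteq> j"
        then obtain k where "k \<noteq> 0" "C * elem_mat n i j (- of_int (M * k)) = elem_mat n i j (- of_int (M * k)) * C"
          using C(2)[of j i] contragredient_elem[of j i, OF _ _ _ E_in(1)] by auto
        then show "\<exists>t. t \<noteq> 0 \<and> C * elem_mat n i j t = elem_mat n i j t * C"
          using M_pos by (intro exI[of _ "- of_int (M * k)"]) simp
      qed (use n3 in simp)
    next
      show "contragredient (1\<^sub>m n) = 1\<^sub>m n"
        using adj_mat_eqI[of "1\<^sub>m n" n "1\<^sub>m n"] by (simp add: contragredient_def cmat_one)
      show "det (contragredient y) = 1" if y: "y \<in> L" for y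
      proof -
        have "det y * det (adj_mat y) = 1"
          using det_mult[OF L_carrier[OF y] adj(1)[OF y]] adj(2)[OF y] by simp
        then have "det (adj_mat y) = 1"
          by (simp add: L_det[OF y])
        moreover have "det (contragredient y) = det (cmat (adj_mat y))"
          unfolding contragredient_def by (rule det_transpose[of _ n]) (use adj(1)[OF y] in simp)
        ultimately show ?thesis
          by simp
      qed
      show "contragredient y \<in> carrier_mat n n" if "y \<in> L" for y
        using adj(1)[OF that] by (simp add: contragredient_def)
      show "contragredient (y * z) = contragredient y * contragredient z" if "y \<in> L" "z \<in> L" for y z
        using that by (rule contragredient_mult)
      show "cmat (\<phi> (E i j)) * A = A * contragredient (E i j)" if "i < n" "j < n" "i \<noteq> j" for i j
        using inter that contragredient_elem[OF that E_in(2)[OF that]] by simp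
    qed
    then obtain c where c: "c ^ n = 1" "cmat (\<phi> h) * A = c \<cdot>\<^sub>m (A * contragredient h)"
      by blast
    have gc: "g \<in> carrier_mat n n" "h \<in> carrier_mat n n" "x \<in> carrier_mat n n" "\<phi> h \<in> carrier_mat n n"
      using L_carrier g h x \<phi>_carrier by auto
    have ag: "adj_mat g = h"
      by (rule adj_mat_eqI[OF gc(1,2) gh L_det[OF g]])
    then have hg: "h * g = 1\<^sub>m n"
      using adj(3)[OF g] by simp
    have ah: "adj_mat h = g"
      by (rule adj_mat_eqI[OF gc(2,1) hg L_det[OF h]])
    have phi_gh: "\<phi> h * \<phi> g = 1\<^sub>m n"
      using \<phi>_mult[OF h g] by (simp add: hg \<phi>_one)
    have aph: "adj_mat (\<phi> h) = \<phi> g"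
      by (rule adj_mat_eqI[OF gc(4) \<phi>_carrier[OF g] phi_gh L_det[OF \<phi>_in[OF h]]])
    let ?g = "cmat g" and ?h = "cmat h" and ?P = "cmat (\<phi> g)" and ?Q = "cmat (\<phi> h)"
    let ?gt = "transpose_mat ?g" and ?ht = "transpose_mat ?h"
    have cc: "?g \<in> carrier_mat n n" "?h \<in> carrier_mat n n" "?P \<in> carrier_mat n n" "?Q \<in> carrier_mat n n"
      "?gt \<in> carrier_mat n n" "?ht \<in> carrier_mat n n"
      using gc \<phi>_carrier[OF g] by auto
    have QA: "?Q * A = c \<cdot>\<^sub>m (A * ?gt)"
      using c(2) by (simp add: contragredient_def ah)
    have "?g * ?h = 1\<^sub>m n"
      using cmat_mult[OF gc(1,2)] gh cmat_one by simp
    then have htgt: "?ht * ?gt = 1\<^sub>m n"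
      using transpose_mult[OF cc(1,2)] by simp
    have "?h * ?g = 1\<^sub>m n"
      using cmat_mult[OF gc(2,1)] hg cmat_one by simp
    then have gtht: "?gt * ?ht = 1\<^sub>m n"
      using transpose_mult[OF cc(2,1)] by simp
    have QP: "?Q * ?P = 1\<^sub>m n"
      by (rule cmat_phi_inverse[OF h g hg])
    \<comment> \<open>The inverse form of \<open>QA\<close>, arranged so that \<open>c\<close> is
      not inverted.\<close>
    have BP: "c \<cdot>\<^sub>m (B * ?P) = ?ht * B"
    proof -
      have "?ht * B = ?ht * (B * (?Q * (A * (B * ?P))))"
        using cc A QP by (simp add: ccancel cclosed)
      also have "\<dots> = ?ht * (B * (?Q * A * (B * ?P)))"
        using cc A by (simp add: cassoc cclosed)
      also have "\<dots> = c \<cdot>\<^sub>m (?ht * (B * (A * (?gt * (B * ?P)))))"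
        using cc A unfolding QA
        by (simp add: mult_smult_distrib[of _ n n _ n] mult_smult_assoc_mat[of _ n n _ n] cassoc cclosed)
      also have "\<dots> = c \<cdot>\<^sub>m (B * ?P)"
        using cc A htgt by (simp add: ccancel cclosed)
      finally show ?thesis ..
    qed
    have gx: "g * x \<in> L" "\<phi> h \<in> L"
      using g x L_mult \<phi>_in[OF h] by auto
    have gx_SL: "g * x \<in> carrier_mat n n" "det (g * x) = 1" "\<phi> h \<in> carrier_mat n n" "det (\<phi> h) = 1"
      using L_carrier L_det gx by auto
    have "adj_mat (g * x * \<phi> h) = \<phi> g * (adj_mat x * h)"
      unfolding adj_mat_mult[OF gx_SL] adj_mat_mult[OF gc(1) L_det[OF g] gc(3) L_det[OF x]] aph ag ..
    then have R_y: "R (g * x * \<phi> h) = B * ?P * (cmat (adj_mat x) * ?h)"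
      using \<phi>_carrier[OF g] adj(1)[OF x] gc A
      by (simp add: R_def cmat_mult[of _ n] mult_carrier_mat[of _ n n _ n] cassoc cclosed)
    have Z_y: "transpose_mat (Z (g * x * \<phi> h)) = c \<cdot>\<^sub>m (?g * (transpose_mat (Z x) * ?gt))"
    proof -
      have "Z (g * x * \<phi> h) = ?g * (cmat x * (?Q * A))"
        using gc A by (simp add: Z_def cmat_mult[of _ n] mult_carrier_mat[of _ n n _ n] cassoc cclosed)
      also have "\<dots> = c \<cdot>\<^sub>m (?g * (Z x * ?gt))"
        using gc cc A unfolding QA Z_def
        by (simp add: mult_smult_distrib[of _ n n _ n] cassoc cclosed)
      finally have "transpose_mat (Z (g * x * \<phi> h)) = c \<cdot>\<^sub>m transpose_mat (?g * (Z x * ?gt))"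
        by (auto intro!: eq_matI)
      also have "transpose_mat (?g * (Z x * ?gt)) = transpose_mat (Z x * ?gt) * ?gt"
        by (rule transpose_mult[OF cc(1) cclosed[OF car(1)[OF x] cc(5)]])
      also have "transpose_mat (Z x * ?gt) = ?g * transpose_mat (Z x)"
        using transpose_mult[OF car(1)[OF x] cc(5)] by simp
      also have "?g * transpose_mat (Z x) * ?gt = ?g * (transpose_mat (Z x) * ?gt)"
        using cc car(1)[OF x] by (simp add: cassoc)
      finally show ?thesis .
    qed
    let ?Zt = "transpose_mat (Z x)" and ?a = "cmat (adj_mat x)"
    have Zt: "?Zt \<in> carrier_mat n n" and a: "?a \<in> carrier_mat n n"
      using car(1)[OF x] adj(1)[OF x] by auto
    have "R (g * x * \<phi> h) * transpose_mat (Z (g * x * \<phi> h))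
        = c \<cdot>\<^sub>m (B * ?P) * (?a * (?h * (?g * (?Zt * ?gt))))"
      unfolding R_y Z_y using cc Zt a A
      by (simp add: mult_smult_distrib[of _ n n _ n] mult_smult_assoc_mat[of _ n n _ n] cassoc cclosed)
    also have "\<dots> = ?ht * (R x * ?Zt * ?gt)"
      unfolding BP R_def using cc Zt a A \<open>?h * ?g = 1\<^sub>m n\<close>
      by (simp add: ccancel cassoc cclosed)
    finally show ?thesis
      unfolding f_def using tr_conj[OF cc(6,5) cclosed[OF car(2)[OF x] Zt] gtht] by simp
  qed
  moreover have "infinite (f ` L)"
  proof -
    have inv: "R x * Z x = 1\<^sub>m n" if "x \<in> L" for x
    proof -
      have "cmat (adj_mat x) * cmat x = 1\<^sub>m n"
        using cmat_mult[OF adj(1)[OF that] L_carrier[OF that]] adj(3)[OF that] cmat_one by simp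
      then show ?thesis
        using A adj(1)[OF that] L_carrier[OF that] unfolding R_def Z_def
        by (simp add: ccancel cassoc cclosed)
    qed
    have adj_E: "adj_mat (elem_mat n i j (M * k) * x) = adj_mat x * elem_mat n i j (- (M * k))"
      if "x \<in> L" "i < n" "j < n" "i \<noteq> j" for i j k x
      using adj_mat_mult[OF elem_carrier L_det[OF E_in(1)[OF that(2-4)]] L_carrier[OF that(1)] L_det[OF that(1)]]
        adj_mat_eqI[OF elem_carrier elem_carrier elem_inverse(1)[OF that(2-4)] L_det[OF E_in(1)[OF that(2-4)]]]
      by simp
    have Z_E: "Z (elem_mat n i j (M * k) * x) = elem_mat n i j (of_int (M * k)) * Z x"
      and R_E: "R (elem_mat n i j (M * k) * x) = R x * elem_mat n i j (- of_int (M * k))"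
      if "x \<in> L" "i < n" "j < n" "i \<noteq> j" for i j k x
      using A L_carrier[OF that(1)] adj(1)[OF that(1)] adj_E[OF that]
      by (simp_all add: Z_def R_def cmat_mult[of _ n] cmat_elem cassoc)
    have n012: "0 < n" "1 < n" "2 < n"
      using n3 by auto
    \<comment> \<open>Passing from \<open>x\<close> to \<open>E_ki(M) x\<close> subtracts
      \<open>M\<close> times column \<open>k\<close> of \<open>R\<close> from column
      \<open>i\<close>, which makes the entry (i, i) nonzero, and changes only row
      \<open>k \<noteq> 0\<close> of \<open>Z\<close>, so the corner entry is kept.\<close>
    have step: "\<exists>y\<in>L. Z y $$ (0, 0) \<noteq> 0 \<and> R y $$ (i, i) \<noteq> 0"
      if x: "x \<in> L" "Z x $$ (0, 0) \<noteq> 0" and i: "i < n" "i \<noteq> 0" and k: "k < n" "k \<noteq> 0" "R x $$ (i, k) \<noteq> 0" for x i k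
    proof (cases "R x $$ (i, i) = 0")
      case True
      then have ki: "k \<noteq> i"
        using k by auto
      have "Z (elem_mat n k i (M * 1) * x) $$ (0, 0) \<noteq> 0"
        unfolding Z_E[OF x(1) k(1) i(1) ki] elem_mult_index[OF car(1)[OF x(1)] k(1) i(1) n012(1,1)]
        using x k by simp
      moreover have "R (elem_mat n k i (M * 1) * x) $$ (i, i) \<noteq> 0"
        unfolding R_E[OF x(1) k(1) i(1) ki] mult_elem_index[OF car(2)[OF x(1)] k(1) i(1) i(1,1)]
        using True k M_pos by simp
      ultimately show ?thesis
        using L_mult[OF E_in(1)[OF k(1) i(1) ki] x(1)] by blast
    qed (use x in blast)
    \<comment> \<open>If the corner of \<open>A\<close> vanishes, a row operation adds a multiple of
      a nonzero entry of column 0 to it.\<close>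
    obtain x1 where x1: "x1 \<in> L" "Z x1 $$ (0, 0) \<noteq> 0"
    proof (cases "A $$ (0, 0) = 0")
      case True
      obtain k where k: "k < n" "B $$ (0, k) * A $$ (k, 0) \<noteq> 0"
        using invertible_entry[OF A(2,1,4) n012(1)] by blast
      then have k0: "0 \<noteq> k"
        using True by (cases "k = 0") auto
      have "Z (elem_mat n 0 k (M * 1) * 1\<^sub>m n) $$ (0, 0) \<noteq> 0"
        unfolding Z_E[OF L_one n012(1) k(1) k0] elem_mult_index[OF car(1)[OF L_one] n012(1) k(1) n012(1,1)]
        using True k M_pos A by (simp add: Z_def cmat_one)
      then show thesis
        using that L_mult[OF E_in(1)[OF n012(1) k(1) k0] L_one] by blast
    next
      case False
      then show thesis
        using that[OF L_one] A by (simp add: Z_def cmat_one)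
    qed
    \<comment> \<open>Otherwise rows 1 and 2 of \<open>R x1\<close> would both be supported in
      column 0 and hence proportional, contradicting invertibility; this uses
      \<open>n \<ge> 3\<close>.\<close>
    have "\<exists>i k. i < n \<and> i \<noteq> 0 \<and> k < n \<and> k \<noteq> 0 \<and> R x1 $$ (i, k) \<noteq> 0"
    proof (rule ccontr)
      assume none: "\<not> ?thesis"
      have entry: "R x1 $$ (i, 0) * Z x1 $$ (0, j) = of_bool (i = j)" if "i < n" "i \<noteq> 0" "j < n" for i j
      proof -
        have "of_bool (i = j) = (R x1 * Z x1) $$ (i, j)"
          using that by (simp add: inv[OF x1(1)])
        also have "\<dots> = (\<Sum>k\<in>{0}. R x1 $$ (i, k) * Z x1 $$ (k, j))"
          unfolding mult_index[OF car(2)[OF x1(1)] car(1)[OF x1(1)] that(1,3)]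
          by (rule sum.mono_neutral_right) (use none that n012 in auto)
        finally show ?thesis by simp
      qed
      show False
        using entry[of 1 1] entry[of 1 2] entry[of 2 2] n012 by auto
    qed
    then obtain i x0 where x0: "x0 \<in> L" "Z x0 $$ (0, 0) \<noteq> 0" "R x0 $$ (i, i) \<noteq> 0" and i: "i < n" "i \<noteq> 0"
      using step[OF x1] by blast
    obtain \<beta> where \<beta>: "\<And>s. tr (R x0 * elem_mat n i 0 (- s) * (transpose_mat (Z x0) * elem_mat n 0 i s))
        = tr (R x0 * transpose_mat (Z x0)) + s * \<beta> - s\<^sup>2 * (R x0 $$ (i, i) * Z x0 $$ (0, 0))"
      using tr_elem_conj_transpose[OF car(1,2)[OF x0(1)] i(1) n012(1)] by blast
    \<comment> \<open>The leading coefficient is nonzero by the choice of \<open>x0\<close>.\<close>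
    define p where "p = [:f x0, of_int M * \<beta>, - ((of_int M)\<^sup>2 * (R x0 $$ (i, i) * Z x0 $$ (0, 0))):]"
    have "f (elem_mat n i 0 (M * int k) * x0) = poly p (of_nat k)" for k
    proof -
      have "transpose_mat (Z (elem_mat n i 0 (M * int k) * x0))
          = transpose_mat (Z x0) * elem_mat n 0 i (of_int (M * int k))"
        unfolding Z_E[OF x0(1) i(1) n012(1) i(2)] transpose_mult[OF elem_carrier car(1)[OF x0(1)]]
        by (simp only: transpose_elem)
      then have "f (elem_mat n i 0 (M * int k) * x0)
          = f x0 + of_int (M * int k) * \<beta> - (of_int (M * int k))\<^sup>2 * (R x0 $$ (i, i) * Z x0 $$ (0, 0))"
        unfolding f_def R_E[OF x0(1) i(1) n012(1) i(2)] by (simp only: \<beta>)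
      then show ?thesis
        by (simp add: p_def algebra_simps power2_eq_square)
    qed
    then have "range (\<lambda>k. poly p (of_nat k)) \<subseteq> f ` L"
      using L_mult[OF E_in(1)[OF i(1) n012(1) i(2)] x0(1)] by (metis image_subsetI imageI)
    moreover have "degree p > 0"
      using x0 M_pos by (simp add: p_def)
    ultimately show ?thesis
      using infinite_polynomial_values finite_subset by blast
  qed
  ultimately show ?thesis
    by (intro exI[of _ f]) blast
qed

theorem twisted_invariant_exists:
  "\<exists>f :: int mat \<Rightarrow> complex. (\<forall>g\<in>L. \<forall>h\<in>L. \<forall>x\<in>L. g * h = 1\<^sub>m n \<longrightarrow> f (g * x * \<phi> h) = f x) \<and> infinite (f ` L)"
  using intertwiner_exists standard_case contragredient_case by blast

end

section \<open>Translation into Reidemeister numbers\<close>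

theorem theorem3p2:
  fixes n :: nat and \<Lambda> :: "int mat set"
  assumes "n \<ge> 3"
    and "\<Lambda> \<lhd> SL_int n"
    and "\<not> \<Lambda> \<subseteq> group_center (SL_int n)"
  shows "R_infinity_property (SL_int n\<lparr>carrier := \<Lambda>\<rparr>)"
proof -
  interpret SL: Group.group "SL_int n"
    by (rule group_SL_int)
  have sub: "subgroup \<Lambda> (SL_int n)"
    using assms(2) by (rule normal_imp_subgroup)
  have car: "carrier (SL_int n) = {A \<in> carrier_mat n n. det A = 1}"
    and mult: "x \<otimes>\<^bsub>SL_int n\<^esub> y = x * y" and one: "\<one>\<^bsub>SL_int n\<^esub> = 1\<^sub>m n" for x y
    by (simp_all add: SL_int_def)
  let ?G = "SL_int n\<lparr>carrier := \<Lambda>\<rparr>"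
  have grpG: "Group.group ?G"
    by (rule SL.subgroup_imp_group[OF sub])
  have \<Lambda>_car: "x \<in> carrier_mat n n" "det x = 1" if "x \<in> \<Lambda>" for x
    using subgroup.subset[OF sub] that by (auto simp: car)
  have inv_SL: "inv\<^bsub>SL_int n\<^esub> x * x = 1\<^sub>m n" "x * inv\<^bsub>SL_int n\<^esub> x = 1\<^sub>m n" if "x \<in> carrier (SL_int n)" for x
    using SL.l_inv[OF that] SL.r_inv[OF that] by (simp_all add: mult one)
  interpret N: normal_in_SL n \<Lambda>
  proof
    show "n \<ge> 3" by (rule assms(1))
    show "x \<in> carrier_mat n n" if "x \<in> \<Lambda>" for x
      using \<Lambda>_car that by blast
    show "x * y \<in> \<Lambda>" if "x \<in> \<Lambda>" "y \<in> \<Lambda>" for x y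
      using subgroup.m_closed[OF sub that] by (simp add: mult)
    show "\<exists>y\<in>\<Lambda>. x * y = 1\<^sub>m n \<and> y * x = 1\<^sub>m n" if "x \<in> \<Lambda>" for x
      using inv_SL[of x] subgroup.m_inv_closed[OF sub that] subgroup.subset[OF sub] that by blast
    show "g * x * h \<in> \<Lambda>" if x: "x \<in> \<Lambda>" and g: "g \<in> carrier_mat n n" "h \<in> carrier_mat n n" "det g = 1"
      "g * h = 1\<^sub>m n" for x g h
    proof -
      have gS: "g \<in> carrier (SL_int n)"
        using g by (simp add: car)
      have "det h = 1"
        using det_mult[OF g(1,2)] g by simp
      then have hS: "h \<in> carrier (SL_int n)"
        using g by (simp add: car)
      have "inv\<^bsub>SL_int n\<^esub> g = h"
        using SL.inv_equality[of h g] SL.inv_comm[of g h] g(4) gS hS by (simp add: mult one)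
      then show ?thesis
        using SL.normal_invE(2)[OF assms(2) gS x] by (simp add: mult)
    qed
  qed
  obtain x where x: "x \<in> \<Lambda>" "x \<notin> group_center (SL_int n)"
    using assms(3) by blast
  \<comment> \<open>An element commuting with all \<open>E_ij(2)\<close> is scalar and thus central.
    The entry 2 matches the doubled transvections, whose determinant is known to be 1.\<close>
  have "\<exists>i j. i < n \<and> j < n \<and> i \<noteq> j \<and> x * elem_mat n i j 2 \<noteq> elem_mat n i j 2 * x"
  proof (rule ccontr)
    assume "\<not> ?thesis"
    then obtain c where c: "x = c \<cdot>\<^sub>m 1\<^sub>m n"
      using commutes_elem_imp_scalar[OF \<Lambda>_car(1)[OF x(1)]] assms(1)
      by (metis Suc_leD eval_nat_numeral(3) zero_neq_numeral)
    have "x * g = g * x" if "g \<in> carrier_mat n n" for g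
      unfolding c using that by (simp add: mult_smult_distrib[of _ n n _ n] mult_smult_assoc_mat[of _ n n _ n])
    then have "x \<in> group_center (SL_int n)"
      using \<Lambda>_car[OF x(1)] by (simp add: group_center_def car mult)
    with x(2) show False ..
  qed
  then obtain i j where ij: "i < n" "j < n" "i \<noteq> j" and ne: "x * elem_mat n i j 2 \<noteq> elem_mat n i j 2 * x"
    by blast
  obtain m where m: "m > 0" "\<And>i j k. i < n \<Longrightarrow> j < n \<Longrightarrow> i \<noteq> j \<Longrightarrow> elem_mat n i j (m * k) \<in> \<Lambda>"
    using N.contains_level[OF x(1) ij ne] by blast
  show ?thesis
    unfolding R_infinity_property_def
  proof
    fix \<phi> assume \<phi>: "\<phi> \<in> iso ?G ?G"
    then have hom: "\<phi> \<in> hom ?G ?G" and bij: "bij_betw \<phi> \<Lambda> \<Lambda>"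
      by (auto simp: iso_def)
    interpret injective_endo n \<Lambda> \<phi> m
    proof
      show "\<phi> x \<in> \<Lambda>" if "x \<in> \<Lambda>" for x
        using bij_betwE[OF bij] that by blast
      show "\<phi> (x * y) = \<phi> x * \<phi> y" if "x \<in> \<Lambda>" "y \<in> \<Lambda>" for x y
        using hom_mult[OF hom, of x y] that by (simp add: mult)
      show "inj_on \<phi> \<Lambda>"
        using bij by (rule bij_betw_imp_inj_on)
    qed (use m \<Lambda>_car in auto)
    obtain f :: "int mat \<Rightarrow> complex" where f: "\<And>g h x. g \<in> \<Lambda> \<Longrightarrow> h \<in> \<Lambda> \<Longrightarrow> x \<in> \<Lambda> \<Longrightarrow> g * h = 1\<^sub>m n \<Longrightarrow> f (g * x * \<phi> h) = f x"
      and inf: "infinite (f ` \<Lambda>)"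
      using twisted_invariant_exists by blast
    have "infinite (twisted_conjugacy_classes ?G \<phi>)"
    proof
      assume fin: "finite (twisted_conjugacy_classes ?G \<phi>)"
      \<comment> \<open>\<open>f\<close> is constant on classes, so its values are recovered from
        one chosen representative of each class.\<close>
      have "f ` \<Lambda> \<subseteq> (\<lambda>C. f (SOME x. x \<in> C)) ` twisted_conjugacy_classes ?G \<phi>"
      proof
        fix z assume "z \<in> f ` \<Lambda>"
        then obtain y where y: "y \<in> \<Lambda>" "z = f y" by blast
        let ?C = "orbit ?G (twisted_action ?G \<phi>) y"
        interpret ga: group_action ?G \<Lambda> "twisted_action ?G \<phi>"
          using group.group_action_twisted_action[OF grpG hom] by simp
        have "y \<in> ?C"
          using y(1) by (rule ga.orbit_refl)
        then have "(SOME x. x \<in> ?C) \<in> ?C"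
          by (rule someI)
        then obtain g where g: "g \<in> \<Lambda>" "(SOME x. x \<in> ?C) = twisted_action ?G \<phi> g y"
          by (auto simp: orbit_def)
        let ?h = "inv\<^bsub>?G\<^esub> g"
        have h: "?h \<in> \<Lambda>" "g * ?h = 1\<^sub>m n"
          using Group.group.inv_closed[OF grpG, of g] Group.group.r_inv[OF grpG, of g] g(1)
          by (simp_all add: mult one)
        have "twisted_action ?G \<phi> g y = g * y * \<phi> ?h"
          using y(1) by (simp add: twisted_action_def mult)
        then have "f (SOME x. x \<in> ?C) = f (g * y * \<phi> ?h)"
          unfolding g(2) by (rule arg_cong)
        also have "\<dots> = z"
          using f[OF g(1) h(1) y(1) h(2)] y(2) by simp
        finally have "z = f (SOME x. x \<in> ?C)" ..
        moreover have "?C \<in> twisted_conjugacy_classes ?G \<phi>"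
          using y(1) by (auto simp: twisted_conjugacy_classes_def orbits_def)
        ultimately show "z \<in> (\<lambda>C. f (SOME x. x \<in> C)) ` twisted_conjugacy_classes ?G \<phi>"
          by blast
      qed
      with fin inf show False
        using finite_subset finite_imageI by blast
    qed
    then show "reidemeister_number ?G \<phi> = \<infinity>"
      by (simp add: reidemeister_number_def)
  qed
qed

end
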